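(* Let $\mathcal{L}$ be the category whose objects are natural numbers and whose morphisms $m\to n$ are the total injective increasing functions $[m]\to[n]$, and let $\mathcal{P}$ be its free conservative finite cocompletion. Then $\mathcal{P}$ is equivalent to the full subcategory of the category of graphs whose objects are the finite graphs such that for every non-empty path from a vertex $x$ to a vertex $y$ there exists exactly one edge $x\to y$. Equivalently, $\mathcal{P}$ is equivalent to the category whose objects are finite sets equipped with a transitive relation $<$, and whose morphisms are the functions $f$ respecting the relations (i.e. $a<a'$ implies $f(a)<f(a')$).
   Context: For $n\in\mathbb{N}$ write $[n]=\{0,\dots,n-1\}$. A graph consists of a set of vertices, a set of edges, and source and target functions from edges to vertices; morphisms of graphs are pairs of functions on vertices and edges commuting with source and target. A path of length $k\ge1$ from $x$ to $y$ is a sequence of $k$ edges, each one's target being the next one's source, starting at $x$ and ending at $y$. The free conservative finite cocompletion of $\mathcal{L}$ is (up to equivalence) the unique finitely cocomplete category $\mathcal{P}$ together with an embedding functor $y:\mathcal{L}\to\mathcal{P}$ preserving those finite colimits which exist in $\mathcal{L}$, such that for every finitely cocomplete category $\mathcal{C}$ and every functor $F:\mathcal{L}\to\mathcal{C}$ preserving the finite colimits existing in $\mathcal{L}$, there is, up to unique isomorphism, a unique finite-colimit-preserving functor $\tilde F:\mathcal{P}\to\mathcal{C}$ with $\tilde F\circ y=F$. *)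

theory Defs
  imports
    "HOL-Library.FuncSet"
    "HOL-Library.Infinite_Typeclass"
    "Graph_Theory.Arc_Walk"
begin

record ('o, 'm) category =
  Ob :: "'o set"
  Ar :: "'m set"
  Dom :: "'m \<Rightarrow> 'o"
  Cod :: "'m \<Rightarrow> 'o"
  Id :: "'o \<Rightarrow> 'm"
  Comp :: "'m \<Rightarrow> 'm \<Rightarrow> 'm"  \<comment> \<open>\<open>Comp C g f\<close> is \<open>g\<close> after \<open>f\<close>\<close>

definition Hom :: "('o, 'm) category \<Rightarrow> 'o \<Rightarrow> 'o \<Rightarrow> 'm set" where
  "Hom C x y = {f \<in> Ar C. Dom C f = x \<and> Cod C f = y}"

definition is_category :: "('o, 'm) category \<Rightarrow> bool" where
  "is_category C \<longleftrightarrow>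
     (\<forall>f \<in> Ar C. Dom C f \<in> Ob C \<and> Cod C f \<in> Ob C) \<and>
     (\<forall>x \<in> Ob C. Id C x \<in> Hom C x x) \<and>
     (\<forall>x y z. \<forall>f \<in> Hom C x y. \<forall>g \<in> Hom C y z. Comp C g f \<in> Hom C x z) \<and>
     (\<forall>x y. \<forall>f \<in> Hom C x y. Comp C f (Id C x) = f \<and> Comp C (Id C y) f = f) \<and>
     (\<forall>w x y z. \<forall>f \<in> Hom C w x. \<forall>g \<in> Hom C x y. \<forall>h \<in> Hom C y z.
        Comp C h (Comp C g f) = Comp C (Comp C h g) f)"

definition is_iso :: "('o, 'm) category \<Rightarrow> 'm \<Rightarrow> bool" where
  "is_iso C f \<longleftrightarrow> f \<in> Ar C \<and>
     (\<exists>g \<in> Hom C (Cod C f) (Dom C f).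
        Comp C g f = Id C (Dom C f) \<and> Comp C f g = Id C (Cod C f))"

definition full_subcategory :: "('o, 'm) category \<Rightarrow> ('o \<Rightarrow> bool) \<Rightarrow> ('o, 'm) category" where
  "full_subcategory C Q =
     C\<lparr>Ob := {x \<in> Ob C. Q x}, Ar := {f \<in> Ar C. Q (Dom C f) \<and> Q (Cod C f)}\<rparr>"

record ('o1, 'm1, 'o2, 'm2) functor_data =
  obj_map :: "'o1 \<Rightarrow> 'o2"
  arr_map :: "'m1 \<Rightarrow> 'm2"

definition is_functor ::
    "('o1, 'm1) category \<Rightarrow> ('o2, 'm2) category \<Rightarrow> ('o1, 'm1, 'o2, 'm2) functor_data \<Rightarrow> bool" where
  "is_functor A B F \<longleftrightarrow>
     (\<forall>x \<in> Ob A. obj_map F x \<in> Ob B) \<and>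
     (\<forall>x y. \<forall>f \<in> Hom A x y. arr_map F f \<in> Hom B (obj_map F x) (obj_map F y)) \<and>
     (\<forall>x \<in> Ob A. arr_map F (Id A x) = Id B (obj_map F x)) \<and>
     (\<forall>x y z. \<forall>f \<in> Hom A x y. \<forall>g \<in> Hom A y z.
        arr_map F (Comp A g f) = Comp B (arr_map F g) (arr_map F f))"

definition id_functor :: "('o, 'm, 'o, 'm) functor_data" where
  "id_functor = \<lparr>obj_map = (\<lambda>x. x), arr_map = (\<lambda>f. f)\<rparr>"

definition functor_comp ::
    "('o2, 'm2, 'o3, 'm3) functor_data \<Rightarrow> ('o1, 'm1, 'o2, 'm2) functor_data
      \<Rightarrow> ('o1, 'm1, 'o3, 'm3) functor_data" (infixl "\<circ>\<^sub>F" 55) where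
  "G \<circ>\<^sub>F F = \<lparr>obj_map = obj_map G \<circ> obj_map F, arr_map = arr_map G \<circ> arr_map F\<rparr>"

text \<open>Equality of functors out of \<open>A\<close>: the values off the carriers of \<open>A\<close> carry no meaning.\<close>

definition functor_eq ::
    "('o1, 'm1) category \<Rightarrow> ('o1, 'm1, 'o2, 'm2) functor_data
      \<Rightarrow> ('o1, 'm1, 'o2, 'm2) functor_data \<Rightarrow> bool" where
  "functor_eq A F G \<longleftrightarrow>
     (\<forall>x \<in> Ob A. obj_map F x = obj_map G x) \<and> (\<forall>f \<in> Ar A. arr_map F f = arr_map G f)"

text \<open>Fullness is not part of being an embedding.\<close>

definition is_embedding ::
    "('o1, 'm1) category \<Rightarrow> ('o2, 'm2) category \<Rightarrow> ('o1, 'm1, 'o2, 'm2) functor_data \<Rightarrow> bool" where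
  "is_embedding A B F \<longleftrightarrow>
     is_functor A B F \<and> inj_on (obj_map F) (Ob A) \<and>
     (\<forall>x \<in> Ob A. \<forall>y \<in> Ob A. inj_on (arr_map F) (Hom A x y))"

definition is_natural ::
    "('o1, 'm1) category \<Rightarrow> ('o2, 'm2) category \<Rightarrow> ('o1, 'm1, 'o2, 'm2) functor_data
      \<Rightarrow> ('o1, 'm1, 'o2, 'm2) functor_data \<Rightarrow> ('o1 \<Rightarrow> 'm2) \<Rightarrow> bool" where
  "is_natural A B F G \<tau> \<longleftrightarrow>
     (\<forall>x \<in> Ob A. \<tau> x \<in> Hom B (obj_map F x) (obj_map G x)) \<and>
     (\<forall>x y. \<forall>f \<in> Hom A x y. Comp B (arr_map G f) (\<tau> x) = Comp B (\<tau> y) (arr_map F f))"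

definition is_natural_iso ::
    "('o1, 'm1) category \<Rightarrow> ('o2, 'm2) category \<Rightarrow> ('o1, 'm1, 'o2, 'm2) functor_data
      \<Rightarrow> ('o1, 'm1, 'o2, 'm2) functor_data \<Rightarrow> ('o1 \<Rightarrow> 'm2) \<Rightarrow> bool" where
  "is_natural_iso A B F G \<tau> \<longleftrightarrow> is_natural A B F G \<tau> \<and> (\<forall>x \<in> Ob A. is_iso B (\<tau> x))"

definition equivalent_categories :: "('o1, 'm1) category \<Rightarrow> ('o2, 'm2) category \<Rightarrow> bool" where
  "equivalent_categories A B \<longleftrightarrow>
     is_category A \<and> is_category B \<and>
     (\<exists>F G \<eta> \<epsilon>. is_functor A B F \<and> is_functor B A G \<and>
        is_natural_iso A A id_functor (G \<circ>\<^sub>F F) \<eta> \<and>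
        is_natural_iso B B (F \<circ>\<^sub>F G) id_functor \<epsilon>)"

definition is_cocone ::
    "('j, 'k) category \<Rightarrow> ('o, 'm) category \<Rightarrow> ('j, 'k, 'o, 'm) functor_data
      \<Rightarrow> 'o \<Rightarrow> ('j \<Rightarrow> 'm) \<Rightarrow> bool" where
  "is_cocone J C D c \<kappa> \<longleftrightarrow>
     c \<in> Ob C \<and> (\<forall>j \<in> Ob J. \<kappa> j \<in> Hom C (obj_map D j) c) \<and>
     (\<forall>i j. \<forall>a \<in> Hom J i j. Comp C (\<kappa> j) (arr_map D a) = \<kappa> i)"

definition is_colimit ::
    "('j, 'k) category \<Rightarrow> ('o, 'm) category \<Rightarrow> ('j, 'k, 'o, 'm) functor_data
      \<Rightarrow> 'o \<Rightarrow> ('j \<Rightarrow> 'm) \<Rightarrow> bool" where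
  "is_colimit J C D c \<kappa> \<longleftrightarrow>
     is_cocone J C D c \<kappa> \<and>
     (\<forall>d \<mu>. is_cocone J C D d \<mu> \<longrightarrow>
        (\<exists>!u. u \<in> Hom C c d \<and> (\<forall>j \<in> Ob J. Comp C u (\<kappa> j) = \<mu> j)))"

text \<open>
  Every finite category is isomorphic to one whose objects and arrows are natural numbers, so
  these index categories account for all finite diagrams.
\<close>

definition finite_index :: "(nat, nat) category \<Rightarrow> bool" where
  "finite_index J \<longleftrightarrow> is_category J \<and> finite (Ob J) \<and> finite (Ar J)"

definition finitely_cocomplete :: "('o, 'm) category \<Rightarrow> bool" where
  "finitely_cocomplete C \<longleftrightarrow>
     is_category C \<and>
     (\<forall>J D. finite_index J \<and> is_functor J C D \<longrightarrow> (\<exists>c \<kappa>. is_colimit J C D c \<kappa>))"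

definition preserves_finite_colimits ::
    "('o1, 'm1) category \<Rightarrow> ('o2, 'm2) category \<Rightarrow> ('o1, 'm1, 'o2, 'm2) functor_data \<Rightarrow> bool" where
  "preserves_finite_colimits A B F \<longleftrightarrow>
     (\<forall>J D c \<kappa>. finite_index J \<and> is_functor J A D \<and> is_colimit J A D c \<kappa> \<longrightarrow>
        is_colimit J B (F \<circ>\<^sub>F D) (obj_map F c) (\<lambda>j. arr_map F (\<kappa> j)))"

definition is_cocontinuous_extension ::
    "('a, 'b) category \<Rightarrow> ('o, 'm) category \<Rightarrow> ('a, 'b, 'o, 'm) functor_data
      \<Rightarrow> ('c, 'd) category \<Rightarrow> ('a, 'b, 'c, 'd) functor_data
      \<Rightarrow> ('o, 'm, 'c, 'd) functor_data \<Rightarrow> bool" where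
  "is_cocontinuous_extension L P y C F E \<longleftrightarrow>
     is_functor P C E \<and> preserves_finite_colimits P C E \<and> functor_eq L (E \<circ>\<^sub>F y) F"

text \<open>
  Quantification over all finitely cocomplete categories \<open>C\<close> has to fix the types of the objects
  and arrows of \<open>C\<close>; the first argument records this choice.

  Uniqueness of an extension of \<open>F\<close> up to unique isomorphism refers to isomorphisms restricting
  to the identity of \<open>F\<close> along \<open>y\<close>; automorphisms of \<open>F\<close> would otherwise give several.
\<close>

definition is_free_conservative_finite_cocompletion ::
    "('c, 'd) category itself \<Rightarrow> ('a, 'b) category \<Rightarrow> ('o, 'm) category
      \<Rightarrow> ('a, 'b, 'o, 'm) functor_data \<Rightarrow> bool" where
  "is_free_conservative_finite_cocompletion U L P y \<longleftrightarrow>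
     finitely_cocomplete P \<and> is_embedding L P y \<and> preserves_finite_colimits L P y \<and>
     (\<forall>(C :: ('c, 'd) category) F.
        finitely_cocomplete C \<and> is_functor L C F \<and> preserves_finite_colimits L C F \<longrightarrow>
        (\<exists>E. is_cocontinuous_extension L P y C F E) \<and>
        (\<forall>E E'. is_cocontinuous_extension L P y C F E \<and>
                is_cocontinuous_extension L P y C F E' \<longrightarrow>
           (\<exists>!\<theta>. \<theta> \<in> extensional (Ob P) \<and> is_natural_iso P C E E' \<theta> \<and>
                 (\<forall>n \<in> Ob L. \<theta> (obj_map y n) = Id C (obj_map F n)))))"

text \<open>
  A category from hom-sets that need not be disjoint: an arrow is tagged with its domain and
  codomain. In \<open>c x g f\<close>, the composite of \<open>g\<close> after \<open>f\<close>, \<open>x\<close> is the domain of \<open>f\<close>.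
\<close>

definition category_of_homs ::
    "'o set \<Rightarrow> ('o \<Rightarrow> 'o \<Rightarrow> 'f set) \<Rightarrow> ('o \<Rightarrow> 'f) \<Rightarrow> ('o \<Rightarrow> 'f \<Rightarrow> 'f \<Rightarrow> 'f)
      \<Rightarrow> ('o, 'o \<times> 'f \<times> 'o) category" where
  "category_of_homs X H i c =
     \<lparr>Ob = X,
      Ar = {(x, f, y). x \<in> X \<and> y \<in> X \<and> f \<in> H x y},
      Dom = (\<lambda>(x, f, y). x),
      Cod = (\<lambda>(x, f, y). y),
      Id = (\<lambda>x. (x, i x, x)),
      Comp = (\<lambda>(y', g, z) (x, f, y). (x, c x g f, z))\<rparr>"

definition cat_L :: "(nat, nat \<times> (nat \<Rightarrow> nat) \<times> nat) category" where
  "cat_L = category_of_homs UNIV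
     (\<lambda>m n. {f \<in> {..<m} \<rightarrow>\<^sub>E {..<n}. inj_on f {..<m} \<and> mono_on {..<m} f})
     (\<lambda>m. \<lambda>i\<in>{..<m}. i)
     (\<lambda>m g f. compose {..<m} g f)"

type_synonym ('v, 'e) graph_arrow =
  "('v, 'e) pre_digraph \<times> (('v \<Rightarrow> 'v) \<times> ('e \<Rightarrow> 'e)) \<times> ('v, 'e) pre_digraph"

definition graph_homs ::
    "('v, 'e) pre_digraph \<Rightarrow> ('v, 'e) pre_digraph \<Rightarrow> (('v \<Rightarrow> 'v) \<times> ('e \<Rightarrow> 'e)) set" where
  "graph_homs G H =
     {(p, q). p \<in> verts G \<rightarrow>\<^sub>E verts H \<and> q \<in> arcs G \<rightarrow>\<^sub>E arcs H \<and>
        (\<forall>e \<in> arcs G. tail H (q e) = p (tail G e) \<and> head H (q e) = p (head G e))}"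

definition cat_Graph :: "(('v, 'e) pre_digraph, ('v, 'e) graph_arrow) category" where
  "cat_Graph = category_of_homs
     {G. wf_digraph G \<and> tail G \<in> extensional (arcs G) \<and> head G \<in> extensional (arcs G)}
     graph_homs
     (\<lambda>G. (\<lambda>v\<in>verts G. v, \<lambda>e\<in>arcs G. e))
     (\<lambda>G (p', q') (p, q). (compose (verts G) p' p, compose (arcs G) q' q))"

definition unique_edge_along_paths :: "('v, 'e) pre_digraph \<Rightarrow> bool" where
  "unique_edge_along_paths G \<longleftrightarrow>
     (\<forall>x y w. pre_digraph.awalk G x w y \<and> w \<noteq> [] \<longrightarrow>
        (\<exists>!e. e \<in> arcs G \<and> tail G e = x \<and> head G e = y))"

definition cat_PathGraph :: "(('v, 'e) pre_digraph, ('v, 'e) graph_arrow) category" where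
  "cat_PathGraph = full_subcategory cat_Graph (\<lambda>G. fin_digraph G \<and> unique_edge_along_paths G)"

definition cat_TransRel ::
    "('a set \<times> 'a rel, ('a set \<times> 'a rel) \<times> ('a \<Rightarrow> 'a) \<times> ('a set \<times> 'a rel)) category" where
  "cat_TransRel = category_of_homs
     {(A, r). finite A \<and> r \<subseteq> A \<times> A \<and> trans r}
     (\<lambda>(A, r) (B, s). {f \<in> A \<rightarrow>\<^sub>E B. \<forall>(a, a') \<in> r. (f a, f a') \<in> s})
     (\<lambda>(A, r). \<lambda>a\<in>A. a)
     (\<lambda>(A, r) g f. compose A g f)"

end

theory Submission
  imports Defs
begin

text \<open>
  Regard the objects of \<^const>\<open>cat_L\<close> as chains \<open>[n]\<close>. There \<open>[3]\<close> is the pushout of two copies of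
  \<open>[2]\<close> along \<open>[1]\<close>, and \<open>[2]\<close> is the colimit of two parallel edges. So if \<open>F\<close> preserves colimits, the
  arrows \<open>F [1] \<rightarrow> c\<close> carry a transitive relation \<open>Rel c\<close> (being the two ends of an arrow
  \<open>F [2] \<rightarrow> c\<close>, which is unique), and the extension of \<open>F\<close> sends a finite transitive relation \<open>X\<close> to
  the object representing the homomorphisms \<open>X \<rightarrow> Rel c\<close>. The inclusion of chains preserves colimits:
  if a diagram of chains has a colimit in \<^const>\<open>cat_L\<close>, its colimit \<open>K\<close> among the transitive
  relations is a chain, since all linear extensions of \<open>K\<close> must agree.
\<close>

section \<open>Categories and functors\<close>

text \<open>Every finite transitive relation is the colimit of its own points and edges. This forces
  the values of any extension, so existence and uniqueness rest on the same computation. Two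
  obstacles shape the rest. The relations \<open>Rel c\<close> live on the arrows of
  \<open>C\<close> and may be infinite, so in general they are no objects of
  \<open>cat_TransRel\<close>; cocones into arbitrary transitive relations are therefore treated
  alongside the categorical ones. And the universal property speaks of targets of one fixed type, so
  an abstract \<open>P\<close> cannot be compared with \<open>cat_TransRel\<close> directly: the
  comparison passes through a copy inside the types of \<open>P\<close>.\<close>

lemma functor_comp_simps [simp]:
  "obj_map (G \<circ>\<^sub>F F) x = obj_map G (obj_map F x)"
  "arr_map (G \<circ>\<^sub>F F) f = arr_map G (arr_map F f)"
  by (simp_all add: functor_comp_def)

lemma id_functor_simps [simp]: "obj_map id_functor x = x" "arr_map id_functor f = f"
  by (simp_all add: id_functor_def)

lemma functor_comp_assoc: "(H \<circ>\<^sub>F G) \<circ>\<^sub>F F = H \<circ>\<^sub>F (G \<circ>\<^sub>F F)"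
  by (simp add: functor_comp_def comp_assoc)

lemma id_functor_comp [simp]: "id_functor \<circ>\<^sub>F F = F"
  by (cases F) (simp add: functor_comp_def id_functor_def comp_def)

lemma Hom_Ar: "f \<in> Hom C x y \<Longrightarrow> f \<in> Ar C"
  and Hom_Dom: "f \<in> Hom C x y \<Longrightarrow> Dom C f = x"
  and Hom_Cod: "f \<in> Hom C x y \<Longrightarrow> Cod C f = y"
  and Ar_Hom: "f \<in> Ar C \<Longrightarrow> f \<in> Hom C (Dom C f) (Cod C f)"
  by (auto simp: Hom_def)

lemma is_isoI:
  assumes "f \<in> Hom C x y" "g \<in> Hom C y x" "Comp C g f = Id C x" "Comp C f g = Id C y"
  shows "is_iso C f"
  using assms unfolding is_iso_def by (auto simp: Hom_def)

lemma is_isoE: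
  assumes "is_iso C f" "f \<in> Hom C x y"
  obtains g where "g \<in> Hom C y x" "Comp C g f = Id C x" "Comp C f g = Id C y"
  using assms unfolding is_iso_def by (auto simp: Hom_def)

context
  fixes C :: "('o, 'm) category"
  assumes C: "is_category C"
begin

lemma Hom_Ob: "f \<in> Hom C x y \<Longrightarrow> x \<in> Ob C \<and> y \<in> Ob C"
  using C unfolding is_category_def Hom_def by blast

lemma Id_Hom: "x \<in> Ob C \<Longrightarrow> Id C x \<in> Hom C x x"
  using C unfolding is_category_def by blast

lemma Comp_Hom: "g \<in> Hom C y z \<Longrightarrow> f \<in> Hom C x y \<Longrightarrow> Comp C g f \<in> Hom C x z"
  using C unfolding is_category_def by blast

lemma Comp_Id_right: "f \<in> Hom C x y \<Longrightarrow> Comp C f (Id C x) = f"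
  using C unfolding is_category_def by blast

lemma Comp_Id_left: "f \<in> Hom C x y \<Longrightarrow> Comp C (Id C y) f = f"
  using C unfolding is_category_def by blast

lemma Comp_assoc:
  "h \<in> Hom C y z \<Longrightarrow> g \<in> Hom C x y \<Longrightarrow> f \<in> Hom C w x \<Longrightarrow>
    Comp C h (Comp C g f) = Comp C (Comp C h g) f"
  using C unfolding is_category_def by blast

end

lemma is_functor_Ob: "is_functor A B F \<Longrightarrow> x \<in> Ob A \<Longrightarrow> obj_map F x \<in> Ob B"
  and is_functor_Hom: "is_functor A B F \<Longrightarrow> f \<in> Hom A x y \<Longrightarrow>
    arr_map F f \<in> Hom B (obj_map F x) (obj_map F y)"
  and is_functor_Id: "is_functor A B F \<Longrightarrow> x \<in> Ob A \<Longrightarrow> arr_map F (Id A x) = Id B (obj_map F x)"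
  and is_functor_Comp: "is_functor A B F \<Longrightarrow> g \<in> Hom A y z \<Longrightarrow> f \<in> Hom A x y \<Longrightarrow>
    arr_map F (Comp A g f) = Comp B (arr_map F g) (arr_map F f)"
  unfolding is_functor_def by blast+

lemma is_functor_comp:
  assumes F: "is_functor A B F" and G: "is_functor B C G"
  shows "is_functor A C (G \<circ>\<^sub>F F)"
  using is_functor_Ob[OF G is_functor_Ob[OF F]] is_functor_Hom[OF G is_functor_Hom[OF F]]
    is_functor_Id[OF F] is_functor_Id[OF G is_functor_Ob[OF F]] is_functor_Comp[OF F]
    is_functor_Comp[OF G is_functor_Hom[OF F] is_functor_Hom[OF F]]
  unfolding is_functor_def[of A C] by simp

lemma is_functor_id: "is_functor A A id_functor"
  by (simp add: is_functor_def)

lemma is_functor_iso: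
  assumes "is_category A" "is_functor A B F" "is_iso A f"
  shows "is_iso B (arr_map F f)"
proof -
  have f: "f \<in> Hom A (Dom A f) (Cod A f)"
    using assms(3) by (simp add: is_iso_def Hom_def)
  obtain g where g: "g \<in> Hom A (Cod A f) (Dom A f)" "Comp A g f = Id A (Dom A f)"
    "Comp A f g = Id A (Cod A f)"
    using assms(3) by (auto simp: is_iso_def)
  show ?thesis
    by (rule is_isoI[OF is_functor_Hom[OF assms(2) f] is_functor_Hom[OF assms(2) g(1)]])
      (simp_all flip: is_functor_Comp[OF assms(2) f g(1)] is_functor_Comp[OF assms(2) g(1) f]
        add: g is_functor_Id[OF assms(2)] Hom_Ob[OF assms(1) f])
qed

lemma functor_eqD:
  assumes "functor_eq A F G"
  shows "x \<in> Ob A \<Longrightarrow> obj_map F x = obj_map G x"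
    and "f \<in> Hom A x y \<Longrightarrow> arr_map F f = arr_map G f"
  using assms by (auto simp: functor_eq_def Hom_def)

subsection \<open>Equivalences\<close>

definition fully_faithful ::
  "('o1, 'm1) category \<Rightarrow> ('o2, 'm2) category \<Rightarrow> ('o1, 'm1, 'o2, 'm2) functor_data \<Rightarrow> bool" where
  "fully_faithful A B F \<longleftrightarrow> is_functor A B F \<and>
     (\<forall>x \<in> Ob A. \<forall>y \<in> Ob A.
        bij_betw (arr_map F) (Hom A x y) (Hom B (obj_map F x) (obj_map F y)))"

definition essentially_surjective ::
  "('o1, 'm1) category \<Rightarrow> ('o2, 'm2) category \<Rightarrow> ('o1, 'm1, 'o2, 'm2) functor_data \<Rightarrow> bool" where
  "essentially_surjective A B F \<longleftrightarrow>
     (\<forall>b \<in> Ob B. \<exists>a \<in> Ob A. \<exists>i \<in> Hom B (obj_map F a) b. is_iso B i)"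

text \<open>The quasi-inverse \<open>go\<close>, \<open>ga\<close> is chosen from preimages under
  \<open>F\<close>. Its laws live in \<open>A\<close> and are proved after applying
  \<open>F\<close>, which is faithful; there they become cancellations of the chosen isomorphisms
  \<open>e\<close> and \<open>e'\<close>.\<close>

lemma equivalent_categoriesI:
  assumes A: "is_category A" and B: "is_category B"
    and ff: "fully_faithful A B F" and es: "essentially_surjective A B F"
  shows "equivalent_categories A B"
proof -
  have F: "is_functor A B F" using ff by (simp add: fully_faithful_def)
  have inj: "f = f'" if "f \<in> Hom A x y" "f' \<in> Hom A x y" "arr_map F f = arr_map F f'" for f f' x y
  proof -
    have "bij_betw (arr_map F) (Hom A x y) (Hom B (obj_map F x) (obj_map F y))"
      using ff Hom_Ob[OF A that(1)] by (simp add: fully_faithful_def)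
    then show ?thesis using that by (auto simp: bij_betw_def inj_on_def)
  qed
  have surj: "\<exists>f \<in> Hom A x y. arr_map F f = g"
    if "x \<in> Ob A" "y \<in> Ob A" "g \<in> Hom B (obj_map F x) (obj_map F y)" for g x y
  proof -
    have "bij_betw (arr_map F) (Hom A x y) (Hom B (obj_map F x) (obj_map F y))"
      using ff that by (simp add: fully_faithful_def)
    then have "g \<in> arr_map F ` Hom A x y" using that by (simp add: bij_betw_def)
    then show ?thesis by auto
  qed
  note cH = Comp_Hom[OF B] and ass = Comp_assoc[OF B]
  have "\<exists>a i i'. b \<in> Ob B \<longrightarrow> a \<in> Ob A \<and> i \<in> Hom B (obj_map F a) b \<and> i' \<in> Hom B b (obj_map F a) \<and>
    Comp B i' i = Id B (obj_map F a) \<and> Comp B i i' = Id B b" for b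
    using es is_isoE unfolding essentially_surjective_def by metis
  then obtain go e e' where ge: "\<And>b. b \<in> Ob B \<Longrightarrow> go b \<in> Ob A"
    "\<And>b. b \<in> Ob B \<Longrightarrow> e b \<in> Hom B (obj_map F (go b)) b"
    "\<And>b. b \<in> Ob B \<Longrightarrow> e' b \<in> Hom B b (obj_map F (go b))"
    "\<And>b. b \<in> Ob B \<Longrightarrow> Comp B (e' b) (e b) = Id B (obj_map F (go b))"
    "\<And>b. b \<in> Ob B \<Longrightarrow> Comp B (e b) (e' b) = Id B b"
    by metis
  \<comment> \<open>An arrow map sees only the arrow, so one \<open>f\<close> has to serve all
    \<open>b\<close> and \<open>b'\<close>; the arrow \<open>g\<close> determines them. Outside
    \<open>Ar B\<close> the claim is vacuous.\<close>
  have "\<exists>f. \<forall>b b'. g \<in> Hom B b b' \<longrightarrow> f \<in> Hom A (go b) (go b') \<and>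
      arr_map F f = Comp B (Comp B (e' b') g) (e b)" for g
  proof (cases "g \<in> Ar B")
    case True
    then have g: "g \<in> Hom B (Dom B g) (Cod B g)" by (rule Ar_Hom)
    note Ob = Hom_Ob[OF B g]
    obtain f where "f \<in> Hom A (go (Dom B g)) (go (Cod B g))"
      "arr_map F f = Comp B (Comp B (e' (Cod B g)) g) (e (Dom B g))"
      using surj[of "go (Dom B g)" "go (Cod B g)" "Comp B (Comp B (e' (Cod B g)) g) (e (Dom B g))"]
        ge Ob cH g by meson
    then show ?thesis by (auto simp: Hom_def)
  qed (auto simp: Hom_def)
  then obtain ga where ga: "\<And>g b b'. g \<in> Hom B b b' \<Longrightarrow> ga g \<in> Hom A (go b) (go b')"
    "\<And>g b b'. g \<in> Hom B b b' \<Longrightarrow> arr_map F (ga g) = Comp B (Comp B (e' b') g) (e b)"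
    by metis
  have "\<exists>h. x \<in> Ob A \<longrightarrow> h \<in> Hom A x (go (obj_map F x)) \<and> arr_map F h = e' (obj_map F x)" for x
    using surj[of x "go (obj_map F x)" "e' (obj_map F x)"] ge is_functor_Ob[OF F] by metis
  then obtain h where h: "\<And>x. x \<in> Ob A \<Longrightarrow> h x \<in> Hom A x (go (obj_map F x))"
    "\<And>x. x \<in> Ob A \<Longrightarrow> arr_map F (h x) = e' (obj_map F x)"
    by metis
  define G where "G = \<lparr>obj_map = go, arr_map = ga\<rparr>"
  \<comment> \<open>Naturality of the counit. It also shows that \<open>ga\<close> respects
    composition, before \<open>G\<close> is known to be a functor.\<close>
  have e_ga: "Comp B (e b') (arr_map F (ga g)) = Comp B g (e b)" if g: "g \<in> Hom B b b'" for g b b'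
  proof -
    note Ob = Hom_Ob[OF B g]
    note e = ge(2)[of b] ge(2)[of b'] ge(3)[of b'] ge(5)[of b']
    have "Comp B (e b') (arr_map F (ga g)) = Comp B (Comp B (Comp B (e b') (e' b')) g) (e b)"
      using ga(2)[OF g] ass[OF e(2) cH[OF e(3) g] e(1)] ass[OF e(2,3) g] Ob by simp
    then show ?thesis using e(4) Ob Comp_Id_left[OF B g] by simp
  qed
  have G: "is_functor B A G"
    unfolding is_functor_def
  proof (intro conjI ballI allI)
    fix x assume "x \<in> Ob B"
    then show "obj_map G x \<in> Ob A" using ge by (simp add: G_def)
  next
    fix x y f assume "f \<in> Hom B x y"
    then show "arr_map G f \<in> Hom A (obj_map G x) (obj_map G y)" using ga by (simp add: G_def)
  next
    fix x assume x: "x \<in> Ob B"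
    note i = Id_Hom[OF B x]
    have "arr_map F (ga (Id B x)) = arr_map F (Id A (go x))"
      using ga(2)[OF i] ge[OF x] Comp_Id_right[OF B ge(3)[OF x]] is_functor_Id[OF F ge(1)[OF x]]
      by simp
    then show "arr_map G (Id B x) = Id A (obj_map G x)"
      using inj[OF ga(1)[OF i] Id_Hom[OF A ge(1)[OF x]]] by (simp add: G_def)
  next
    fix x y z f g assume f: "f \<in> Hom B x y" and g: "g \<in> Hom B y z"
    note Ob = Hom_Ob[OF B f] Hom_Ob[OF B g]
    note ex = ge(2)[of x] and ez' = ge(3)[of z] and ey = ge(2)[of y] ge(3)[of y] ge(5)[of y]
    let ?Fg = "arr_map F (ga g)" and ?Ff = "arr_map F (ga f)"
    have "arr_map F (Comp A (ga g) (ga f)) = Comp B ?Fg ?Ff"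
      by (rule is_functor_Comp[OF F ga(1)[OF g] ga(1)[OF f]])
    also have "\<dots> = Comp B (Comp B (e' z) g) (Comp B (e y) ?Ff)"
      using ga(2)[OF g] ass[OF cH[OF ez' g] ey(1) is_functor_Hom[OF F ga(1)[OF f]]] Ob by simp
    also have "\<dots> = Comp B (Comp B (e' z) g) (Comp B f (e x))"
      using e_ga[OF f] by simp
    also have "\<dots> = arr_map F (ga (Comp B g f))"
      using ga(2)[OF cH[OF g f]] ass[OF cH[OF ez' g] f ex] ass[OF ez' g f] Ob by simp
    finally show "arr_map G (Comp B g f) = Comp A (arr_map G g) (arr_map G f)"
      using inj[OF ga(1)[OF cH[OF g f]] Comp_Hom[OF A ga(1)[OF g] ga(1)[OF f]]]
      by (simp add: G_def)
  qed
  have "is_natural_iso A A id_functor (G \<circ>\<^sub>F F) h"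
    unfolding is_natural_iso_def is_natural_def
  proof (intro conjI ballI allI)
    fix x assume x: "x \<in> Ob A"
    then show "h x \<in> Hom A (obj_map id_functor x) (obj_map (G \<circ>\<^sub>F F) x)"
      using h by (simp add: G_def)
    note Fx = is_functor_Ob[OF F x]
    obtain k where k: "k \<in> Hom A (go (obj_map F x)) x" "arr_map F k = e (obj_map F x)"
      using surj[OF ge(1)[OF Fx] x ge(2)[OF Fx]] by blast
    show "is_iso A (h x)"
    proof (rule is_isoI[OF h(1)[OF x] k(1)])
      show "Comp A k (h x) = Id A x"
        by (rule inj[OF Comp_Hom[OF A k(1) h(1)[OF x]] Id_Hom[OF A x]])
          (simp add: is_functor_Comp[OF F k(1) h(1)[OF x]] k h(2)[OF x] ge(5)[OF Fx]
            is_functor_Id[OF F x])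
      show "Comp A (h x) k = Id A (go (obj_map F x))"
        by (rule inj[OF Comp_Hom[OF A h(1)[OF x] k(1)] Id_Hom[OF A ge(1)[OF Fx]]])
          (simp add: is_functor_Comp[OF F h(1)[OF x] k(1)] k h(2)[OF x] ge(4)[OF Fx]
            is_functor_Id[OF F ge(1)[OF Fx]])
    qed
  next
    fix x y f assume f: "f \<in> Hom A x y"
    note Ob = Hom_Ob[OF A f]
    then have x: "x \<in> Ob A" and y: "y \<in> Ob A" by auto
    note Ff = is_functor_Hom[OF F f] and Fx = is_functor_Ob[OF F x] and Fy = is_functor_Ob[OF F y]
    let ?a = "Comp A (ga (arr_map F f)) (h x)" and ?b = "Comp A (h y) f"
    have "arr_map F ?a = Comp B (Comp B (Comp B (e' (obj_map F y)) (arr_map F f)) (e (obj_map F x)))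
        (e' (obj_map F x))"
      by (simp add: is_functor_Comp[OF F ga(1)[OF Ff] h(1)[OF x]] h(2)[OF x] ga(2)[OF Ff])
    also have "\<dots> = Comp B (e' (obj_map F y)) (arr_map F f)"
      using ass[OF cH[OF ge(3)[OF Fy] Ff] ge(2)[OF Fx] ge(3)[OF Fx]] ge(5)[OF Fx]
        Comp_Id_right[OF B cH[OF ge(3)[OF Fy] Ff]] by simp
    also have "\<dots> = arr_map F ?b"
      by (simp add: is_functor_Comp[OF F h(1)[OF y] f] h(2)[OF y])
    finally have "?a = ?b"
      using inj[OF Comp_Hom[OF A ga(1)[OF Ff] h(1)[OF x]] Comp_Hom[OF A h(1)[OF y] f]] by simp
    then show "Comp A (arr_map (G \<circ>\<^sub>F F) f) (h x) = Comp A (h y) (arr_map id_functor f)"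
      by (simp add: G_def)
  qed
  moreover have "is_natural_iso B B (F \<circ>\<^sub>F G) id_functor e"
    unfolding is_natural_iso_def is_natural_def
    using ge e_ga is_isoI[OF ge(2,3,4,5)] by (auto simp: G_def)
  ultimately show ?thesis
    using A B F G unfolding equivalent_categories_def by blast
qed

section \<open>Composition of equivalences\<close>

lemma natural_isoD:
  assumes "is_natural_iso A B F G \<tau>"
  shows "x \<in> Ob A \<Longrightarrow> \<tau> x \<in> Hom B (obj_map F x) (obj_map G x)"
    and "x \<in> Ob A \<Longrightarrow> is_iso B (\<tau> x)"
    and "f \<in> Hom A x y \<Longrightarrow> Comp B (arr_map G f) (\<tau> x) = Comp B (\<tau> y) (arr_map F f)"
  using assms by (auto simp: is_natural_iso_def is_natural_def)

lemma is_iso_Comp: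
  assumes C: "is_category C" and f: "f \<in> Hom C x y" "is_iso C f" and g: "g \<in> Hom C y z" "is_iso C g"
  shows "is_iso C (Comp C g f)"
proof -
  obtain f' where f': "f' \<in> Hom C y x" "Comp C f' f = Id C x" "Comp C f f' = Id C y"
    using is_isoE[OF f(2,1)] .
  obtain g' where g': "g' \<in> Hom C z y" "Comp C g' g = Id C y" "Comp C g g' = Id C z"
    using is_isoE[OF g(2,1)] .
  note H = Comp_Hom[OF C] and ass = Comp_assoc[OF C]
  show ?thesis
  proof (rule is_isoI[OF H[OF g(1) f(1)] H[OF f'(1) g'(1)]])
    show "Comp C (Comp C f' g') (Comp C g f) = Id C x"
      using ass[OF f'(1) g'(1) H[OF g(1) f(1)]] ass[OF g'(1) g(1) f(1)] f' g'
        Comp_Id_left[OF C f(1)] by simp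
    show "Comp C (Comp C g f) (Comp C f' g') = Id C z"
      using ass[OF g(1) f(1) H[OF f'(1) g'(1)]] ass[OF f(1) f'(1) g'(1)] f' g'
        Comp_Id_left[OF C g'(1)] by simp
  qed
qed

lemma natural_iso_Comp:
  assumes A: "is_category A" and B: "is_category B"
    and F: "is_functor A B F" and G: "is_functor A B G" and H: "is_functor A B H"
    and \<tau>: "is_natural_iso A B F G \<tau>" and \<sigma>: "is_natural_iso A B G H \<sigma>"
  shows "is_natural_iso A B F H (\<lambda>x. Comp B (\<sigma> x) (\<tau> x))"
proof -
  note \<tau> = natural_isoD[OF \<tau>] and \<sigma> = natural_isoD[OF \<sigma>] and ass = Comp_assoc[OF B]
  have "Comp B (arr_map H f) (Comp B (\<sigma> x) (\<tau> x)) = Comp B (Comp B (\<sigma> y) (\<tau> y)) (arr_map F f)"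
    if f: "f \<in> Hom A x y" for x y f
  proof -
    have x: "x \<in> Ob A" and y: "y \<in> Ob A" using Hom_Ob[OF A f] by auto
    show ?thesis
      using ass[OF is_functor_Hom[OF H f] \<sigma>(1)[OF x] \<tau>(1)[OF x]]
        ass[OF \<sigma>(1)[OF y] is_functor_Hom[OF G f] \<tau>(1)[OF x]]
        ass[OF \<sigma>(1)[OF y] \<tau>(1)[OF y] is_functor_Hom[OF F f]] \<sigma>(3)[OF f] \<tau>(3)[OF f]
      by simp
  qed
  then show ?thesis
    using Comp_Hom[OF B \<sigma>(1) \<tau>(1)] is_iso_Comp[OF B \<tau>(1,2) \<sigma>(1,2)]
    by (simp add: is_natural_iso_def is_natural_def)
qed

text \<open>Whiskering on both sides at once: it places the unit of the second equivalence between
  the functors of the first, and the counit of the first between those of the second.\<close>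

lemma natural_iso_whisker:
  assumes A: "is_category A" and C: "is_category C"
    and K: "is_functor A B K" and F: "is_functor B C F" and G: "is_functor B C G"
    and \<tau>: "is_natural_iso B C F G \<tau>" and H: "is_functor C D H"
  shows "is_natural_iso A D (H \<circ>\<^sub>F (F \<circ>\<^sub>F K)) (H \<circ>\<^sub>F (G \<circ>\<^sub>F K)) (\<lambda>x. arr_map H (\<tau> (obj_map K x)))"
proof -
  note \<tau> = natural_isoD[OF \<tau>] and KO = is_functor_Ob[OF K]
  have "Comp D (arr_map H (arr_map G (arr_map K f))) (arr_map H (\<tau> (obj_map K x))) =
      Comp D (arr_map H (\<tau> (obj_map K y))) (arr_map H (arr_map F (arr_map K f)))"
    if f: "f \<in> Hom A x y" for x y f
  proof -
    have x: "x \<in> Ob A" and y: "y \<in> Ob A" using Hom_Ob[OF A f] by auto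
    note Kf = is_functor_Hom[OF K f]
    show ?thesis
      using is_functor_Comp[OF H is_functor_Hom[OF G Kf] \<tau>(1)[OF KO[OF x]]]
        is_functor_Comp[OF H \<tau>(1)[OF KO[OF y]] is_functor_Hom[OF F Kf]] \<tau>(3)[OF Kf]
      by simp
  qed
  then show ?thesis
    using is_functor_Hom[OF H \<tau>(1)[OF KO]] is_functor_iso[OF C H \<tau>(2)[OF KO]]
    by (simp add: is_natural_iso_def is_natural_def)
qed

lemma equivalent_categories_trans:
  assumes "equivalent_categories A B" "equivalent_categories B C"
  shows "equivalent_categories A C"
proof -
  obtain F G \<eta> \<epsilon> where A: "is_category A" and B: "is_category B"
    and F: "is_functor A B F" and G: "is_functor B A G"
    and \<eta>: "is_natural_iso A A id_functor (G \<circ>\<^sub>F F) \<eta>" and \<epsilon>: "is_natural_iso B B (F \<circ>\<^sub>F G) id_functor \<epsilon>"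
    using assms(1) unfolding equivalent_categories_def by (elim conjE exE)
  obtain F' G' \<eta>' \<epsilon>' where C: "is_category C"
    and F': "is_functor B C F'" and G': "is_functor C B G'"
    and \<eta>': "is_natural_iso B B id_functor (G' \<circ>\<^sub>F F') \<eta>'"
    and \<epsilon>': "is_natural_iso C C (F' \<circ>\<^sub>F G') id_functor \<epsilon>'"
    using assms(2) unfolding equivalent_categories_def by (elim conjE exE)
  note fc = is_functor_comp and id = is_functor_id
  have "is_natural_iso A A (G \<circ>\<^sub>F F) ((G \<circ>\<^sub>F G') \<circ>\<^sub>F (F' \<circ>\<^sub>F F)) (\<lambda>x. arr_map G (\<eta>' (obj_map F x)))"
    using natural_iso_whisker[OF A B F id fc[OF F' G'] \<eta>' G] by (simp add: functor_comp_assoc)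
  note 1 = natural_iso_Comp[OF A A id fc[OF F G] fc[OF fc[OF F F'] fc[OF G' G]] \<eta> this]
  have "is_natural_iso C C ((F' \<circ>\<^sub>F F) \<circ>\<^sub>F (G \<circ>\<^sub>F G')) (F' \<circ>\<^sub>F G') (\<lambda>x. arr_map F' (\<epsilon> (obj_map G' x)))"
    using natural_iso_whisker[OF C B G' fc[OF G F] id \<epsilon> F'] by (simp add: functor_comp_assoc)
  note 2 = natural_iso_Comp[OF C C fc[OF fc[OF G' G] fc[OF F F']] fc[OF G' F'] id this \<epsilon>']
  show ?thesis
    unfolding equivalent_categories_def
    by (intro conjI exI) (rule A C fc[OF F F'] fc[OF G' G] 1 2)+
qed

subsection \<open>Isomorphisms of categories and colimits\<close>

lemma is_cocone_Hom: "is_cocone J C D c \<kappa> \<Longrightarrow> j \<in> Ob J \<Longrightarrow> \<kappa> j \<in> Hom C (obj_map D j) c"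
  and is_cocone_Ob: "is_cocone J C D c \<kappa> \<Longrightarrow> c \<in> Ob C"
  and is_cocone_Comp: "is_cocone J C D c \<kappa> \<Longrightarrow> a \<in> Hom J i j \<Longrightarrow> Comp C (\<kappa> j) (arr_map D a) = \<kappa> i"
  by (auto simp: is_cocone_def)

lemma is_colimit_cocone: "is_colimit J C D c \<kappa> \<Longrightarrow> is_cocone J C D c \<kappa>"
  by (simp add: is_colimit_def)

lemma is_colimit_ex1:
  "is_colimit J C D c \<kappa> \<Longrightarrow> is_cocone J C D d \<mu> \<Longrightarrow>
    \<exists>!u. u \<in> Hom C c d \<and> (\<forall>j \<in> Ob J. Comp C u (\<kappa> j) = \<mu> j)"
  by (simp add: is_colimit_def)

lemma is_cocone_push:
  assumes C: "is_category C" and D: "is_functor J C D"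
    and k: "is_cocone J C D c \<kappa>" and u: "u \<in> Hom C c d" and J: "is_category J"
  shows "is_cocone J C D d (\<lambda>j. Comp C u (\<kappa> j))"
proof -
  have "Comp C (Comp C u (\<kappa> j)) (arr_map D a) = Comp C u (\<kappa> i)" if a: "a \<in> Hom J i j" for i j a
    using Comp_assoc[OF C u is_cocone_Hom[OF k] is_functor_Hom[OF D a]] is_cocone_Comp[OF k a]
      Hom_Ob[OF J a] by simp
  then show ?thesis
    using Hom_Ob[OF C u] Comp_Hom[OF C u is_cocone_Hom[OF k]] by (simp add: is_cocone_def)
qed

text \<open>The legs of a colimit are jointly epic: \<open>u\<close> and \<open>v\<close> mediate to
  the same pushed-forward cocone.\<close>

lemma is_colimit_uniq:
  assumes C: "is_category C" and J: "is_category J" and D: "is_functor J C D"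
    and k: "is_colimit J C D c \<kappa>" and u: "u \<in> Hom C c d" and v: "v \<in> Hom C c d"
    and eq: "\<And>j. j \<in> Ob J \<Longrightarrow> Comp C u (\<kappa> j) = Comp C v (\<kappa> j)"
  shows "u = v"
  using is_colimit_ex1[OF k is_cocone_push[OF C D is_colimit_cocone[OF k] u J]] u v eq by metis

text \<open>Functors are compared on carriers only, so a diagram carried along an isomorphism and
  back is merely \<open>functor_eq\<close> to itself; cocones and colimits have to be insensitive to
  the difference.\<close>

lemma is_cocone_cong:
  assumes J: "is_category J" and eq: "functor_eq J D D'" "\<And>j. j \<in> Ob J \<Longrightarrow> \<kappa> j = \<kappa>' j"
  shows "is_cocone J C D c \<kappa> \<longleftrightarrow> is_cocone J C D' c \<kappa>'"
proof -
  have "Comp C (\<kappa> j) (arr_map D a) = \<kappa> i \<longleftrightarrow> Comp C (\<kappa>' j) (arr_map D' a) = \<kappa>' i"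
    if "a \<in> Hom J i j" for a i j
    using functor_eqD(2)[OF eq(1) that] eq(2) Hom_Ob[OF J that] by simp
  then show ?thesis
    using functor_eqD(1)[OF eq(1)] eq(2) unfolding is_cocone_def by auto
qed

lemma is_colimit_cong:
  assumes J: "is_category J" and eq: "functor_eq J D D'" "\<And>j. j \<in> Ob J \<Longrightarrow> \<kappa> j = \<kappa>' j"
  shows "is_colimit J C D c \<kappa> \<longleftrightarrow> is_colimit J C D' c \<kappa>'"
  unfolding is_colimit_def
  using is_cocone_cong[OF J eq] is_cocone_cong[OF J eq(1) refl] eq(2) by (simp cong: ball_cong)

lemma is_cocone_functor_eq:
  "is_category J \<Longrightarrow> functor_eq J D D' \<Longrightarrow> is_cocone J C D c \<kappa> \<Longrightarrow> is_cocone J C D' c \<kappa>"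
  using is_cocone_cong[of J D D' \<kappa> \<kappa>] by simp

lemma is_colimit_functor_eq:
  "is_category J \<Longrightarrow> functor_eq J D D' \<Longrightarrow> is_colimit J C D c \<kappa> \<Longrightarrow> is_colimit J C D' c \<kappa>"
  using is_colimit_cong[of J D D' \<kappa> \<kappa>] by simp

lemma is_colimit_iso:
  assumes C: "is_category C" and J: "is_category J" and D: "is_functor J C D"
    and k: "is_colimit J C D c \<kappa>" and i: "is_iso C i" "i \<in> Hom C c d"
  shows "is_colimit J C D d (\<lambda>j. Comp C i (\<kappa> j))"
proof -
  obtain i' where i': "i' \<in> Hom C d c" "Comp C i' i = Id C c" "Comp C i i' = Id C d"
    using is_isoE[OF i] .
  note k0 = is_colimit_cocone[OF k]
  note kH = is_cocone_Hom[OF k0]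
  show ?thesis
    unfolding is_colimit_def
  proof (intro conjI allI impI is_cocone_push[OF C D k0 i(2) J])
    fix e \<mu> assume mu: "is_cocone J C D e \<mu>"
    obtain u where u: "u \<in> Hom C c e" "\<And>j. j \<in> Ob J \<Longrightarrow> Comp C u (\<kappa> j) = \<mu> j"
      using is_colimit_ex1[OF k mu] by blast
    show "\<exists>!v. v \<in> Hom C d e \<and> (\<forall>j\<in>Ob J. Comp C v (Comp C i (\<kappa> j)) = \<mu> j)"
    proof (intro ex1I[of _ "Comp C u i'"] conjI ballI)
      show "Comp C u i' \<in> Hom C d e" using Comp_Hom[OF C u(1) i'(1)] .
    next
      fix j assume j: "j \<in> Ob J"
      have "Comp C (Comp C u i') (Comp C i (\<kappa> j)) = Comp C u (Comp C (Comp C i' i) (\<kappa> j))"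
        using Comp_assoc[OF C u(1) i'(1) Comp_Hom[OF C i(2) kH[OF j]]]
          Comp_assoc[OF C i'(1) i(2) kH[OF j]] by simp
      then show "Comp C (Comp C u i') (Comp C i (\<kappa> j)) = \<mu> j"
        using i' u(2)[OF j] Comp_Id_left[OF C kH[OF j]] by simp
    next
      fix v assume v: "v \<in> Hom C d e \<and> (\<forall>j\<in>Ob J. Comp C v (Comp C i (\<kappa> j)) = \<mu> j)"
      then have vH: "v \<in> Hom C d e" by simp
      have "Comp C v i = u"
        using v u Comp_assoc[OF C vH i(2) kH]
        by (intro is_colimit_uniq[OF C J D k Comp_Hom[OF C vH i(2)] u(1)]) simp
      then show "v = Comp C u i'"
        using Comp_assoc[OF C vH i(2) i'(1)] i'(3) Comp_Id_right[OF C vH] by simp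
    qed
  qed
qed

text \<open>Isomorphism of categories rather than equivalence: colimits are then carried over on the
  nose, with no comparison isomorphisms between the composites and the identities.\<close>

definition inverse_functors ::
  "('o1, 'm1) category \<Rightarrow> ('o2, 'm2) category \<Rightarrow> ('o1, 'm1, 'o2, 'm2) functor_data
    \<Rightarrow> ('o2, 'm2, 'o1, 'm1) functor_data \<Rightarrow> bool" where
  "inverse_functors A B F G \<longleftrightarrow> is_functor A B F \<and> is_functor B A G \<and>
     functor_eq A (G \<circ>\<^sub>F F) id_functor \<and> functor_eq B (F \<circ>\<^sub>F G) id_functor"

lemma inverse_functorsD:
  assumes "inverse_functors A B F G"
  shows "is_functor A B F" "is_functor B A G"
    "x \<in> Ob A \<Longrightarrow> obj_map G (obj_map F x) = x" "f \<in> Hom A x y \<Longrightarrow> arr_map G (arr_map F f) = f"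
    "x' \<in> Ob B \<Longrightarrow> obj_map F (obj_map G x') = x'" "f' \<in> Hom B v w \<Longrightarrow> arr_map F (arr_map G f') = f'"
  using assms by (auto simp: inverse_functors_def functor_eq_def Hom_def)

lemma inverse_functors_sym: "inverse_functors A B F G \<Longrightarrow> inverse_functors B A G F"
  by (auto simp: inverse_functors_def)

lemma functor_cocone:
  assumes J: "is_category J" and D: "is_functor J A D" and F: "is_functor A B F"
    and k: "is_cocone J A D c \<kappa>"
  shows "is_cocone J B (F \<circ>\<^sub>F D) (obj_map F c) (\<lambda>j. arr_map F (\<kappa> j))"
proof -
  have "Comp B (arr_map F (\<kappa> j)) (arr_map F (arr_map D a)) = arr_map F (\<kappa> i)"
    if a: "a \<in> Hom J i j" for a i j
    using is_functor_Comp[OF F is_cocone_Hom[OF k] is_functor_Hom[OF D a]] Hom_Ob[OF J a]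
      is_cocone_Comp[OF k a] by simp
  then show ?thesis
    unfolding is_cocone_def
    using is_functor_Ob[OF F is_cocone_Ob[OF k]] is_functor_Hom[OF F is_cocone_Hom[OF k]] by simp
qed

lemma inverse_functors_colimit:
  assumes A: "is_category A" and B: "is_category B" and J: "is_category J" and D: "is_functor J A D"
    and FG: "inverse_functors A B F G" and k: "is_colimit J A D c \<kappa>"
  shows "is_colimit J B (F \<circ>\<^sub>F D) (obj_map F c) (\<lambda>j. arr_map F (\<kappa> j))"
proof -
  note FG = inverse_functorsD[OF FG]
  note k0 = is_colimit_cocone[OF k]
  note c = is_cocone_Ob[OF k0] and kH = is_cocone_Hom[OF k0]
  show ?thesis
    unfolding is_colimit_def
  proof (intro conjI allI impI functor_cocone[OF J D FG(1) k0])
    fix d \<mu> assume mu: "is_cocone J B (F \<circ>\<^sub>F D) d \<mu>"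
    note d = is_cocone_Ob[OF mu]
    have "is_cocone J A (G \<circ>\<^sub>F (F \<circ>\<^sub>F D)) (obj_map G d) (\<lambda>j. arr_map G (\<mu> j))"
      by (rule functor_cocone[OF J is_functor_comp[OF D FG(1)] FG(2) mu])
    moreover have "functor_eq J (G \<circ>\<^sub>F (F \<circ>\<^sub>F D)) D"
      using FG(3)[OF is_functor_Ob[OF D]] FG(4)[OF is_functor_Hom[OF D Ar_Hom]]
      by (simp add: functor_eq_def)
    ultimately have mu': "is_cocone J A D (obj_map G d) (\<lambda>j. arr_map G (\<mu> j))"
      by (rule is_cocone_functor_eq[OF J, rotated])
    obtain u where u: "u \<in> Hom A c (obj_map G d)"
      "\<And>j. j \<in> Ob J \<Longrightarrow> Comp A u (\<kappa> j) = arr_map G (\<mu> j)"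
      using is_colimit_ex1[OF k mu'] by blast
    show "\<exists>!u. u \<in> Hom B (obj_map F c) d \<and> (\<forall>j\<in>Ob J. Comp B u (arr_map F (\<kappa> j)) = \<mu> j)"
    proof (intro ex1I[of _ "arr_map F u"] conjI ballI)
      show "arr_map F u \<in> Hom B (obj_map F c) d"
        using is_functor_Hom[OF FG(1) u(1)] FG(5)[OF d] by simp
    next
      fix j assume "j \<in> Ob J"
      then show "Comp B (arr_map F u) (arr_map F (\<kappa> j)) = \<mu> j"
        using is_functor_Comp[OF FG(1) u(1) kH, symmetric] u(2) FG(6)[OF is_cocone_Hom[OF mu]] by simp
    next
      fix v assume v: "v \<in> Hom B (obj_map F c) d \<and> (\<forall>j\<in>Ob J. Comp B v (arr_map F (\<kappa> j)) = \<mu> j)"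
      then have vH: "v \<in> Hom B (obj_map F c) d" by simp
      have Gv: "arr_map G v \<in> Hom A c (obj_map G d)"
        using is_functor_Hom[OF FG(2) vH] FG(3)[OF c] by simp
      have "Comp A (arr_map G v) (\<kappa> j) = arr_map G (\<mu> j)" if j: "j \<in> Ob J" for j
        using is_functor_Comp[OF FG(2) vH is_functor_Hom[OF FG(1) kH[OF j]]] FG(4)[OF kH[OF j]] v j
        by simp
      then have "arr_map G v = u"
        using u Gv by (intro is_colimit_uniq[OF A J D k Gv u(1)]) simp
      then show "v = arr_map F u" using FG(6)[OF vH] by simp
    qed
  qed
qed

lemma inverse_functors_cocone_reindex:
  assumes FG: "inverse_functors I J F G" and k: "is_cocone J C D c \<kappa>"
  shows "is_cocone I C (D \<circ>\<^sub>F F) c (\<lambda>i. \<kappa> (obj_map F i))"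
  using is_functor_Ob[OF inverse_functorsD(1)[OF FG]] is_functor_Hom[OF inverse_functorsD(1)[OF FG]]
    is_cocone_Ob[OF k] is_cocone_Hom[OF k] is_cocone_Comp[OF k]
  by (simp add: is_cocone_def)

text \<open>Composing with \<open>F\<close> and with \<open>G\<close> gives mutually inverse
  passages between cocones over \<open>D\<close> and over its reindexing, with the same apex and the
  same mediating arrows.\<close>

lemma inverse_functors_colimit_reindex:
  assumes J: "is_category J" and FG: "inverse_functors I J F G" and k: "is_colimit J C D c \<kappa>"
  shows "is_colimit I C (D \<circ>\<^sub>F F) c (\<lambda>i. \<kappa> (obj_map F i))"
  unfolding is_colimit_def
proof (intro conjI allI impI)
  note FGD = inverse_functorsD[OF FG]
  show "is_cocone I C (D \<circ>\<^sub>F F) c (\<lambda>i. \<kappa> (obj_map F i))"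
    using inverse_functors_cocone_reindex[OF FG is_colimit_cocone[OF k]] .
  fix d \<mu> assume mu: "is_cocone I C (D \<circ>\<^sub>F F) d \<mu>"
  have "is_cocone J C ((D \<circ>\<^sub>F F) \<circ>\<^sub>F G) d (\<lambda>j. \<mu> (obj_map G j))"
    using inverse_functors_cocone_reindex[OF inverse_functors_sym[OF FG] mu] .
  moreover have "functor_eq J ((D \<circ>\<^sub>F F) \<circ>\<^sub>F G) D"
    using FGD(5) FGD(6)[OF Ar_Hom] by (simp add: functor_eq_def)
  ultimately have mu': "is_cocone J C D d (\<lambda>j. \<mu> (obj_map G j))"
    by (rule is_cocone_functor_eq[OF J, rotated])
  have "(\<forall>j\<in>Ob J. Comp C u (\<kappa> j) = \<mu> (obj_map G j)) \<longleftrightarrow>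
      (\<forall>i\<in>Ob I. Comp C u (\<kappa> (obj_map F i)) = \<mu> i)" for u
  proof (intro iffI ballI)
    fix j assume *: "\<forall>i\<in>Ob I. Comp C u (\<kappa> (obj_map F i)) = \<mu> i" and j: "j \<in> Ob J"
    show "Comp C u (\<kappa> j) = \<mu> (obj_map G j)"
      using bspec[OF * is_functor_Ob[OF FGD(2) j]] FGD(5)[OF j] by simp
  next
    fix i assume *: "\<forall>j\<in>Ob J. Comp C u (\<kappa> j) = \<mu> (obj_map G j)" and i: "i \<in> Ob I"
    show "Comp C u (\<kappa> (obj_map F i)) = \<mu> i"
      using bspec[OF * is_functor_Ob[OF FGD(1) i]] FGD(3)[OF i] by simp
  qed
  then show "\<exists>!u. u \<in> Hom C c d \<and> (\<forall>i\<in>Ob I. Comp C u (\<kappa> (obj_map F i)) = \<mu> i)"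
    using is_colimit_ex1[OF k mu'] by simp
qed

section \<open>Copying a category along injections\<close>

definition transport_category ::
  "('o \<Rightarrow> 'p) \<Rightarrow> ('m \<Rightarrow> 'n) \<Rightarrow> ('o, 'm) category \<Rightarrow> ('p, 'n) category" where
  "transport_category f g C =
     \<lparr>Ob = f ` Ob C, Ar = g ` Ar C,
      Dom = (\<lambda>h. f (Dom C (inv_into (Ar C) g h))), Cod = (\<lambda>h. f (Cod C (inv_into (Ar C) g h))),
      Id = (\<lambda>x. g (Id C (inv_into (Ob C) f x))),
      Comp = (\<lambda>h k. g (Comp C (inv_into (Ar C) g h) (inv_into (Ar C) g k)))\<rparr>"

text \<open>\<open>inv_into\<close> is meaningful only on the images of the carriers, which is all
  that \<open>is_category\<close> and \<open>functor_eq\<close> inspect. The copy is used twice: for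
  index categories inside \<open>nat\<close>, and for the relations on \<open>nat\<close> inside the
  types of an arbitrary cocompletion.\<close>

lemma transport_category:
  assumes C: "is_category C" and f: "inj_on f (Ob C)" and g: "inj_on g (Ar C)"
  shows "is_category (transport_category f g C)" (is "is_category ?T")
    and "inverse_functors C (transport_category f g C) \<lparr>obj_map = f, arr_map = g\<rparr>
      \<lparr>obj_map = inv_into (Ob C) f, arr_map = inv_into (Ar C) g\<rparr>" (is "inverse_functors _ _ ?F ?G")
proof -
  have T: "Ob ?T = f ` Ob C" "Ar ?T = g ` Ar C" by (auto simp: transport_category_def)
  have Id: "Id ?T (f x) = g (Id C x)" if "x \<in> Ob C" for x
    using that f by (simp add: transport_category_def)
  have DC: "Dom ?T (g h) = f (Dom C h)" "Cod ?T (g h) = f (Cod C h)" if "h \<in> Ar C" for h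
    using that g by (simp_all add: transport_category_def)
  have Comp: "Comp ?T (g k) (g h) = g (Comp C k h)" if "h \<in> Ar C" "k \<in> Ar C" for h k
    using that g by (simp add: transport_category_def)
  have Hom: "h' \<in> Hom ?T x' y' \<longleftrightarrow> (\<exists>x y h. h \<in> Hom C x y \<and> h' = g h \<and> x' = f x \<and> y' = f y)"
    for h' x' y'
    unfolding Hom_def by (auto simp: T DC)
  \<comment> \<open>\<open>Hom\<close> yields some preimages of the end points; injectivity of
    \<open>f\<close> identifies them with the given ones, so composable arrows of the copy come from
    composable arrows of \<open>C\<close>.\<close>
  have HomE: "\<exists>h. h \<in> Hom C x y \<and> h' = g h" if "h' \<in> Hom ?T (f x) (f y)" "x \<in> Ob C" "y \<in> Ob C" for h' x y
    using that Hom_Ob[OF C] inj_onD[OF f] unfolding Hom by metis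
  have HomI: "h \<in> Hom C x y \<Longrightarrow> g h \<in> Hom ?T (f x) (f y)" for x y h
    unfolding Hom by blast
  show T_cat: "is_category ?T"
    unfolding is_category_def
  proof (intro conjI ballI allI)
    fix h assume "h \<in> Ar ?T"
    then show "Dom ?T h \<in> Ob ?T" "Cod ?T h \<in> Ob ?T"
      using Hom_Ob[OF C Ar_Hom] by (auto simp: T DC)
  next
    fix x assume "x \<in> Ob ?T"
    then show "Id ?T x \<in> Hom ?T x x"
      using Id_Hom[OF C] by (auto simp: T Id intro!: HomI)
  next
    fix x y z h k assume h: "h \<in> Hom ?T x y" and k: "k \<in> Hom ?T y z"
    obtain x' y' h' where h': "h' \<in> Hom C x' y'" "h = g h'" "x = f x'" "y = f y'"
      using h Hom by auto
    obtain z' where z': "z' \<in> Ob C" "z = f z'"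
      using k Hom Hom_Ob[OF C] by metis
    obtain k' where k': "k' \<in> Hom C y' z'" "k = g k'"
      using HomE[of k y' z'] k z' h' Hom_Ob[OF C h'(1)] by auto
    show "Comp ?T k h \<in> Hom ?T x z"
      using h' k' z' by (auto simp: Comp Hom_Ar intro!: HomI Comp_Hom[OF C])
  next
    fix x y h assume h: "h \<in> Hom ?T x y"
    obtain x' y' h' where h': "h' \<in> Hom C x' y'" "h = g h'" "x = f x'" "y = f y'"
      using h Hom by auto
    note Ob = Hom_Ob[OF C h'(1)]
    show "Comp ?T h (Id ?T x) = h" "Comp ?T (Id ?T y) h = h"
      using Ob h'
      by (simp_all add: Id Comp Hom_Ar[OF h'(1)] Hom_Ar[OF Id_Hom[OF C]]
          Comp_Id_left[OF C h'(1)] Comp_Id_right[OF C h'(1)])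
  next
    fix w x y z h k l assume h: "h \<in> Hom ?T w x" and k: "k \<in> Hom ?T x y" and l: "l \<in> Hom ?T y z"
    obtain w' x' h' where h': "h' \<in> Hom C w' x'" "h = g h'" "w = f w'" "x = f x'"
      using h Hom by auto
    obtain y' where y': "y' \<in> Ob C" "y = f y'"
      using k Hom Hom_Ob[OF C] by metis
    obtain k' where k': "k' \<in> Hom C x' y'" "k = g k'"
      using HomE[of k x' y'] k y' h' Hom_Ob[OF C h'(1)] by auto
    obtain z' where z': "z' \<in> Ob C" "z = f z'"
      using l Hom Hom_Ob[OF C] by metis
    obtain l' where l': "l' \<in> Hom C y' z'" "l = g l'"
      using HomE[of l y' z'] l y' z' by auto
    show "Comp ?T l (Comp ?T k h) = Comp ?T (Comp ?T l k) h"
      using h'(2) k'(2) l'(2) Comp_assoc[OF C l'(1) k'(1) h'(1)]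
      by (simp add: Comp Hom_Ar[OF h'(1)] Hom_Ar[OF k'(1)] Hom_Ar[OF l'(1)]
          Hom_Ar[OF Comp_Hom[OF C k'(1) h'(1)]] Hom_Ar[OF Comp_Hom[OF C l'(1) k'(1)]])
  qed
  have F: "is_functor C ?T ?F"
    unfolding is_functor_def
    by (auto simp: T Id HomI Comp Hom_Ar)
  have G: "is_functor ?T C ?G"
    unfolding is_functor_def
  proof (intro conjI ballI allI)
    fix x assume "x \<in> Ob ?T"
    then show "obj_map ?G x \<in> Ob C" by (auto simp: T f)
    show "arr_map ?G (Id ?T x) = Id C (obj_map ?G x)"
      using \<open>x \<in> Ob ?T\<close> Hom_Ar[OF Id_Hom[OF C]] by (auto simp: T f g Id)
  next
    fix x y h assume "h \<in> Hom ?T x y"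
    then show "arr_map ?G h \<in> Hom C (obj_map ?G x) (obj_map ?G y)"
      using Hom_Ob[OF C] Hom_Ar by (fastforce simp: Hom f g)
  next
    fix x y z h k assume "h \<in> Hom ?T x y" "k \<in> Hom ?T y z"
    then obtain x' y' h' v' z' k' where h': "h' \<in> Hom C x' y'" "h = g h'" "y = f y'"
      "k' \<in> Hom C v' z'" "k = g k'" "y = f v'"
      using Hom by auto
    moreover have "v' = y'"
      using h' inj_onD[OF f] Hom_Ob[OF C h'(1)] Hom_Ob[OF C h'(4)] by metis
    ultimately show "arr_map ?G (Comp ?T k h) = Comp C (arr_map ?G k) (arr_map ?G h)"
      using Hom_Ar[OF Comp_Hom[OF C]] by (auto simp: Comp Hom_Ar g)
  qed
  show "inverse_functors C ?T ?F ?G"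
    unfolding inverse_functors_def using F G f g by (auto simp: functor_eq_def T)
qed

text \<open>The definitions only mention index categories on natural numbers; colimits over any finite
  index category reduce to these by renaming objects and arrows.\<close>

lemma finite_index_transport:
  fixes J :: "('j, 'k) category"
  assumes J: "is_category J" "finite (Ob J)" "finite (Ar J)"
  obtains I F G where "finite_index I" "inverse_functors I J F G"
proof -
  obtain f :: "'j \<Rightarrow> nat" where f: "inj_on f (Ob J)"
    using finite_imp_inj_to_nat_seg[OF J(2)] by blast
  obtain g :: "'k \<Rightarrow> nat" where g: "inj_on g (Ar J)"
    using finite_imp_inj_to_nat_seg[OF J(3)] by blast
  have "finite_index (transport_category f g J)"
    using transport_category(1)[OF J(1) f g] J by (simp add: finite_index_def transport_category_def)
  then show ?thesis
    using that inverse_functors_sym[OF transport_category(2)[OF J(1) f g]] by blast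
qed

lemma finitely_cocomplete_colimit:
  assumes C: "finitely_cocomplete C"
    and J: "is_category J" "finite (Ob J)" "finite (Ar J)" and D: "is_functor J C D"
  shows "\<exists>c \<kappa>. is_colimit J C D c \<kappa>"
proof -
  obtain I F G where I: "finite_index I" and FG: "inverse_functors I J F G"
    using finite_index_transport[OF J] .
  have Icat: "is_category I" using I by (simp add: finite_index_def)
  note FGD = inverse_functorsD[OF FG]
  note DF = is_functor_comp[OF FGD(1) D]
  obtain c \<kappa> where "is_colimit I C (D \<circ>\<^sub>F F) c \<kappa>"
    using C I DF unfolding finitely_cocomplete_def by blast
  from inverse_functors_colimit_reindex[OF Icat inverse_functors_sym[OF FG] this]
  have "is_colimit J C ((D \<circ>\<^sub>F F) \<circ>\<^sub>F G) c (\<lambda>j. \<kappa> (obj_map G j))" .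
  moreover have "functor_eq J ((D \<circ>\<^sub>F F) \<circ>\<^sub>F G) D"
    using FGD(5) FGD(6)[OF Ar_Hom] by (simp add: functor_eq_def)
  ultimately show ?thesis by (intro exI) (rule is_colimit_functor_eq[OF J(1), rotated])
qed

lemma preserves_finite_colimits_colimit:
  assumes F: "preserves_finite_colimits A B F"
    and J: "is_category J" "finite (Ob J)" "finite (Ar J)"
    and D: "is_functor J A D" and k: "is_colimit J A D c \<kappa>"
  shows "is_colimit J B (F \<circ>\<^sub>F D) (obj_map F c) (\<lambda>j. arr_map F (\<kappa> j))"
proof -
  obtain I U V where I: "finite_index I" and UV: "inverse_functors I J U V"
    using finite_index_transport[OF J] .
  have Icat: "is_category I" using I by (simp add: finite_index_def)
  note UVD = inverse_functorsD[OF UV]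
  note DU = is_functor_comp[OF UVD(1) D]
  have "is_colimit I B (F \<circ>\<^sub>F (D \<circ>\<^sub>F U)) (obj_map F c) (\<lambda>i. arr_map F (\<kappa> (obj_map U i)))"
    using F I DU inverse_functors_colimit_reindex[OF J(1) UV k]
    unfolding preserves_finite_colimits_def by blast
  from inverse_functors_colimit_reindex[OF Icat inverse_functors_sym[OF UV] this]
  have "is_colimit J B ((F \<circ>\<^sub>F (D \<circ>\<^sub>F U)) \<circ>\<^sub>F V) (obj_map F c)
    (\<lambda>j. arr_map F (\<kappa> (obj_map U (obj_map V j))))" .
  moreover have "functor_eq J ((F \<circ>\<^sub>F (D \<circ>\<^sub>F U)) \<circ>\<^sub>F V) (F \<circ>\<^sub>F D)"
    using UVD(5) UVD(6)[OF Ar_Hom] by (simp add: functor_eq_def)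
  ultimately show ?thesis
    using is_colimit_cong[OF J(1), of _ "F \<circ>\<^sub>F D" "\<lambda>j. arr_map F (\<kappa> (obj_map U (obj_map V j)))"
        "\<lambda>j. arr_map F (\<kappa> j)"] UVD(5) by simp
qed

lemma preserves_finite_colimits_comp:
  assumes "is_functor A B F" "preserves_finite_colimits A B F" "preserves_finite_colimits B C G"
  shows "preserves_finite_colimits A C (G \<circ>\<^sub>F F)"
  unfolding preserves_finite_colimits_def
proof (intro allI impI)
  fix J D c \<kappa> assume a: "finite_index J \<and> is_functor J A D \<and> is_colimit J A D c \<kappa>"
  then have "is_colimit J B (F \<circ>\<^sub>F D) (obj_map F c) (\<lambda>j. arr_map F (\<kappa> j))"
    using assms(2) unfolding preserves_finite_colimits_def by blast
  then have "is_colimit J C (G \<circ>\<^sub>F (F \<circ>\<^sub>F D)) (obj_map G (obj_map F c))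
      (\<lambda>j. arr_map G (arr_map F (\<kappa> j)))"
    using assms(3) a is_functor_comp[OF _ assms(1)] unfolding preserves_finite_colimits_def by blast
  then show "is_colimit J C (G \<circ>\<^sub>F F \<circ>\<^sub>F D) (obj_map (G \<circ>\<^sub>F F) c) (\<lambda>j. arr_map (G \<circ>\<^sub>F F) (\<kappa> j))"
    by (simp add: functor_comp_assoc)
qed

lemma preserves_finite_colimits_id: "preserves_finite_colimits A A id_functor"
  by (simp add: preserves_finite_colimits_def)

lemma inverse_functors_preserves_finite_colimits:
  assumes "is_category A" "is_category B" "inverse_functors A B F G"
  shows "preserves_finite_colimits A B F"
  using inverse_functors_colimit[OF assms(1,2) _ _ assms(3)]
  by (auto simp: preserves_finite_colimits_def finite_index_def)

lemma inverse_functors_finitely_cocomplete: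
  assumes A: "finitely_cocomplete A" and B: "is_category B" and FG: "inverse_functors A B F G"
  shows "finitely_cocomplete B"
  unfolding finitely_cocomplete_def
proof (intro conjI allI impI B)
  fix J D assume J: "finite_index J \<and> is_functor J B D"
  then have Jcat: "is_category J" and D: "is_functor J B D" by (auto simp: finite_index_def)
  note FGD = inverse_functorsD[OF FG]
  note GD = is_functor_comp[OF D FGD(2)]
  obtain c \<kappa> where "is_colimit J A (G \<circ>\<^sub>F D) c \<kappa>"
    using A J GD unfolding finitely_cocomplete_def by blast
  from inverse_functors_colimit[OF _ B Jcat GD FG this] A
  have "is_colimit J B (F \<circ>\<^sub>F (G \<circ>\<^sub>F D)) (obj_map F c) (\<lambda>j. arr_map F (\<kappa> j))"
    by (simp add: finitely_cocomplete_def)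
  moreover have "functor_eq J (F \<circ>\<^sub>F (G \<circ>\<^sub>F D)) D"
    using FGD(5)[OF is_functor_Ob[OF D]] FGD(6)[OF is_functor_Hom[OF D Ar_Hom]]
    by (simp add: functor_eq_def)
  ultimately show "\<exists>c \<kappa>. is_colimit J B D c \<kappa>"
    by (intro exI) (rule is_colimit_functor_eq[OF Jcat, rotated])
qed

section \<open>The categories involved\<close>

lemma Hom_category_of_homs:
  "h \<in> Hom (category_of_homs X H i c) x y \<longleftrightarrow> x \<in> X \<and> y \<in> X \<and> (\<exists>f \<in> H x y. h = (x, f, y))"
  by (auto simp: Hom_def category_of_homs_def)

lemma category_of_homs_simps [simp]:
  "Ob (category_of_homs X H i c) = X"
  "Id (category_of_homs X H i c) x = (x, i x, x)"
  "Comp (category_of_homs X H i c) (y', g, z) (x, f, y) = (x, c x g f, z)"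
  by (simp_all add: category_of_homs_def)

lemma is_category_of_homs:
  assumes "\<And>x. x \<in> X \<Longrightarrow> i x \<in> H x x"
    and "\<And>x y z f g. x \<in> X \<Longrightarrow> y \<in> X \<Longrightarrow> z \<in> X \<Longrightarrow> f \<in> H x y \<Longrightarrow> g \<in> H y z \<Longrightarrow> c x g f \<in> H x z"
    and "\<And>x y f. x \<in> X \<Longrightarrow> y \<in> X \<Longrightarrow> f \<in> H x y \<Longrightarrow> c x f (i x) = f \<and> c x (i y) f = f"
    and "\<And>w x y z f g h. w \<in> X \<Longrightarrow> x \<in> X \<Longrightarrow> y \<in> X \<Longrightarrow> z \<in> X \<Longrightarrow>
      f \<in> H w x \<Longrightarrow> g \<in> H x y \<Longrightarrow> h \<in> H y z \<Longrightarrow> c w h (c w g f) = c w (c x h g) f"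
  shows "is_category (category_of_homs X H i c)"
  unfolding is_category_def
proof (intro conjI ballI allI)
  fix f assume "f \<in> Ar (category_of_homs X H i c)"
  then show "Dom (category_of_homs X H i c) f \<in> Ob (category_of_homs X H i c)"
    "Cod (category_of_homs X H i c) f \<in> Ob (category_of_homs X H i c)"
    by (auto simp: category_of_homs_def)
qed (use assms in \<open>auto simp: Hom_category_of_homs\<close>)

definition act :: "'x \<times> 'f \<times> 'y \<Rightarrow> 'f" where
  "act h = fst (snd h)"

lemma act_simp [simp]: "act (x, f, y) = f"
  by (simp add: act_def)

subsection \<open>Strictly increasing maps\<close>

lemma Ob_L [simp]: "Ob cat_L = UNIV"
  by (simp add: cat_L_def)

text \<open>Injective and monotone together mean strictly increasing, so these arrows are the
  homomorphisms of strict linear orders. This is the form that compares with homomorphisms of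
  transitive relations.\<close>

lemma Hom_L: "h \<in> Hom cat_L m n \<longleftrightarrow>
  (\<exists>f \<in> {..<m} \<rightarrow>\<^sub>E {..<n}. h = (m, f, n) \<and> (\<forall>i j. i < j \<longrightarrow> j < m \<longrightarrow> f i < f j))"
proof -
  have "inj_on f {..<m} \<and> mono_on {..<m} f \<longleftrightarrow> (\<forall>i j. i < j \<longrightarrow> j < m \<longrightarrow> f i < f j)"
    for f :: "nat \<Rightarrow> nat"
  proof
    assume f: "inj_on f {..<m} \<and> mono_on {..<m} f"
    have "f i < f j" if "i < j" "j < m" for i j
    proof -
      have "f i \<le> f j" "f i \<noteq> f j"
        using f that mono_onD[of "{..<m}" f i j] inj_onD[of f "{..<m}" i j] by auto
      then show ?thesis by simp
    qed
    then show "\<forall>i j. i < j \<longrightarrow> j < m \<longrightarrow> f i < f j" by blast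
  next
    assume f: "\<forall>i j. i < j \<longrightarrow> j < m \<longrightarrow> f i < f j"
    then have "inj_on f {..<m}"
      by (intro linorder_inj_onI) (auto dest: less_imp_neq)
    moreover have "mono_on {..<m} f"
      using f by (auto simp: mono_on_def le_less)
    ultimately show "inj_on f {..<m} \<and> mono_on {..<m} f" ..
  qed
  then show ?thesis
    by (auto simp: cat_L_def Hom_category_of_homs)
qed

lemma L_HomI:
  assumes "\<And>i. i < m \<Longrightarrow> f i < n" "\<And>i j. i < j \<Longrightarrow> j < m \<Longrightarrow> f i < f j"
  shows "(m, restrict f {..<m}, n) \<in> Hom cat_L m n"
  using assms by (auto simp: Hom_L)

lemma L_HomD:
  assumes "h \<in> Hom cat_L m n"
  shows "i < m \<Longrightarrow> act h i < n" and "i < j \<Longrightarrow> j < m \<Longrightarrow> act h i < act h j"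
  using assms by (auto simp: Hom_L)

lemma L_ext:
  assumes "h \<in> Hom cat_L m n" "h' \<in> Hom cat_L m n" "\<And>i. i < m \<Longrightarrow> act h i = act h' i"
  shows "h = h'"
proof -
  obtain f f' where *: "h = (m, f, n)" "h' = (m, f', n)"
    "f \<in> {..<m} \<rightarrow>\<^sub>E {..<n}" "f' \<in> {..<m} \<rightarrow>\<^sub>E {..<n}"
    using assms(1,2) by (auto simp: Hom_L)
  then have "f = f'" using assms(3) by (intro PiE_ext[of f "{..<m}" "\<lambda>_. {..<n}"]) auto
  then show ?thesis using * by simp
qed

lemma act_L_Comp:
  assumes "g \<in> Hom cat_L n p" "h \<in> Hom cat_L m n" "i < m"
  shows "act (Comp cat_L g h) i = act g (act h i)"
  using assms unfolding Hom_L by (auto simp: cat_L_def compose_def)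

lemma act_L_Id: "i < n \<Longrightarrow> act (Id cat_L n) i = i"
  by (simp add: cat_L_def)

lemma is_category_L: "is_category cat_L"
  unfolding cat_L_def
proof (rule is_category_of_homs)
  fix x y z f g
  assume "f \<in> {f \<in> {..<x} \<rightarrow>\<^sub>E {..<y}. inj_on f {..<x} \<and> mono_on {..<x} f}"
    and "g \<in> {f \<in> {..<y} \<rightarrow>\<^sub>E {..<z}. inj_on f {..<y} \<and> mono_on {..<y} f}"
  then show "compose {..<x} g f \<in> {f \<in> {..<x} \<rightarrow>\<^sub>E {..<z}. inj_on f {..<x} \<and> mono_on {..<x} f}"
    by (auto simp: compose_def inj_on_def mono_on_def) (metis PiE_mem lessThan_iff)+
next
  fix x and y :: nat and f
  assume "f \<in> {f \<in> {..<x} \<rightarrow>\<^sub>E {..<y}. inj_on f {..<x} \<and> mono_on {..<x} f}"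
  then have f: "f \<in> {..<x} \<rightarrow>\<^sub>E {..<y}" by simp
  have fe: "f \<in> extensional {..<x}" and fm: "f \<in> {..<x} \<rightarrow> {..<y}"
    using f by (simp_all add: PiE_def)
  show "compose {..<x} f (\<lambda>i\<in>{..<x}. i) = f \<and> compose {..<x} (\<lambda>i\<in>{..<y}. i) f = f"
    using compose_Id[OF fm fe] Id_compose[OF fm fe] by simp
next
  fix w x y z :: nat and f g h
  assume "f \<in> {f \<in> {..<w} \<rightarrow>\<^sub>E {..<x}. inj_on f {..<w} \<and> mono_on {..<w} f}"
  then have f: "f \<in> {..<w} \<rightarrow> {..<x}" by auto
  show "compose {..<w} h (compose {..<w} g f) = compose {..<w} (compose {..<x} h g) f"
    by (rule compose_assoc[OF f])
qed (auto simp: inj_on_def mono_on_def)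

subsection \<open>Finite transitive relations\<close>

type_synonym 'a rel_arrow = "('a set \<times> 'a rel) \<times> ('a \<Rightarrow> 'a) \<times> ('a set \<times> 'a rel)"

lemma Ob_TransRel: "X \<in> Ob cat_TransRel \<longleftrightarrow> finite (fst X) \<and> snd X \<subseteq> fst X \<times> fst X \<and> trans (snd X)"
  by (auto simp: cat_TransRel_def)

lemma TransRel_Ob_subset: "X \<in> Ob cat_TransRel \<Longrightarrow> (a, b) \<in> snd X \<Longrightarrow> a \<in> fst X \<and> b \<in> fst X"
  by (auto simp: Ob_TransRel)

lemma Hom_TransRel: "h \<in> Hom cat_TransRel X Y \<longleftrightarrow> X \<in> Ob cat_TransRel \<and> Y \<in> Ob cat_TransRel \<and>
  (\<exists>f \<in> fst X \<rightarrow>\<^sub>E fst Y. h = (X, f, Y) \<and> (\<forall>a b. (a, b) \<in> snd X \<longrightarrow> (f a, f b) \<in> snd Y))"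
  by (cases X; cases Y) (auto simp: cat_TransRel_def Hom_category_of_homs)

lemma TransRel_HomI:
  assumes "X \<in> Ob cat_TransRel" "Y \<in> Ob cat_TransRel"
    and "\<And>a. a \<in> fst X \<Longrightarrow> f a \<in> fst Y" "\<And>a b. (a, b) \<in> snd X \<Longrightarrow> (f a, f b) \<in> snd Y"
  shows "(X, restrict f (fst X), Y) \<in> Hom cat_TransRel X Y"
  using assms TransRel_Ob_subset[OF assms(1)] by (auto simp: Hom_TransRel)

lemma TransRel_HomD:
  assumes "h \<in> Hom cat_TransRel X Y"
  shows "a \<in> fst X \<Longrightarrow> act h a \<in> fst Y" and "(a, b) \<in> snd X \<Longrightarrow> (act h a, act h b) \<in> snd Y"
    and "X \<in> Ob cat_TransRel" "Y \<in> Ob cat_TransRel"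
  using assms by (auto simp: Hom_TransRel)

lemma TransRel_ext:
  assumes "h \<in> Hom cat_TransRel X Y" "h' \<in> Hom cat_TransRel X Y"
    and "\<And>a. a \<in> fst X \<Longrightarrow> act h a = act h' a"
  shows "h = h'"
proof -
  obtain f f' where *: "h = (X, f, Y)" "h' = (X, f', Y)" "f \<in> fst X \<rightarrow>\<^sub>E fst Y" "f' \<in> fst X \<rightarrow>\<^sub>E fst Y"
    using assms(1,2) by (auto simp: Hom_TransRel)
  then have "f = f'" using assms(3) by (intro PiE_ext[of f "fst X" "\<lambda>_. fst Y"]) auto
  then show ?thesis using * by simp
qed

lemma act_TransRel_Comp:
  assumes "g \<in> Hom cat_TransRel Y Z" "h \<in> Hom cat_TransRel X Y" "a \<in> fst X"
  shows "act (Comp cat_TransRel g h) a = act g (act h a)"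
  using assms unfolding Hom_TransRel by (cases X) (auto simp: cat_TransRel_def compose_def)

lemma act_TransRel_Id: "a \<in> fst X \<Longrightarrow> act (Id cat_TransRel X) a = a"
  by (cases X) (simp add: cat_TransRel_def)

lemma is_category_TransRel: "is_category cat_TransRel"
  unfolding cat_TransRel_def
proof (rule is_category_of_homs, goal_cases)
  case (1 x)
  then show ?case by auto
next
  case (2 x y z f g)
  then have f: "f \<in> fst x \<rightarrow>\<^sub>E fst y" "\<And>a b. (a, b) \<in> snd x \<Longrightarrow> (f a, f b) \<in> snd y"
    and g: "g \<in> fst y \<rightarrow>\<^sub>E fst z" "\<And>a b. (a, b) \<in> snd y \<Longrightarrow> (g a, g b) \<in> snd z"
    and x: "snd x \<subseteq> fst x \<times> fst x"
    by (auto simp: split_beta)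
  have "compose (fst x) g f \<in> fst x \<rightarrow>\<^sub>E fst z"
    using f(1) g(1) by (auto simp: compose_def)
  moreover have "(compose (fst x) g f a, compose (fst x) g f b) \<in> snd z" if "(a, b) \<in> snd x" for a b
    using f(2)[OF that] g(2) x that by (auto simp: compose_def)
  ultimately show ?case by (auto simp: split_beta)
next
  case (3 x y f)
  then have f: "f \<in> fst x \<rightarrow>\<^sub>E fst y" by (auto simp: split_beta)
  have fe: "f \<in> extensional (fst x)" and fm: "f \<in> fst x \<rightarrow> fst y"
    using f by (simp_all add: PiE_def)
  show ?case
    unfolding split_beta using compose_Id[OF fm fe] Id_compose[OF fm fe] by simp
next
  case (4 w x y z f g h)
  then have f: "f \<in> fst w \<rightarrow> fst x" by (auto simp: split_beta)
  show ?case
    unfolding split_beta by (rule compose_assoc[OF f])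
qed

section \<open>Colimits of finite transitive relations\<close>

text \<open>The target is a bare transitive relation on any type: no carrier, no finiteness, no
  tagged arrows. This covers the relation \<open>Rel d\<close> on the arrows of a category.\<close>

definition rel_cocone ::
  "('j, 'k) category \<Rightarrow> ('j, 'k, 'a set \<times> 'a rel, 'c \<times> ('a \<Rightarrow> 'a) \<times> 'd) functor_data
    \<Rightarrow> 'b rel \<Rightarrow> ('j \<Rightarrow> 'a \<Rightarrow> 'b) \<Rightarrow> bool" where
  "rel_cocone J D s \<mu> \<longleftrightarrow> trans s \<and>
     (\<forall>j \<in> Ob J. \<forall>(a, b) \<in> snd (obj_map D j). (\<mu> j a, \<mu> j b) \<in> s) \<and>
     (\<forall>i j. \<forall>t \<in> Hom J i j. \<forall>a \<in> fst (obj_map D i). \<mu> j (act (arr_map D t) a) = \<mu> i a)"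

lemma rel_coconeD:
  assumes "rel_cocone J D s \<mu>"
  shows "trans s" "j \<in> Ob J \<Longrightarrow> (a, b) \<in> snd (obj_map D j) \<Longrightarrow> (\<mu> j a, \<mu> j b) \<in> s"
    "t \<in> Hom J i j \<Longrightarrow> a \<in> fst (obj_map D i) \<Longrightarrow> \<mu> j (act (arr_map D t) a) = \<mu> i a"
  using assms unfolding rel_cocone_def by fast+

lemma is_cocone_rel_cocone:
  assumes J: "is_category J" and D: "is_functor J cat_TransRel D"
    and k: "is_cocone J cat_TransRel D X \<kappa>"
  shows "rel_cocone J D (snd X) (\<lambda>j. act (\<kappa> j))"
  unfolding rel_cocone_def
proof (intro conjI ballI allI)
  show "trans (snd X)"
    using is_cocone_Ob[OF k] by (simp add: Ob_TransRel)
  fix j p assume "j \<in> Ob J" "p \<in> snd (obj_map D j)"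
  then show "case p of (a, b) \<Rightarrow> (act (\<kappa> j) a, act (\<kappa> j) b) \<in> snd X"
    using TransRel_HomD(2)[OF is_cocone_Hom[OF k]] by auto
next
  fix i j t a assume t: "t \<in> Hom J i j" and a: "a \<in> fst (obj_map D i)"
  show "act (\<kappa> j) (act (arr_map D t) a) = act (\<kappa> i) a"
    using act_TransRel_Comp[OF is_cocone_Hom[OF k] is_functor_Hom[OF D t] a] is_cocone_Comp[OF k t]
      Hom_Ob[OF J t] by simp
qed

lemma rel_cocone_is_cocone:
  assumes J: "is_category J" and D: "is_functor J cat_TransRel D" and X: "X \<in> Ob cat_TransRel"
    and m: "rel_cocone J D (snd X) \<mu>"
    and in_X: "\<And>j a. j \<in> Ob J \<Longrightarrow> a \<in> fst (obj_map D j) \<Longrightarrow> \<mu> j a \<in> fst X"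
  shows "is_cocone J cat_TransRel D X (\<lambda>j. (obj_map D j, restrict (\<mu> j) (fst (obj_map D j)), X))"
    (is "is_cocone _ _ _ _ ?\<kappa>")
proof -
  have k: "?\<kappa> j \<in> Hom cat_TransRel (obj_map D j) X" if "j \<in> Ob J" for j
    using is_functor_Ob[OF D that] X in_X[OF that] rel_coconeD(2)[OF m that]
    by (intro TransRel_HomI)
  have "Comp cat_TransRel (?\<kappa> j) (arr_map D t) = ?\<kappa> i" if t: "t \<in> Hom J i j" for t i j
  proof (rule TransRel_ext)
    note Dt = is_functor_Hom[OF D t]
    show "Comp cat_TransRel (?\<kappa> j) (arr_map D t) \<in> Hom cat_TransRel (obj_map D i) X"
      using Comp_Hom[OF is_category_TransRel k Dt] Hom_Ob[OF J t] by simp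
    show "?\<kappa> i \<in> Hom cat_TransRel (obj_map D i) X"
      using k Hom_Ob[OF J t] by simp
    fix a assume a: "a \<in> fst (obj_map D i)"
    show "act (Comp cat_TransRel (?\<kappa> j) (arr_map D t)) a = act (?\<kappa> i) a"
      using act_TransRel_Comp[OF k Dt a] Hom_Ob[OF J t] TransRel_HomD(1)[OF Dt a]
        rel_coconeD(3)[OF m t a] a by simp
  qed
  then show ?thesis
    using X k by (simp add: is_cocone_def)
qed

text \<open>The colimit is the disjoint union of the diagram, with two points identified, respectively
  related, whenever every cocone does so; this avoids generating equivalence relations and
  transitive closures.\<close>

lemma TransRel_colimit_ex:
  fixes D :: "('j, 'k, 'a::infinite set \<times> 'a rel, _) functor_data"
  assumes J: "is_category J" and fin: "finite (Ob J)" and D: "is_functor J cat_TransRel D"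
  shows "\<exists>K \<kappa>. is_colimit J cat_TransRel D K \<kappa>"
proof -
  let ?A = "\<lambda>j. fst (obj_map D j)"
  define S where "S = Sigma (Ob J) ?A"
  define ev where "ev \<mu> p = \<mu> (fst p) (snd p)" for \<mu> :: "'j \<Rightarrow> 'a \<Rightarrow> 'a" and p
  \<comment> \<open>Both \<open>eq\<close> and \<open>lt\<close> are intersections over all cocones,
    so being an equivalence, respectively transitive, is inherited from the targets. Targets on
    \<open>'a\<close> suffice because the objects of the category have their elements there.\<close>
  define eq where "eq p q \<longleftrightarrow> (\<forall>(s :: 'a rel) \<mu>. rel_cocone J D s \<mu> \<longrightarrow> ev \<mu> p = ev \<mu> q)" for p q
  define lt where "lt p q \<longleftrightarrow> (\<forall>(s :: 'a rel) \<mu>. rel_cocone J D s \<mu> \<longrightarrow> (ev \<mu> p, ev \<mu> q) \<in> s)" for p q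
  have DO: "obj_map D j \<in> Ob cat_TransRel" if "j \<in> Ob J" for j
    using is_functor_Ob[OF D that] .
  have finS: "finite S"
    unfolding S_def using fin DO by (auto simp: Ob_TransRel)
  define cls where "cls p = {q \<in> S. eq p q}" for p
  \<comment> \<open>The classes are sets of pairs; being finitely many, they can be renamed by
    elements of the infinite type \<open>'a\<close>.\<close>
  obtain e :: "_ \<Rightarrow> 'a" where e: "inj_on e (cls ` S)"
    using arb_inj_on_finite_infinite finS by blast
  define h where "h p = e (cls p)" for p
  have h_eq: "h p = h q \<longleftrightarrow> eq p q" if "p \<in> S" "q \<in> S" for p q
  proof -
    have "h p = h q \<longleftrightarrow> cls p = cls q"
      unfolding h_def using e that by (auto simp: inj_on_def)
    also have "\<dots> \<longleftrightarrow> eq p q"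
    proof
      assume "cls p = cls q"
      moreover have "q \<in> cls q" using that by (simp add: cls_def eq_def)
      ultimately have "q \<in> cls p" by simp
      then show "eq p q" by (simp add: cls_def)
    next
      assume "eq p q"
      then show "cls p = cls q" by (simp add: cls_def eq_def)
    qed
    finally show ?thesis .
  qed
  define K where "K = (h ` S, {(h p, h q) |p q. p \<in> S \<and> q \<in> S \<and> lt p q})"
  have fstK: "fst K = h ` S" by (simp add: K_def)
  have sndK: "(x, y) \<in> snd K \<longleftrightarrow> (\<exists>p \<in> S. \<exists>q \<in> S. x = h p \<and> y = h q \<and> lt p q)" for x y
    unfolding K_def snd_conv by blast
  have "trans (snd K)"
  proof (rule transI)
    fix x y z assume "(x, y) \<in> snd K" "(y, z) \<in> snd K"
    then obtain p q q' r where *: "p \<in> S" "q \<in> S" "q' \<in> S" "r \<in> S" "lt p q" "lt q' r"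
      "x = h p" "y = h q" "h q = h q'" "z = h r"
      unfolding sndK by metis
    \<comment> \<open>The middle point may have two representatives, but each cocone identifies
      them.\<close>
    then have "eq q q'" using h_eq by blast
    with * have "lt p r"
      unfolding lt_def eq_def by (metis rel_coconeD(1) transD)
    with * show "(x, z) \<in> snd K" unfolding sndK by blast
  qed
  then have K: "K \<in> Ob cat_TransRel"
    using finS by (auto simp: Ob_TransRel K_def)
  define \<mu>0 where "\<mu>0 j a = h (j, a)" for j a
  have "rel_cocone J D (snd K) \<mu>0"
    unfolding rel_cocone_def
  proof (intro conjI ballI allI)
    show "trans (snd K)" using K by (simp add: Ob_TransRel)
    fix j p assume j: "j \<in> Ob J" and p: "p \<in> snd (obj_map D j)"
    obtain a b where ab: "p = (a, b)" by (cases p)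
    have "lt (j, a) (j, b)"
      unfolding lt_def ev_def using rel_coconeD(2) j p ab by auto
    moreover have "(j, a) \<in> S" "(j, b) \<in> S"
      using TransRel_Ob_subset[OF DO] j p ab by (auto simp: S_def)
    ultimately show "case p of (a, b) \<Rightarrow> (\<mu>0 j a, \<mu>0 j b) \<in> snd K"
      unfolding ab prod.case sndK \<mu>0_def by blast
  next
    fix i j t a assume t: "t \<in> Hom J i j" and a: "a \<in> ?A i"
    have "eq (j, act (arr_map D t) a) (i, a)"
      unfolding eq_def ev_def using rel_coconeD(3) t a by auto
    moreover have "(j, act (arr_map D t) a) \<in> S" "(i, a) \<in> S"
      using Hom_Ob[OF J t] a TransRel_HomD(1)[OF is_functor_Hom[OF D t] a] by (auto simp: S_def)
    ultimately show "\<mu>0 j (act (arr_map D t) a) = \<mu>0 i a"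
      using h_eq by (simp add: \<mu>0_def)
  qed
  then have cocone: "is_cocone J cat_TransRel D K
      (\<lambda>j. (obj_map D j, restrict (\<mu>0 j) (?A j), K))" (is "is_cocone _ _ _ _ ?\<kappa>")
    by (rule rel_cocone_is_cocone[OF J D K]) (auto simp: K_def S_def \<mu>0_def)
  have "\<exists>!u. u \<in> Hom cat_TransRel K X \<and> (\<forall>j \<in> Ob J. Comp cat_TransRel u (?\<kappa> j) = \<mu> j)"
    if m: "is_cocone J cat_TransRel D X \<mu>" for X \<mu>
  proof -
    let ?m = "ev (\<lambda>j. act (\<mu> j))"
    note rc = is_cocone_rel_cocone[OF J D m]
    note X = is_cocone_Ob[OF m]
    \<comment> \<open>A cocone takes equal values on the representatives of one class, so the choice
      made by \<open>inv_into\<close> is immaterial.\<close>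
    define v where "v x = ?m (inv_into S h x)" for x
    have v: "v (h p) = ?m p" if "p \<in> S" for p
    proof -
      have "eq (inv_into S h (h p)) p"
        using h_eq that by (metis f_inv_into_f imageI inv_into_into)
      then show ?thesis
        unfolding v_def eq_def using rc by blast
    qed
    define u where "u = (K, restrict v (fst K), X)"
    have u: "u \<in> Hom cat_TransRel K X"
      unfolding u_def
    proof (rule TransRel_HomI[OF K X])
      fix x assume "x \<in> fst K"
      then obtain p where p: "p \<in> S" "x = h p" by (auto simp: fstK)
      then show "v x \<in> fst X"
        using TransRel_HomD(1)[OF is_cocone_Hom[OF m]] by (auto simp: v ev_def S_def)
    next
      fix x y assume "(x, y) \<in> snd K"
      then obtain p q where p: "p \<in> S" "q \<in> S" "x = h p" "y = h q" "lt p q"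
        unfolding sndK by blast
      then show "(v x, v y) \<in> snd X"
        using rc by (auto simp: v lt_def)
    qed
    have ku: "Comp cat_TransRel w (?\<kappa> j) = \<mu> j \<longleftrightarrow> (\<forall>a \<in> ?A j. act w (h (j, a)) = act (\<mu> j) a)"
      if w: "w \<in> Hom cat_TransRel K X" and j: "j \<in> Ob J" for w j
    proof
      assume "Comp cat_TransRel w (?\<kappa> j) = \<mu> j"
      then show "\<forall>a \<in> ?A j. act w (h (j, a)) = act (\<mu> j) a"
        using act_TransRel_Comp[OF w is_cocone_Hom[OF cocone j]] by (simp add: \<mu>0_def)
    next
      assume *: "\<forall>a \<in> ?A j. act w (h (j, a)) = act (\<mu> j) a"
      show "Comp cat_TransRel w (?\<kappa> j) = \<mu> j"
        using act_TransRel_Comp[OF w is_cocone_Hom[OF cocone j]] *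
        by (intro TransRel_ext[OF Comp_Hom[OF is_category_TransRel w is_cocone_Hom[OF cocone j]]
              is_cocone_Hom[OF m j]])
          (simp add: \<mu>0_def)
    qed
    show ?thesis
    proof (intro ex1I[of _ u] conjI ballI u)
      fix j assume j: "j \<in> Ob J"
      then show "Comp cat_TransRel u (?\<kappa> j) = \<mu> j"
        unfolding ku[OF u j] by (auto simp: u_def v ev_def S_def fstK)
    next
      fix w assume w: "w \<in> Hom cat_TransRel K X \<and> (\<forall>j \<in> Ob J. Comp cat_TransRel w (?\<kappa> j) = \<mu> j)"
      then have wH: "w \<in> Hom cat_TransRel K X" by simp
      show "w = u"
      proof (rule TransRel_ext[OF wH u])
        fix x assume x: "x \<in> fst K"
        then obtain j a where ja: "j \<in> Ob J" "a \<in> ?A j" "x = h (j, a)" by (auto simp: fstK S_def)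
        then have "act w x = act (\<mu> j) a"
          using w ku[OF wH] by blast
        also have "\<dots> = act u x"
          using ja x v[of "(j, a)"] by (auto simp: u_def S_def ev_def)
        finally show "act w x = act u x" .
      qed
    qed
  qed
  then show ?thesis
    using cocone unfolding is_colimit_def by blast
qed

lemma finitely_cocomplete_TransRel:
  "finitely_cocomplete (cat_TransRel :: ('a::infinite set \<times> 'a rel, _) category)"
  unfolding finitely_cocomplete_def finite_index_def
  using TransRel_colimit_ex is_category_TransRel by blast

text \<open>The target of a cocone may be an infinite relation on any type, since only the finite image
  of the cocone matters.\<close>

lemma TransRel_colimit_factor:
  fixes D :: "('j, 'k, 'a::infinite set \<times> 'a rel, _) functor_data" and s :: "'b rel"
  assumes J: "is_category J" and fin: "finite (Ob J)" and D: "is_functor J cat_TransRel D"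
    and k: "is_colimit J cat_TransRel D K \<kappa>" and m: "rel_cocone J D s \<mu>"
  obtains v where "\<And>x y. (x, y) \<in> snd K \<Longrightarrow> (v x, v y) \<in> s"
    and "\<And>j a. j \<in> Ob J \<Longrightarrow> a \<in> fst (obj_map D j) \<Longrightarrow> v (act (\<kappa> j) a) = \<mu> j a"
proof -
  let ?A = "\<lambda>j. fst (obj_map D j)"
  define T where "T = (\<Union>j \<in> Ob J. \<mu> j ` ?A j)"
  have "finite T"
    unfolding T_def using fin is_functor_Ob[OF D] by (auto simp: Ob_TransRel)
  then obtain e :: "'b \<Rightarrow> 'a" where e: "inj_on e T"
    using arb_inj_on_finite_infinite by blast
  define X where "X = (e ` T, {(e x, e y) |x y. x \<in> T \<and> y \<in> T \<and> (x, y) \<in> s})"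
  have "trans (snd X)"
  proof (rule transI)
    fix x y z assume "(x, y) \<in> snd X" "(y, z) \<in> snd X"
    then show "(x, z) \<in> snd X"
      using inj_onD[OF e] transD[OF rel_coconeD(1)[OF m]] unfolding X_def by fastforce
  qed
  then have X: "X \<in> Ob cat_TransRel"
    using \<open>finite T\<close> by (auto simp: Ob_TransRel X_def)
  have inT: "\<mu> j a \<in> T" if "j \<in> Ob J" "a \<in> ?A j" for j a
    using that by (auto simp: T_def)
  have rc: "rel_cocone J D (snd X) (\<lambda>j a. e (\<mu> j a))"
    unfolding rel_cocone_def
  proof (intro conjI ballI allI)
    show "trans (snd X)" by fact
    fix j p assume j: "j \<in> Ob J" and p: "p \<in> snd (obj_map D j)"
    obtain a b where ab: "p = (a, b)" by (cases p)
    have "\<mu> j a \<in> T" "\<mu> j b \<in> T" "(\<mu> j a, \<mu> j b) \<in> s"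
      using TransRel_Ob_subset[OF is_functor_Ob[OF D j]] inT[OF j] rel_coconeD(2)[OF m j] p ab
      by auto
    then show "case p of (a, b) \<Rightarrow> (e (\<mu> j a), e (\<mu> j b)) \<in> snd X"
      by (auto simp: ab X_def)
  qed (use rel_coconeD(3)[OF m] in simp)
  have "is_cocone J cat_TransRel D X (\<lambda>j. (obj_map D j, restrict (\<lambda>a. e (\<mu> j a)) (?A j), X))"
    (is "is_cocone _ _ _ _ ?l")
    by (rule rel_cocone_is_cocone[OF J D X rc]) (auto simp: X_def inT)
  then obtain u where u: "u \<in> Hom cat_TransRel K X"
    "\<And>j. j \<in> Ob J \<Longrightarrow> Comp cat_TransRel u (\<kappa> j) = ?l j"
    using is_colimit_ex1[OF k] by blast
  have ua: "act u (act (\<kappa> j) a) = e (\<mu> j a)" if j: "j \<in> Ob J" and a: "a \<in> ?A j" for j a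
    using act_TransRel_Comp[OF u(1) is_cocone_Hom[OF is_colimit_cocone[OF k] j] a] u(2)[OF j] a
    by simp
  define v where "v x = inv_into T e (act u x)" for x
  show ?thesis
  proof (rule that[of v])
    fix x y assume "(x, y) \<in> snd K"
    then show "(v x, v y) \<in> s"
      using TransRel_HomD(2)[OF u(1)] e by (fastforce simp: v_def X_def)
  next
    fix j a assume "j \<in> Ob J" "a \<in> ?A j"
    then show "v (act (\<kappa> j) a) = \<mu> j a"
      using ua e inT by (simp add: v_def)
  qed
qed

text \<open>Two maps into a complete relation that differ only at an element missed by all legs
  would agree on every leg, against the joint epimorphy of the legs.\<close>

lemma TransRel_colimit_surj:
  fixes D :: "('j, 'k, 'a::infinite set \<times> 'a rel, _) functor_data"
  assumes J: "is_category J" and D: "is_functor J cat_TransRel D"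
    and k: "is_colimit J cat_TransRel D K \<kappa>" and x: "x \<in> fst K"
  shows "\<exists>j \<in> Ob J. \<exists>a \<in> fst (obj_map D j). act (\<kappa> j) a = x"
proof (rule ccontr)
  assume "\<not> ?thesis"
  then have nx: "act (\<kappa> j) a \<noteq> x" if "j \<in> Ob J" "a \<in> fst (obj_map D j)" for j a
    using that by blast
  note k0 = is_colimit_cocone[OF k]
  have K: "K \<in> Ob cat_TransRel" using is_cocone_Ob[OF k0] .
  obtain p :: 'a where True by blast
  obtain q :: 'a where q: "q \<noteq> p"
    using arb_element[of "{p}"] by auto
  \<comment> \<open>In the complete relation on two points every function is a homomorphism, so a
    map may take either value at \<open>x\<close> alone.\<close>
  define X where "X = ({p, q}, {p, q} \<times> {p, q})"
  have X: "X \<in> Ob cat_TransRel"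
    by (auto simp: Ob_TransRel X_def trans_def)
  define u where "u r = (K, restrict (\<lambda>z. if z = x then r else p) (fst K), X)" for r
  have u: "u r \<in> Hom cat_TransRel K X" if "r \<in> {p, q}" for r
    unfolding u_def using that by (intro TransRel_HomI[OF K X]) (auto simp: X_def)
  have "u p = u q"
  proof (rule is_colimit_uniq[OF is_category_TransRel J D k])
    fix j assume j: "j \<in> Ob J"
    note kj = is_cocone_Hom[OF k0 j]
    show "Comp cat_TransRel (u p) (\<kappa> j) = Comp cat_TransRel (u q) (\<kappa> j)"
    proof (rule TransRel_ext)
      fix a assume a: "a \<in> fst (obj_map D j)"
      show "act (Comp cat_TransRel (u p) (\<kappa> j)) a = act (Comp cat_TransRel (u q) (\<kappa> j)) a"
        using act_TransRel_Comp[OF u kj a, of p] act_TransRel_Comp[OF u kj a, of q]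
          nx[OF j a] TransRel_HomD(1)[OF kj a] by (simp add: u_def)
    qed (use Comp_Hom[OF is_category_TransRel u kj] in auto)
  qed (use u in auto)
  then have "act (u p) x = act (u q) x" by simp
  then show False using x q by (simp add: u_def)
qed

section \<open>The embedding of the linear orders\<close>

text \<open>The carrier type is an arbitrary infinite one, so the chains use a fixed but unspecified
  copy of the numbers in it.\<close>

definition nat_emb :: "nat \<Rightarrow> 'a::infinite" where
  "nat_emb = (SOME f. inj f)"

lemma inj_nat_emb: "inj nat_emb"
proof -
  have "\<exists>f :: nat \<Rightarrow> 'a. inj f"
    using infinite_countable_subset[OF infinite_UNIV] by blast
  then show "inj (nat_emb :: nat \<Rightarrow> 'a)"
    unfolding nat_emb_def by (rule someI_ex)
qed

lemma nat_emb_eq [simp]: "nat_emb i = nat_emb j \<longleftrightarrow> i = j"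
  using inj_nat_emb by (auto dest: injD)

lemma inv_nat_emb [simp]: "inv nat_emb (nat_emb i) = i"
  by (rule inv_f_f[OF inj_nat_emb])

definition chain :: "nat \<Rightarrow> 'a::infinite set \<times> 'a rel" where
  "chain n = (nat_emb ` {..<n}, {(nat_emb i, nat_emb j) |i j. i < j \<and> j < n})"

definition chain_functor ::
  "(nat, nat \<times> (nat \<Rightarrow> nat) \<times> nat, 'a::infinite set \<times> 'a rel,
    'a rel_arrow) functor_data" where
  "chain_functor = \<lparr>obj_map = chain,
     arr_map = (\<lambda>(m, f, n). (chain m,
       restrict (\<lambda>x. nat_emb (f (inv nat_emb x))) (fst (chain m)), chain n))\<rparr>"

lemma obj_chain_functor [simp]: "obj_map chain_functor = chain"
  by (simp add: chain_functor_def)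

lemma in_fst_chain: "x \<in> fst (chain n) \<longleftrightarrow> (\<exists>i<n. x = nat_emb i)"
  by (auto simp: chain_def)

lemma in_snd_chain: "(x, y) \<in> snd (chain n) \<longleftrightarrow> (\<exists>i j. i < j \<and> j < n \<and> x = nat_emb i \<and> y = nat_emb j)"
  by (auto simp: chain_def)

lemma nat_emb_in_fst_chain [simp]: "nat_emb i \<in> fst (chain n) \<longleftrightarrow> i < n"
  by (auto simp: in_fst_chain)

lemma nat_emb_in_snd_chain [simp]: "(nat_emb i, nat_emb j) \<in> snd (chain n) \<longleftrightarrow> i < j \<and> j < n"
  by (auto simp: in_snd_chain)

lemma chain_Ob: "chain n \<in> Ob cat_TransRel"
proof -
  have "trans (snd (chain n))"
    by (rule transI) (auto simp: in_snd_chain)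
  moreover have "finite (fst (chain n))" "snd (chain n) \<subseteq> fst (chain n) \<times> fst (chain n)"
    by (auto simp: chain_def)
  ultimately show ?thesis by (simp add: Ob_TransRel)
qed

lemma act_chain_functor:
  "h \<in> Hom cat_L m n \<Longrightarrow> i < m \<Longrightarrow> act (arr_map chain_functor h) (nat_emb i) = nat_emb (act h i)"
  by (auto simp: Hom_L chain_functor_def)

lemma chain_functor_Hom:
  "h \<in> Hom cat_L m n \<Longrightarrow> arr_map chain_functor h \<in> Hom cat_TransRel (chain m) (chain n)"
proof -
  assume h: "h \<in> Hom cat_L m n"
  then obtain f where f: "h = (m, f, n)" by (auto simp: Hom_L)
  show ?thesis
    unfolding f chain_functor_def functor_data.simps prod.case
    using L_HomD[OF h] f
    by (intro TransRel_HomI[OF chain_Ob chain_Ob]) (auto simp: in_fst_chain in_snd_chain)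
qed

lemma is_functor_chain:
  "is_functor cat_L cat_TransRel (chain_functor :: (_, _, 'a::infinite set \<times> 'a rel, _) functor_data)"
  (is "is_functor _ _ ?y")
  unfolding is_functor_def
proof (intro conjI ballI allI)
  fix n :: nat
  note Id = Id_Hom[OF is_category_L, of n, simplified]
  show "arr_map ?y (Id cat_L n) = Id cat_TransRel (obj_map ?y n)"
  proof (rule TransRel_ext)
    fix x :: 'a assume "x \<in> fst (chain n)"
    then show "act (arr_map ?y (Id cat_L n)) x =
        act (Id cat_TransRel (obj_map ?y n)) x"
      using act_chain_functor[OF Id] by (auto simp: in_fst_chain act_TransRel_Id act_L_Id)
  qed (use chain_functor_Hom[OF Id] Id_Hom[OF is_category_TransRel chain_Ob] in auto)
next
  fix m n p h g assume h: "h \<in> Hom cat_L m n" and g: "g \<in> Hom cat_L n p"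
  note gh = Comp_Hom[OF is_category_L g h]
  show "arr_map ?y (Comp cat_L g h) =
      Comp cat_TransRel (arr_map ?y g) (arr_map ?y h)"
  proof (rule TransRel_ext)
    fix x :: 'a assume x: "x \<in> fst (chain m)"
    then show "act (arr_map ?y (Comp cat_L g h)) x =
        act (Comp cat_TransRel (arr_map ?y g) (arr_map ?y h)) x"
      unfolding act_TransRel_Comp[OF chain_functor_Hom[OF g] chain_functor_Hom[OF h] x]
      by (auto simp: in_fst_chain act_chain_functor[OF gh] act_chain_functor[OF g]
          act_chain_functor[OF h] act_L_Comp[OF g h] L_HomD(1)[OF h])
  qed (use chain_functor_Hom[OF gh]
      Comp_Hom[OF is_category_TransRel chain_functor_Hom[OF g] chain_functor_Hom[OF h]] in auto)
qed (simp_all add: chain_functor_Hom chain_Ob)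

lemma chain_functor_inj:
  assumes h: "h \<in> Hom cat_L m n" "h' \<in> Hom cat_L m n"
    and eq: "(arr_map chain_functor h :: 'a::infinite rel_arrow) = arr_map chain_functor h'"
  shows "h = h'"
proof (rule L_ext[OF h])
  fix i assume i: "i < m"
  have "(nat_emb (act h i) :: 'a) = nat_emb (act h' i)"
    using act_chain_functor[OF h(1) i] act_chain_functor[OF h(2) i] eq by metis
  then show "act h i = act h' i" by simp
qed

text \<open>Homomorphisms between strict chains are the strictly increasing maps. Fullness turns
  arrows of relations between chains into arrows of \<open>cat_L\<close>, where a given colimit can
  be applied.\<close>

lemma chain_functor_full:
  fixes g :: "'a::infinite rel_arrow"
  assumes g: "g \<in> Hom cat_TransRel (chain m) (chain n)"
  obtains h where "h \<in> Hom cat_L m n" "arr_map chain_functor h = g"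
proof -
  have g_emb: "act g (nat_emb i) = nat_emb (inv nat_emb (act g (nat_emb i)))" if "i < m" for i
    using TransRel_HomD(1)[OF g, of "nat_emb i"] that by (auto simp: in_fst_chain)
  define h where "h = (m, restrict (\<lambda>i. inv nat_emb (act g (nat_emb i))) {..<m}, n)"
  have h: "h \<in> Hom cat_L m n"
    unfolding h_def
  proof (rule L_HomI)
    fix i assume "i < m"
    then show "inv nat_emb (act g (nat_emb i)) < n"
      using TransRel_HomD(1)[OF g, of "nat_emb i"] by (auto simp: in_fst_chain)
  next
    fix i j assume "i < j" "j < m"
    then show "inv nat_emb (act g (nat_emb i)) < inv nat_emb (act g (nat_emb j))"
      using TransRel_HomD(2)[OF g, of "nat_emb i" "nat_emb j"] by (auto simp: in_snd_chain)
  qed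
  moreover have "arr_map chain_functor h = g"
  proof (rule TransRel_ext[OF chain_functor_Hom[OF h] g])
    fix x :: 'a assume "x \<in> fst (chain m)"
    then obtain i where i: "i < m" "x = nat_emb i" by (auto simp: in_fst_chain)
    then have "act (arr_map chain_functor h) x = nat_emb (inv nat_emb (act g (nat_emb i)))"
      using act_chain_functor[where ?'a = 'a, OF h i(1)] by (simp add: h_def)
    then show "act (arr_map chain_functor h) x = act g x"
      using g_emb[OF i(1)] i(2) by simp
  qed
  ultimately show ?thesis using that by blast
qed

lemma is_embedding_chain:
  "is_embedding cat_L cat_TransRel (chain_functor :: (_, _, 'a::infinite set \<times> 'a rel, _) functor_data)"
  unfolding is_embedding_def
proof (intro conjI ballI is_functor_chain)
  have "n \<le> m" if "(chain m :: 'a set \<times> 'a rel) = chain n" for m n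
    using nat_emb_in_fst_chain[of m m, where ?'a = 'a] nat_emb_in_fst_chain[of m n, where ?'a = 'a] that
    by (metis leI less_irrefl)
  then show "inj_on (obj_map (chain_functor :: (_, _, 'a set \<times> 'a rel, _) functor_data)) (Ob cat_L)"
    by (auto simp: inj_on_def intro: antisym)
  show "inj_on (arr_map (chain_functor :: (_, _, 'a set \<times> 'a rel, _) functor_data)) (Hom cat_L m n)"
    for m n
    by (rule inj_onI) (rule chain_functor_inj)
qed

subsection \<open>Preservation of existing colimits\<close>

text \<open>Topological sorting: an element without successors takes the last position, and the rest
  is sorted by induction.\<close>

lemma finite_acyclic_linear_extension:
  assumes "finite A" "acyclic r" "r \<subseteq> A \<times> A"
  shows "\<exists>g. bij_betw g A {..<card A} \<and> (\<forall>(x, y) \<in> r. g x < g y)"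
  using assms
proof (induction A arbitrary: r rule: finite_psubset_induct)
  case (psubset A)
  show ?case
  proof (cases "A = {}")
    case True
    then show ?thesis using psubset.prems by (auto simp: bij_betw_def)
  next
    case False
    have "finite r" using psubset.prems psubset.hyps by (meson finite_SigmaI finite_subset)
    then have "wf (r\<inverse>)" using psubset.prems(1) by (rule finite_acyclic_wf_converse)
    then obtain m where m: "m \<in> A" "\<And>y. (m, y) \<in> r \<Longrightarrow> y \<notin> A"
      using False wfE_min'[of "r\<inverse>" A] by auto
    let ?A = "A - {m}"
    define r' where "r' = r \<inter> ?A \<times> ?A"
    have "?A \<subset> A" using m by blast
    moreover have "acyclic r'" using psubset.prems(1) by (rule acyclic_subset) (simp add: r'_def)
    moreover have "r' \<subseteq> ?A \<times> ?A" by (simp add: r'_def)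
    ultimately obtain g where g: "bij_betw g ?A {..<card ?A}" "\<forall>(x, y) \<in> r'. g x < g y"
      using psubset.IH by blast
    let ?g = "g(m := card ?A)"
    have cA: "card A = Suc (card ?A)"
      using card.remove[OF psubset.hyps(1) m(1)] .
    have "bij_betw ?g ?A {..<card ?A}"
      using g(1) by (subst bij_betw_cong[of ?A ?g g]) auto
    then have "bij_betw ?g (?A \<union> {m}) ({..<card ?A} \<union> {card ?A})"
      by (intro bij_betw_combine) (auto simp: bij_betw_def)
    moreover have "?A \<union> {m} = A" "{..<card ?A} \<union> {card ?A} = {..<card A}"
      using m cA by auto
    ultimately have "bij_betw ?g A {..<card A}" by simp
    moreover have "?g x < ?g y" if xy: "(x, y) \<in> r" for x y
    proof -
      have A: "x \<in> A" "y \<in> A" using xy psubset.prems by auto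
      then have xm: "x \<in> ?A" using xy m by auto
      show ?thesis
      proof (cases "y = m")
        case True
        then show ?thesis using bij_betwE[OF g(1)] xm by auto
      next
        case False
        then show ?thesis using g(2) xm A xy by (auto simp: r'_def)
      qed
    qed
    ultimately show ?thesis by blast
  qed
qed

text \<open>Every linear extension of the colimit \<open>K\<close> among transitive relations factors through \<open>n\<close>, but
  incomparable elements of \<open>K\<close> would be ordered either way by some extension; so \<open>K\<close> is a chain.\<close>

lemma chain_functor_colimit:
  assumes J: "is_category J" and fin: "finite (Ob J)" and D: "is_functor J cat_L D"
    and k: "is_colimit J cat_L D n \<kappa>"
  shows "is_colimit J (cat_TransRel :: ('a::infinite set \<times> 'a rel, _) category)
    (chain_functor \<circ>\<^sub>F D) (chain n) (\<lambda>j. arr_map chain_functor (\<kappa> j))"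
proof -
  let ?y = "chain_functor :: (_, _, 'a set \<times> 'a rel, _) functor_data"
  let ?Q = "cat_TransRel :: ('a set \<times> 'a rel, _) category"
  note Q = is_category_TransRel and yF = is_functor_chain[where ?'a = 'a]
  have cH: "Comp ?Q g f \<in> Hom ?Q X Z" if "g \<in> Hom ?Q Y Z" "f \<in> Hom ?Q X Y" for X Y Z f g
    using Comp_Hom[OF Q that] .
  note ass = Comp_assoc[OF Q]
  note k0 = is_colimit_cocone[OF k]
  note yD = is_functor_comp[OF D is_functor_chain]
  obtain K \<nu> where K: "is_colimit J ?Q (?y \<circ>\<^sub>F D) K \<nu>"
    using TransRel_colimit_ex[OF J fin yD] by blast
  note K0 = is_colimit_cocone[OF K]
  note nu = is_cocone_Hom[OF K0]
  have KO: "K \<in> Ob ?Q" using is_cocone_Ob[OF K0] .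
  have yk: "is_cocone J ?Q (?y \<circ>\<^sub>F D) (chain n) (\<lambda>j. arr_map ?y (\<kappa> j))"
    using functor_cocone[OF J D is_functor_chain k0] by simp
  \<comment> \<open>The comparison from the colimit \<open>K\<close> among relations to
    \<open>chain n\<close>. The goal is that it is an isomorphism.\<close>
  obtain u where u: "u \<in> Hom ?Q K (chain n)"
    "\<And>j. j \<in> Ob J \<Longrightarrow> Comp ?Q u (\<nu> j) = arr_map ?y (\<kappa> j)"
    using is_colimit_ex1[OF K yk] by blast
  \<comment> \<open>By fullness a map from \<open>K\<close> to a chain restricts along the legs to a
    cocone in \<open>cat_L\<close>, and this factors through \<open>n\<close>. So every map from
    \<open>K\<close> to a chain extends along \<open>u\<close>.\<close>
  have factor: "\<exists>f \<in> Hom cat_L n N. Comp ?Q (arr_map ?y f) u = g"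
    if g: "g \<in> Hom ?Q K (chain N)" for g N
  proof -
    have "\<exists>l. l \<in> Hom cat_L (obj_map D j) N \<and> arr_map ?y l = Comp ?Q g (\<nu> j)" if "j \<in> Ob J" for j
      using chain_functor_full[of "Comp ?Q g (\<nu> j)" "obj_map D j" N] cH[OF g nu[OF that]]
      unfolding functor_comp_simps obj_chain_functor by metis
    then obtain l where l: "\<And>j. j \<in> Ob J \<Longrightarrow> l j \<in> Hom cat_L (obj_map D j) N"
      "\<And>j. j \<in> Ob J \<Longrightarrow> arr_map ?y (l j) = Comp ?Q g (\<nu> j)"
      by metis
    have "is_cocone J cat_L D N l"
      unfolding is_cocone_def
    proof (intro conjI ballI allI)
      fix i j t assume t: "t \<in> Hom J i j"
      note Dt = is_functor_Hom[OF D t] and ij = Hom_Ob[OF J t]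
      have i: "i \<in> Ob J" and j: "j \<in> Ob J" using ij by auto
      have "arr_map ?y (Comp cat_L (l j) (arr_map D t)) = arr_map ?y (l i)"
        using is_functor_Comp[OF yF l(1)[OF j] Dt] l(2)[OF i] l(2)[OF j]
          is_cocone_Comp[OF K0 t] ass[OF g nu[OF j] is_functor_Hom[OF yD t]] by simp
      then show "Comp cat_L (l j) (arr_map D t) = l i"
        by (rule chain_functor_inj[OF Comp_Hom[OF is_category_L l(1)[OF j] Dt] l(1)[OF i]])
    qed (use l in auto)
    then obtain f where f: "f \<in> Hom cat_L n N" "\<And>j. j \<in> Ob J \<Longrightarrow> Comp cat_L f (\<kappa> j) = l j"
      using is_colimit_ex1[OF k] by blast
    note yf = chain_functor_Hom[where ?'a = 'a, OF f(1)]
    have "Comp ?Q (arr_map ?y f) u = g"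
    proof (rule is_colimit_uniq[OF Q J yD K cH[OF yf u(1)] g])
      fix j assume j: "j \<in> Ob J"
      show "Comp ?Q (Comp ?Q (arr_map ?y f) u) (\<nu> j) = Comp ?Q g (\<nu> j)"
        using ass[OF yf u(1) nu[OF j]] u(2)[OF j] l(2)[OF j] f(2)[OF j]
          is_functor_Comp[OF yF f(1) is_cocone_Hom[OF k0 j]] by simp
    qed
    then show ?thesis using f by blast
  qed
  define idx where "idx x = inv nat_emb (act u x)" for x
  have idx: "act u x = nat_emb (idx x)" "idx x < n" if "x \<in> fst K" for x
    using TransRel_HomD(1)[OF u(1) that] by (auto simp: in_fst_chain idx_def)
  have KA: "finite (fst K)" "snd K \<subseteq> fst K \<times> fst K"
    using KO by (auto simp: Ob_TransRel)
  have "idx x < idx y" if "(x, y) \<in> snd K" for x y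
    using TransRel_HomD(2)[OF u(1) that] by (auto simp: in_snd_chain idx_def)
  \<comment> \<open>\<open>u\<close> sends related elements to strictly increasing positions, which
    rules out cycles and in particular loops.\<close>
  then have acyclic: "acyclic (snd K)"
    by (intro acyclic_subset[OF wf_acyclic[OF wf_measure[of idx]]]) (auto simp: measure_def)
  define N where "N = card (fst K)"
  define up where "up g = (K, restrict (\<lambda>x. nat_emb (g x) :: 'a) (fst K), chain N :: 'a set \<times> 'a rel)"
    for g :: "'a \<Rightarrow> nat"
  have up: "up g \<in> Hom ?Q K (chain N)"
    if "bij_betw g (fst K) {..<N}" "\<forall>(x, y) \<in> r. g x < g y" "snd K \<subseteq> r" for g r
    unfolding up_def
  proof (rule TransRel_HomI[OF KO chain_Ob])
    fix x y assume xy: "(x, y) \<in> snd K"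
    then have "y \<in> fst K" using KA by auto
    then show "(nat_emb (g x), nat_emb (g y)) \<in> snd (chain N)"
      using that xy bij_betwE[OF that(1)] by auto
  qed (use bij_betwE[OF that(1)] in auto)
  \<comment> \<open>\<open>f\<close> reads off the rank in a linear extension from the position in
    [n]; the same \<open>idx\<close> serves all linear extensions.\<close>
  have linear: "\<exists>g f. bij_betw g (fst K) {..<N} \<and> (\<forall>(x, y) \<in> r. g x < g y) \<and>
      f \<in> Hom cat_L n N \<and> Comp ?Q (arr_map ?y f) u = up g \<and> (\<forall>x \<in> fst K. act f (idx x) = g x)"
    if r: "acyclic r" "snd K \<subseteq> r" "r \<subseteq> fst K \<times> fst K" for r
  proof -
    obtain g where g: "bij_betw g (fst K) {..<N}" "\<forall>(x, y) \<in> r. g x < g y"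
      using finite_acyclic_linear_extension[OF KA(1) r(1,3)] by (auto simp: N_def)
    obtain f where f: "f \<in> Hom cat_L n N" "Comp ?Q (arr_map ?y f) u = up g"
      using factor[OF up[OF g r(2)]] by blast
    have "act f (idx x) = g x" if x: "x \<in> fst K" for x
    proof -
      have "(nat_emb (act f (idx x)) :: 'a) = act (Comp ?Q (arr_map ?y f) u) x"
        using act_TransRel_Comp[OF chain_functor_Hom[OF f(1)] u(1) x] idx[OF x]
          act_chain_functor[OF f(1) idx(2)[OF x]] by metis
      also have "\<dots> = nat_emb (g x)" using f(2) x by (simp add: up_def)
      finally show ?thesis by simp
    qed
    then show ?thesis using g f by blast
  qed
  \<comment> \<open>If \<open>b < a\<close> fails in \<open>K\<close>, the pair
    \<open>(a, b)\<close> can be added without a cycle. A linear extension then puts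
    \<open>a\<close> before \<open>b\<close>, and as it is an increasing function of
    \<open>idx\<close>, so does \<open>idx\<close>.\<close>
  have before: "idx a < idx b" if ab: "a \<in> fst K" "b \<in> fst K" "a \<noteq> b" "(b, a) \<notin> snd K" for a b
  proof -
    \<comment> \<open>\<open>snd K\<close> is transitive, so its reflexive transitive closure adds
      only the diagonal.\<close>
    have "(b, a) \<notin> (snd K)\<^sup>*"
      using KO ab by (auto simp: Ob_TransRel rtrancl_eq_or_trancl trancl_id)
    then have ins: "acyclic (insert (a, b) (snd K))" using acyclic by (simp add: acyclic_insert)
    have "insert (a, b) (snd K) \<subseteq> fst K \<times> fst K" using KA ab by auto
    from linear[OF ins subset_insertI this] obtain g f where "\<forall>(x, y) \<in> insert (a, b) (snd K). g x < g y"
      "f \<in> Hom cat_L n N" "\<forall>x \<in> fst K. act f (idx x) = g x"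
      by blast
    then have f: "f \<in> Hom cat_L n N" "act f (idx a) < act f (idx b)" using ab by auto
    show ?thesis
      using f(2) L_HomD(2)[OF f(1), of "idx b" "idx a"] idx(2)[OF ab(1)]
      by (cases "idx a" "idx b" rule: linorder_cases) auto
  qed
  \<comment> \<open>Incomparable \<open>a\<close> and \<open>b\<close> would be placed by
    \<open>idx\<close> in both orders.\<close>
  have total: "(a, b) \<in> snd K \<or> (b, a) \<in> snd K" if "a \<in> fst K" "b \<in> fst K" "a \<noteq> b" for a b
    using before[of a b] before[of b a] less_asym[of "idx a" "idx b"] that by blast
  obtain g f where g: "bij_betw g (fst K) {..<N}" "\<forall>(x, y) \<in> snd K. g x < g y"
    and f: "f \<in> Hom cat_L n N" "Comp ?Q (arr_map ?y f) u = up g"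
    using linear[OF acyclic subset_refl KA(2)] by blast
  note yf = chain_functor_Hom[where ?'a = 'a, OF f(1)]
  \<comment> \<open>\<open>down\<close> inverts \<open>up g\<close>. It preserves the order because
    \<open>K\<close> is total: if a pair of the chain were not related in \<open>K\<close>, the
    reverse pair would be, and \<open>g\<close> would contradict it.\<close>
  define down where
    "down = (chain N :: 'a set \<times> 'a rel,
      restrict (\<lambda>z :: 'a. inv_into (fst K) g (inv nat_emb z)) (fst (chain N)), K)"
  have inv_g: "inv_into (fst K) g i \<in> fst K" "g (inv_into (fst K) g i) = i" if "i < N" for i
    using g(1) that by (auto simp: bij_betw_def inv_into_into f_inv_into_f)
  have down: "down \<in> Hom ?Q (chain N) K"
    unfolding down_def
  proof (rule TransRel_HomI[OF chain_Ob KO])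
    fix x y :: 'a assume "(x, y) \<in> snd (chain N)"
    then obtain i j where ij: "i < j" "j < N" "x = nat_emb i" "y = nat_emb j"
      by (auto simp: in_snd_chain)
    let ?i = "inv_into (fst K) g i" and ?j = "inv_into (fst K) g j"
    have *: "?i \<in> fst K" "?j \<in> fst K" "g ?i = i" "g ?j = j"
      using inv_g[of i] inv_g[of j] ij by auto
    have "(?j, ?i) \<notin> snd K"
      using g(2) *(3,4) ij(1) by auto
    moreover have "?i \<noteq> ?j" using * ij by auto
    ultimately show "(inv_into (fst K) g (inv nat_emb x), inv_into (fst K) g (inv nat_emb y)) \<in> snd K"
      using total * ij by auto
  qed (use inv_g in \<open>auto simp: in_fst_chain\<close>)
  \<comment> \<open>A retraction of \<open>u\<close>: after \<open>u\<close>, the arrow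
    \<open>f\<close> gives the rank under \<open>g\<close>, and \<open>down\<close> recovers the
    element from its rank.\<close>
  define w where "w = Comp ?Q down (arr_map ?y f)"
  have w: "w \<in> Hom ?Q (chain n) K"
    unfolding w_def using cH[OF down yf] .
  note upH = up[OF g subset_refl]
  have wu: "Comp ?Q w u = Id ?Q K"
  proof (rule TransRel_ext[OF cH[OF w u(1)] Id_Hom[OF Q KO]])
    fix x assume x: "x \<in> fst K"
    have "Comp ?Q w u = Comp ?Q down (up g)"
      using ass[OF down yf u(1)] f(2) by (simp add: w_def)
    then show "act (Comp ?Q w u) x = act (Id ?Q K) x"
      using act_TransRel_Comp[OF down upH x] x g(1) bij_betwE[OF g(1)]
      by (simp add: act_TransRel_Id up_def down_def bij_betw_def)
  qed
  \<comment> \<open>By fullness this composite is an endomorphism of [n] in \<open>cat_L\<close>. It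
    fixes all legs of the given colimit, hence is the identity.\<close>
  have "Comp ?Q u w = Id ?Q (chain n)"
  proof -
    obtain h where h: "h \<in> Hom cat_L n n" "arr_map ?y h = Comp ?Q u w"
      using chain_functor_full[OF cH[OF u(1) w]] by blast
    have "h = Id cat_L n"
    proof (rule is_colimit_uniq[OF is_category_L J D k h(1)])
      show Idn: "Id cat_L n \<in> Hom cat_L n n" using Id_Hom[OF is_category_L] by simp
      fix j assume j: "j \<in> Ob J"
      note kj = is_cocone_Hom[OF k0 j]
      have "arr_map ?y (Comp cat_L h (\<kappa> j)) = Comp ?Q (Comp ?Q u w) (Comp ?Q u (\<nu> j))"
        using is_functor_Comp[OF yF h(1) kj] h(2) u(2)[OF j] by simp
      also have "\<dots> = Comp ?Q u (Comp ?Q (Comp ?Q w u) (\<nu> j))"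
        using ass[OF u(1) w cH[OF u(1) nu[OF j]]] ass[OF w u(1) nu[OF j]] by simp
      also have "\<dots> = arr_map ?y (\<kappa> j)"
        using wu Comp_Id_left[OF Q nu[OF j]] u(2)[OF j] by simp
      finally have "Comp cat_L h (\<kappa> j) = \<kappa> j"
        by (rule chain_functor_inj[OF Comp_Hom[OF is_category_L h(1) kj] kj])
      then show "Comp cat_L h (\<kappa> j) = Comp cat_L (Id cat_L n) (\<kappa> j)"
        using Comp_Id_left[OF is_category_L kj] by simp
    qed
    then show ?thesis
      using h(2) is_functor_Id[OF yF, of n] by simp
  qed
  with wu have "is_iso ?Q u" using is_isoI[OF u(1) w] by blast
  from is_colimit_iso[OF Q J yD K this u(1)]
  show ?thesis
    using is_colimit_cong[OF J, of "?y \<circ>\<^sub>F D" "?y \<circ>\<^sub>F D" "\<lambda>j. Comp ?Q u (\<nu> j)"] u(2)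
    by (simp add: functor_eq_def)
qed

lemma preserves_finite_colimits_chain: "preserves_finite_colimits cat_L cat_TransRel chain_functor"
  unfolding preserves_finite_colimits_def finite_index_def
  using chain_functor_colimit by fastforce

section \<open>Diagrams of points and edges\<close>

definition point :: "nat \<Rightarrow> nat \<Rightarrow> nat \<times> (nat \<Rightarrow> nat) \<times> nat" where
  "point i n = (1, restrict (\<lambda>_. i) {..<1}, n)"

definition edge :: "nat \<Rightarrow> nat \<Rightarrow> nat \<Rightarrow> nat \<times> (nat \<Rightarrow> nat) \<times> nat" where
  "edge i j n = (2, restrict (\<lambda>k. if k = 0 then i else j) {..<2}, n)"

lemma point_Hom: "i < n \<Longrightarrow> point i n \<in> Hom cat_L 1 n"
  unfolding point_def by (rule L_HomI) auto

lemma edge_Hom: "i < j \<Longrightarrow> j < n \<Longrightarrow> edge i j n \<in> Hom cat_L 2 n"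
  unfolding edge_def by (rule L_HomI) auto

lemma act_point [simp]: "act (point i n) 0 = i"
  by (simp add: point_def)

lemma act_edge [simp]: "act (edge i j n) 0 = i" "act (edge i j n) (Suc 0) = j"
  by (simp_all add: edge_def)

lemma Comp_point:
  assumes h: "h \<in> Hom cat_L m n" and i: "i < m"
  shows "Comp cat_L h (point i m) = point (act h i) n"
proof (rule L_ext)
  show "Comp cat_L h (point i m) \<in> Hom cat_L 1 n"
    using Comp_Hom[OF is_category_L h point_Hom[OF i]] .
  show "point (act h i) n \<in> Hom cat_L 1 n"
    using point_Hom L_HomD(1)[OF h i] .
  show "act (Comp cat_L h (point i m)) k = act (point (act h i) n) k" if "k < 1" for k
    using act_L_Comp[OF h point_Hom[OF i]] that by simp
qed

definition graph_index_homs :: "('e \<Rightarrow> 'v) \<Rightarrow> ('e \<Rightarrow> 'v) \<Rightarrow> 'v + 'e \<Rightarrow> 'v + 'e \<Rightarrow> nat set" where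
  "graph_index_homs s t x y =
     {k. x = y \<and> k = 0 \<or> (\<exists>e. y = Inr e \<and> (x = Inl (s e) \<and> k = 0 \<or> x = Inl (t e) \<and> k = 1))}"

text \<open>The category of elements of a graph with source \<open>s\<close> and target \<open>t\<close>: besides the identities
  there are, for each edge \<open>e\<close>, an arrow \<open>0\<close> from \<open>s e\<close> to \<open>e\<close> and an arrow \<open>1\<close> from \<open>t e\<close> to \<open>e\<close>.
  Composition may be taken to be addition, as one of two composable arrows is an identity.\<close>

definition graph_index ::
  "'v set \<Rightarrow> 'e set \<Rightarrow> ('e \<Rightarrow> 'v) \<Rightarrow> ('e \<Rightarrow> 'v) \<Rightarrow> ('v + 'e, ('v + 'e) \<times> nat \<times> ('v + 'e)) category" where
  "graph_index V E s t = category_of_homs (V <+> E) (graph_index_homs s t) (\<lambda>_. 0) (\<lambda>_ g f. g + f)"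

lemma Ob_graph_index [simp]: "Ob (graph_index V E s t) = V <+> E"
  by (simp add: graph_index_def)

lemma is_category_graph_index: "is_category (graph_index V E s t)"
  unfolding graph_index_def
  by (rule is_category_of_homs) (auto simp: graph_index_homs_def)

lemma Hom_graph_index: "a \<in> Hom (graph_index V E s t) x y \<longleftrightarrow> x \<in> V <+> E \<and> y \<in> V <+> E \<and>
  (a = (x, 0, y) \<and> x = y \<or>
   (\<exists>e. y = Inr e \<and> (x = Inl (s e) \<and> a = (x, 0, y) \<or> x = Inl (t e) \<and> a = (x, 1, y))))"
  unfolding graph_index_def Hom_category_of_homs graph_index_homs_def by auto

lemma finite_graph_index:
  assumes "finite V" "finite E"
  shows "finite (Ob (graph_index V E s t))" "finite (Ar (graph_index V E s t))"
proof -
  show "finite (Ob (graph_index V E s t))" using assms by simp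
  have "Ar (graph_index V E s t) \<subseteq> (V <+> E) \<times> {0, 1} \<times> (V <+> E)"
    by (auto simp: graph_index_def category_of_homs_def graph_index_homs_def)
  then show "finite (Ar (graph_index V E s t))"
    using assms by (meson finite.emptyI finite.insertI finite_Plus finite_SigmaI finite_subset)
qed

text \<open>The arrow numbered \<open>k\<close> becomes the inclusion of the \<open>k\<close>-th end
  into [2]. Arrows of the index category between two vertices or between two edges are identities,
  which justifies the first branch. The colimit glues copies of [2] along their ends as the graph
  prescribes.\<close>

definition graph_diagram ::
  "('v + 'e, ('v + 'e) \<times> nat \<times> ('v + 'e), nat, nat \<times> (nat \<Rightarrow> nat) \<times> nat) functor_data" where
  "graph_diagram = \<lparr>obj_map = (\<lambda>x. if isl x then 1 else 2),
     arr_map = (\<lambda>(x, k, y). if isl x = isl y then Id cat_L (if isl x then 1 else 2) else point k 2)\<rparr>"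

lemma graph_diagram_simps [simp]:
  "obj_map graph_diagram (Inl v) = 1" "obj_map graph_diagram (Inr e) = 2"
  "arr_map graph_diagram (Inl v, k, Inr e) = point k 2"
  "arr_map graph_diagram (Inl v, k, Inl v') = Id cat_L 1"
  "arr_map graph_diagram (Inr e, k, Inr e') = Id cat_L 2"
  by (simp_all add: graph_diagram_def)

lemma is_functor_graph_diagram: "is_functor (graph_index V E s t) cat_L graph_diagram"
  unfolding is_functor_def
proof (intro conjI ballI allI)
  have Id: "Id cat_L n \<in> Hom cat_L n n" for n
    using Id_Hom[OF is_category_L] by simp
  fix x y a assume "a \<in> Hom (graph_index V E s t) x y"
  then show "arr_map graph_diagram a \<in> Hom cat_L (obj_map graph_diagram x) (obj_map graph_diagram y)"
    unfolding Hom_graph_index using Id point_Hom by (auto simp del: One_nat_def)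
next
  fix x assume "x \<in> Ob (graph_index V E s t)"
  then show "arr_map graph_diagram (Id (graph_index V E s t) x) = Id cat_L (obj_map graph_diagram x)"
    by (auto simp: graph_index_def)
next
  fix x y z a b
  assume a: "a \<in> Hom (graph_index V E s t) x y" and b: "b \<in> Hom (graph_index V E s t) y z"
  have Id: "Id cat_L n \<in> Hom cat_L n n" for n
    using Id_Hom[OF is_category_L] by simp
  note simps = Comp_Id_left[OF is_category_L Id] Comp_Id_right[OF is_category_L point_Hom]
    Comp_Id_left[OF is_category_L point_Hom]
  show "arr_map graph_diagram (Comp (graph_index V E s t) b a) =
      Comp cat_L (arr_map graph_diagram b) (arr_map graph_diagram a)"
    using a b unfolding Hom_graph_index
    by (auto simp: graph_index_def simps simp del: One_nat_def)
qed simp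

text \<open>Only the two arrows into each edge impose conditions, those at identities being trivial.
  The functor \<open>H\<close> is left general so that the same description serves in
  \<open>cat_L\<close>, among relations and in any target category.\<close>

lemma graph_cocone_iff:
  assumes C: "is_category C" and H: "is_functor cat_L C H"
    and st: "\<And>e. e \<in> E \<Longrightarrow> s e \<in> V \<and> t e \<in> V"
  shows "is_cocone (graph_index V E s t) C (H \<circ>\<^sub>F graph_diagram) c \<kappa> \<longleftrightarrow> c \<in> Ob C \<and>
    (\<forall>v \<in> V. \<kappa> (Inl v) \<in> Hom C (obj_map H 1) c) \<and>
    (\<forall>e \<in> E. \<kappa> (Inr e) \<in> Hom C (obj_map H 2) c \<and>
       Comp C (\<kappa> (Inr e)) (arr_map H (point 0 2)) = \<kappa> (Inl (s e)) \<and>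
       Comp C (\<kappa> (Inr e)) (arr_map H (point 1 2)) = \<kappa> (Inl (t e)))"
    (is "?L \<longleftrightarrow> ?R")
proof
  assume L: ?L
  have "Comp C (\<kappa> (Inr e)) (arr_map H (point 0 2)) = \<kappa> (Inl (s e))"
    "Comp C (\<kappa> (Inr e)) (arr_map H (point 1 2)) = \<kappa> (Inl (t e))" if e: "e \<in> E" for e
    using is_cocone_Comp[OF L, of "(Inl (s e), 0, Inr e)" "Inl (s e)" "Inr e"]
      is_cocone_Comp[OF L, of "(Inl (t e), 1, Inr e)" "Inl (t e)" "Inr e"] e st[OF e]
    by (auto simp: Hom_graph_index)
  then show ?R
    using is_cocone_Ob[OF L] is_cocone_Hom[OF L, of "Inl _"] is_cocone_Hom[OF L, of "Inr _"]
    by (simp add: InlI InrI)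
next
  assume R: ?R
  have HId: "arr_map H (Id cat_L n) = Id C (obj_map H n)" for n
    using is_functor_Id[OF H] by simp
  have "Comp C (\<kappa> y) (arr_map H (arr_map graph_diagram a)) = \<kappa> x"
    if a: "a \<in> Hom (graph_index V E s t) x y" for x y a
  proof -
    have *: "x \<in> V <+> E" "y \<in> V <+> E" using a by (auto simp: Hom_graph_index)
    consider (id) "a = (x, 0, y)" "x = y"
      | (src) e where "y = Inr e" "x = Inl (s e)" "a = (x, 0, y)"
      | (tgt) e where "y = Inr e" "x = Inl (t e)" "a = (x, 1, y)"
      using a unfolding Hom_graph_index by blast
    then show ?thesis
    proof cases
      case id
      then show ?thesis
        using *(1) R by (cases x) (auto simp: HId Comp_Id_right[OF C] simp del: One_nat_def)
    next
      case src
      then show ?thesis using *(2) R by auto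
    next
      case tgt
      then show ?thesis using *(2) R by auto
    qed
  qed
  then show ?L
    using R unfolding is_cocone_def by (auto simp del: One_nat_def)
qed

lemma increasing_of_Suc:
  assumes "\<And>i. Suc i < n \<Longrightarrow> f i < (f (Suc i) :: nat)" and "i < j" "j < n"
  shows "f i < f j"
  using assms(2,3)
proof (induction j)
  case (Suc j)
  then show ?case using assms(1)[of j] by (cases "i = j") auto
qed simp

text \<open>A map increasing at each successor step is increasing, and an arrow out of [2] is
  determined by its ends. So once all successor steps are edges, further or parallel ascending edges
  add no constraint. This yields [2] from two parallel edges, [3] from a path of two edges, and [n]
  from all its ordered pairs.\<close>

lemma graph_colimit_L:
  assumes p: "bij_betw p V {..<n}" and st: "\<And>e. e \<in> E \<Longrightarrow> s e \<in> V \<and> t e \<in> V \<and> p (s e) < p (t e)"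
    and Suc: "\<And>v w. v \<in> V \<Longrightarrow> w \<in> V \<Longrightarrow> p w = Suc (p v) \<Longrightarrow> \<exists>e \<in> E. s e = v \<and> t e = w"
  shows "is_colimit (graph_index V E s t) cat_L graph_diagram n
    (case_sum (\<lambda>v. point (p v) n) (\<lambda>e. edge (p (s e)) (p (t e)) n))"
    (is "is_colimit ?J _ _ _ ?\<kappa>")
proof -
  have pV: "p v < n" if "v \<in> V" for v
    using bij_betwE[OF p] that by auto
  note iff = graph_cocone_iff[OF is_category_L is_functor_id[of cat_L], of E s V t, simplified]
  have cocone_iff: "is_cocone ?J cat_L graph_diagram m \<mu> \<longleftrightarrow>
      (\<forall>v \<in> V. \<mu> (Inl v) \<in> Hom cat_L 1 m) \<and>
      (\<forall>e \<in> E. \<mu> (Inr e) \<in> Hom cat_L 2 m \<and>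
         Comp cat_L (\<mu> (Inr e)) (point 0 2) = \<mu> (Inl (s e)) \<and>
         Comp cat_L (\<mu> (Inr e)) (point 1 2) = \<mu> (Inl (t e)))" for m \<mu>
    using iff[of m \<mu>] st by simp
  have edge: "edge (p (s e)) (p (t e)) n \<in> Hom cat_L 2 n" if "e \<in> E" for e
    using edge_Hom pV st[OF that] by blast
  have k: "is_cocone ?J cat_L graph_diagram n ?\<kappa>"
    unfolding cocone_iff using point_Hom pV edge Comp_point[OF edge] by simp
  have "\<exists>!u. u \<in> Hom cat_L n m \<and> (\<forall>j \<in> Ob ?J. Comp cat_L u (?\<kappa> j) = \<mu> j)"
    if "is_cocone ?J cat_L graph_diagram m \<mu>" for m \<mu>
  proof -
    from that[unfolded cocone_iff] have mv: "\<And>v. v \<in> V \<Longrightarrow> \<mu> (Inl v) \<in> Hom cat_L 1 m"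
      and me: "\<And>e. e \<in> E \<Longrightarrow> \<mu> (Inr e) \<in> Hom cat_L 2 m"
      "\<And>e. e \<in> E \<Longrightarrow> Comp cat_L (\<mu> (Inr e)) (point 0 2) = \<mu> (Inl (s e))"
      "\<And>e. e \<in> E \<Longrightarrow> Comp cat_L (\<mu> (Inr e)) (point 1 2) = \<mu> (Inl (t e))"
      by auto
    define q where "q = inv_into V p"
    have q: "q i \<in> V" "p (q i) = i" if "i < n" for i
      using p that by (auto simp: q_def bij_betw_def inv_into_into f_inv_into_f)
    have qp: "q (p v) = v" if "v \<in> V" for v
      using p that by (auto simp: q_def bij_betw_def)
    define f where "f i = act (\<mu> (Inl (q i))) 0" for i
    \<comment> \<open>An arrow out of [1] is the point that it picks, so the vertex legs of the
      cocone amount to a sequence of numbers \<open>f\<close>.\<close>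
    have mu_point: "\<mu> (Inl v) = point (f (p v)) m" if "v \<in> V" for v
    proof (rule L_ext[OF mv[OF that] point_Hom])
      show "f (p v) < m" using L_HomD(1)[OF mv[OF that]] qp[OF that] by (simp add: f_def)
    qed (use qp[OF that] in \<open>simp add: f_def\<close>)
    have act_edge: "act (\<mu> (Inr e)) 0 = f (p (s e))" "act (\<mu> (Inr e)) 1 = f (p (t e))" if e: "e \<in> E" for e
    proof -
      have "point (act (\<mu> (Inr e)) 0) m = point (f (p (s e))) m"
        "point (act (\<mu> (Inr e)) 1) m = point (f (p (t e))) m"
        using Comp_point[OF me(1)[OF e], of 0] Comp_point[OF me(1)[OF e], of 1]
          me(2)[OF e] me(3)[OF e] mu_point st[OF e] by auto
      then show "act (\<mu> (Inr e)) 0 = f (p (s e))" "act (\<mu> (Inr e)) 1 = f (p (t e))"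
        by (metis act_point)+
    qed
    have "f i < f (Suc i)" if n: "Suc i < n" for i
    proof -
      obtain e where e: "e \<in> E" "s e = q i" "t e = q (Suc i)"
        using Suc[of "q i" "q (Suc i)"] q[of i] q[of "Suc i"] n by auto
      then show ?thesis
        using act_edge[OF e(1)] L_HomD(2)[OF me(1)[OF e(1)], of 0 1] q[of i] q[of "Suc i"] n by simp
    qed
    note mono = increasing_of_Suc[of n f, OF this]
    define u where "u = (n, restrict f {..<n}, m)"
    have u: "u \<in> Hom cat_L n m"
      unfolding u_def
    proof (rule L_HomI)
      fix i assume "i < n"
      then show "f i < m" using L_HomD(1)[OF mv[OF q(1)]] by (simp add: f_def)
    qed (use mono in auto)
    show ?thesis
    proof (intro ex1I[of _ u] conjI ballI u)
      fix j assume "j \<in> Ob ?J"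
      then consider v where "j = Inl v" "v \<in> V" | e where "j = Inr e" "e \<in> E" by auto
      then show "Comp cat_L u (?\<kappa> j) = \<mu> j"
      proof cases
        case 1
        then show ?thesis
          using Comp_point[OF u pV] mu_point pV by (simp add: u_def)
      next
        case 2
        have "Comp cat_L u (edge (p (s e)) (p (t e)) n) = \<mu> (Inr e)"
        proof (rule L_ext[OF Comp_Hom[OF is_category_L u edge[OF 2(2)]] me(1)[OF 2(2)]])
          fix k :: nat assume k: "k < 2"
          then have "k = 0 \<or> k = 1" by auto
          then show "act (Comp cat_L u (edge (p (s e)) (p (t e)) n)) k = act (\<mu> (Inr e)) k"
            using act_L_Comp[OF u edge[OF 2(2)] k] act_edge[OF 2(2)] pV st[OF 2(2)]
            by (auto simp: u_def)
        qed
        then show ?thesis using 2 by simp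
      qed
    next
      fix w assume w: "w \<in> Hom cat_L n m \<and> (\<forall>j \<in> Ob ?J. Comp cat_L w (?\<kappa> j) = \<mu> j)"
      then have wH: "w \<in> Hom cat_L n m" by simp
      show "w = u"
      proof (rule L_ext[OF wH u])
        fix i assume i: "i < n"
        have "Comp cat_L w (?\<kappa> (Inl (q i))) = \<mu> (Inl (q i))"
          using bspec[OF conjunct2[OF w], of "Inl (q i)"] q(1)[OF i] by (simp add: InlI)
        then have "point (act w i) m = point (f i) m"
          using Comp_point[OF wH i] mu_point[OF q(1)[OF i]] q(2)[OF i] by simp
        then have "act w i = f i" by (metis act_point)
        then show "act w i = act u i" using i by (simp add: u_def)
      qed
    qed
  qed
  then show ?thesis using k unfolding is_colimit_def by blast
qed

section \<open>Transitive relations as colimits of their points and edges\<close>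

definition rel_point :: "'a::infinite set \<times> 'a rel \<Rightarrow> 'a \<Rightarrow> 'a rel_arrow" where
  "rel_point X a = (chain 1, restrict (\<lambda>_. a) (fst (chain 1)), X)"

definition rel_edge :: "'a::infinite set \<times> 'a rel \<Rightarrow> 'a \<times> 'a \<Rightarrow> 'a rel_arrow" where
  "rel_edge X e =
     (chain 2, restrict (\<lambda>x. if x = nat_emb 0 then fst e else snd e) (fst (chain 2)), X)"

lemma fst_chain_1: "x \<in> fst (chain 1) \<longleftrightarrow> x = nat_emb 0"
  and fst_chain_2: "x \<in> fst (chain 2) \<longleftrightarrow> x = nat_emb 0 \<or> x = nat_emb 1"
  and snd_chain_1: "(x, y) \<notin> snd (chain 1)"
  and snd_chain_2: "(x, y) \<in> snd (chain 2) \<longleftrightarrow> x = nat_emb 0 \<and> y = nat_emb 1"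
  by (auto simp: in_fst_chain in_snd_chain less_2_cases_iff)

lemma rel_point_Hom: "X \<in> Ob cat_TransRel \<Longrightarrow> a \<in> fst X \<Longrightarrow> rel_point X a \<in> Hom cat_TransRel (chain 1) X"
  unfolding rel_point_def by (rule TransRel_HomI[OF chain_Ob]) (auto simp: snd_chain_1 simp del: One_nat_def)

lemma act_rel_point [simp]: "act (rel_point X a) (nat_emb 0) = a"
  by (simp add: rel_point_def)

lemma Comp_rel_point:
  assumes h: "h \<in> Hom cat_TransRel X Y" and a: "a \<in> fst X"
  shows "Comp cat_TransRel h (rel_point X a) = rel_point Y (act h a)"
proof -
  note XY = TransRel_HomD(3,4)[OF h] and ha = TransRel_HomD(1)[OF h a]
  note pX = rel_point_Hom[OF XY(1) a]
  show ?thesis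
  proof (rule TransRel_ext[OF Comp_Hom[OF is_category_TransRel h pX] rel_point_Hom[OF XY(2) ha]])
    fix x :: 'a assume x: "x \<in> fst (chain 1)"
    show "act (Comp cat_TransRel h (rel_point X a)) x = act (rel_point Y (act h a)) x"
      unfolding act_TransRel_Comp[OF h pX x] using x unfolding fst_chain_1 by simp
  qed
qed

lemma chain_functor_point:
  assumes i: "i < n"
  shows "arr_map chain_functor (point i n) = rel_point (chain n) (nat_emb i :: 'a::infinite)"
proof (rule TransRel_ext[OF chain_functor_Hom[OF point_Hom[OF i]] rel_point_Hom[OF chain_Ob]])
  show "(nat_emb i :: 'a) \<in> fst (chain n)" using i by simp
  fix x :: 'a assume "x \<in> fst (chain 1)"
  then have "x = nat_emb 0" unfolding fst_chain_1 .
  then show "act (arr_map chain_functor (point i n)) x = act (rel_point (chain n) (nat_emb i)) x"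
    using act_chain_functor[OF point_Hom[OF i], of 0] by simp
qed

text \<open>A homomorphism is a choice of a point for each element such that each related pair
  becomes an edge, which is exactly a cocone over this diagram. The chains [1] and [2] are thus
  dense, and a functor preserving finite colimits is determined by its behaviour on them.\<close>

lemma graph_colimit_TransRel:
  fixes X :: "'a::infinite set \<times> 'a rel"
  assumes X: "X \<in> Ob cat_TransRel"
  shows "is_colimit (graph_index (fst X) (snd X) fst snd) cat_TransRel (chain_functor \<circ>\<^sub>F graph_diagram) X
    (case_sum (rel_point X) (rel_edge X))" (is "is_colimit ?J ?Q ?D _ ?\<kappa>")
proof -
  have sub: "e \<in> snd X \<Longrightarrow> fst e \<in> fst X \<and> snd e \<in> fst X" for e
    using TransRel_Ob_subset[OF X] by (cases e) auto
  have iff: "is_cocone ?J ?Q ?D Y \<mu> \<longleftrightarrow> Y \<in> Ob ?Q \<and>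
      (\<forall>a \<in> fst X. \<mu> (Inl a) \<in> Hom ?Q (chain 1) Y) \<and>
      (\<forall>e \<in> snd X. \<mu> (Inr e) \<in> Hom ?Q (chain 2) Y \<and>
         Comp ?Q (\<mu> (Inr e)) (arr_map chain_functor (point 0 2)) = \<mu> (Inl (fst e)) \<and>
         Comp ?Q (\<mu> (Inr e)) (arr_map chain_functor (point 1 2)) = \<mu> (Inl (snd e)))" for Y \<mu>
    unfolding obj_chain_functor[symmetric]
    by (rule graph_cocone_iff[OF is_category_TransRel is_functor_chain sub])
  have edge: "rel_edge X e \<in> Hom ?Q (chain 2) X" if "e \<in> snd X" for e
    unfolding rel_edge_def using sub[OF that] that
    by (intro TransRel_HomI[OF chain_Ob X]) (auto simp: fst_chain_2 snd_chain_2)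
  have cp: "Comp ?Q h (arr_map chain_functor (point 0 2)) = rel_point Y (act h (nat_emb 0))"
    "Comp ?Q h (arr_map chain_functor (point 1 2)) = rel_point Y (act h (nat_emb 1))"
    if h: "h \<in> Hom ?Q (chain 2) Y" for h Y
    using Comp_rel_point[OF h] by (simp_all add: chain_functor_point)
  have k: "is_cocone ?J ?Q ?D X ?\<kappa>"
    unfolding iff using X rel_point_Hom[OF X] edge cp[OF edge]
    by (simp add: rel_edge_def)
  have "\<exists>!u. u \<in> Hom ?Q X Y \<and> (\<forall>j \<in> Ob ?J. Comp ?Q u (?\<kappa> j) = \<mu> j)"
    if "is_cocone ?J ?Q ?D Y \<mu>" for Y \<mu>
  proof -
    from that[unfolded iff] have Y: "Y \<in> Ob ?Q"
      and mv: "\<And>a. a \<in> fst X \<Longrightarrow> \<mu> (Inl a) \<in> Hom ?Q (chain 1) Y"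
      and me: "\<And>e. e \<in> snd X \<Longrightarrow> \<mu> (Inr e) \<in> Hom ?Q (chain 2) Y"
      "\<And>e. e \<in> snd X \<Longrightarrow> Comp ?Q (\<mu> (Inr e)) (arr_map chain_functor (point 0 2)) = \<mu> (Inl (fst e))"
      "\<And>e. e \<in> snd X \<Longrightarrow> Comp ?Q (\<mu> (Inr e)) (arr_map chain_functor (point 1 2)) = \<mu> (Inl (snd e))"
      by auto
    define f where "f a = act (\<mu> (Inl a)) (nat_emb 0)" for a
    have fY: "f a \<in> fst Y" if "a \<in> fst X" for a
      unfolding f_def by (rule TransRel_HomD(1)[OF mv[OF that]]) simp
    have mu_point: "\<mu> (Inl a) = rel_point Y (f a)" if "a \<in> fst X" for a
    proof (rule TransRel_ext[OF mv[OF that] rel_point_Hom[OF Y fY[OF that]]])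
      fix x :: 'a assume "x \<in> fst (chain 1)"
      then show "act (\<mu> (Inl a)) x = act (rel_point Y (f a)) x"
        unfolding fst_chain_1 by (simp add: f_def)
    qed
    have act_edge: "act (\<mu> (Inr e)) (nat_emb 0) = f (fst e)" "act (\<mu> (Inr e)) (nat_emb 1) = f (snd e)"
      if e: "e \<in> snd X" for e
    proof -
      have "rel_point Y (act (\<mu> (Inr e)) (nat_emb 0)) = rel_point Y (f (fst e))"
        "rel_point Y (act (\<mu> (Inr e)) (nat_emb 1)) = rel_point Y (f (snd e))"
        using cp[OF me(1)[OF e]] me(2)[OF e] me(3)[OF e] mu_point sub[OF e] by auto
      then show "act (\<mu> (Inr e)) (nat_emb 0) = f (fst e)" "act (\<mu> (Inr e)) (nat_emb 1) = f (snd e)"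
        by (metis act_rel_point)+
    qed
    define u where "u = (X, restrict f (fst X), Y)"
    have u: "u \<in> Hom ?Q X Y"
      unfolding u_def
    proof (rule TransRel_HomI[OF X Y fY])
      fix a b assume ab: "(a, b) \<in> snd X"
      have "(act (\<mu> (Inr (a, b))) (nat_emb 0), act (\<mu> (Inr (a, b))) (nat_emb 1)) \<in> snd Y"
        by (rule TransRel_HomD(2)[OF me(1)[OF ab]]) simp
      then show "(f a, f b) \<in> snd Y" using act_edge[OF ab] by simp
    qed
    show ?thesis
    proof (intro ex1I[of _ u] conjI ballI u)
      fix j assume "j \<in> Ob ?J"
      then consider a where "j = Inl a" "a \<in> fst X" | e where "j = Inr e" "e \<in> snd X" by auto
      then show "Comp ?Q u (?\<kappa> j) = \<mu> j"
      proof cases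
        case 1
        then show ?thesis using Comp_rel_point[OF u 1(2)] mu_point by (simp add: u_def)
      next
        case 2
        have "Comp ?Q u (rel_edge X e) = \<mu> (Inr e)"
        proof (rule TransRel_ext[OF Comp_Hom[OF is_category_TransRel u edge[OF 2(2)]] me(1)[OF 2(2)]])
          fix x :: 'a assume x: "x \<in> fst (chain 2)"
          show "act (Comp ?Q u (rel_edge X e)) x = act (\<mu> (Inr e)) x"
            unfolding act_TransRel_Comp[OF u edge[OF 2(2)] x]
            using x act_edge[OF 2(2)] sub[OF 2(2)] unfolding fst_chain_2
            by (auto simp: u_def rel_edge_def)
        qed
        then show ?thesis using 2 by simp
      qed
    next
      fix w assume w: "w \<in> Hom ?Q X Y \<and> (\<forall>j \<in> Ob ?J. Comp ?Q w (?\<kappa> j) = \<mu> j)"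
      then have wH: "w \<in> Hom ?Q X Y" by simp
      show "w = u"
      proof (rule TransRel_ext[OF wH u])
        fix a assume a: "a \<in> fst X"
        have "Comp ?Q w (?\<kappa> (Inl a)) = \<mu> (Inl a)"
          using bspec[OF conjunct2[OF w], of "Inl a"] a by (simp add: InlI)
        then have "rel_point Y (act w a) = rel_point Y (f a)"
          using Comp_rel_point[OF wH a] mu_point[OF a] by simp
        then have "act w a = f a" by (metis act_rel_point)
        then show "act w a = act u a" using a by (simp add: u_def)
      qed
    qed
  qed
  then show ?thesis using k unfolding is_colimit_def by blast
qed

section \<open>The universal property\<close>

lemma TransRel_Ob_finite: "X \<in> Ob cat_TransRel \<Longrightarrow> finite (fst X) \<and> finite (snd X)"
  unfolding Ob_TransRel by (meson finite_SigmaI finite_subset)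

locale conservative_functor =
  fixes C :: "('c, 'd) category" and F :: "(nat, nat \<times> (nat \<Rightarrow> nat) \<times> nat, 'c, 'd) functor_data"
  assumes finitely_cocomplete: "finitely_cocomplete C"
    and F: "is_functor cat_L C F"
    and F_colimits: "preserves_finite_colimits cat_L C F"
begin

lemma C: "is_category C"
  using finitely_cocomplete by (simp add: finitely_cocomplete_def)

definition "src = arr_map F (point 0 2)"
definition "tgt = arr_map F (point 1 2)"

lemma src_Hom: "src \<in> Hom C (obj_map F 1) (obj_map F 2)"
  and tgt_Hom: "tgt \<in> Hom C (obj_map F 1) (obj_map F 2)"
  unfolding src_def tgt_def by (auto intro!: is_functor_Hom[OF F] point_Hom simp del: One_nat_def)

definition Rel :: "'c \<Rightarrow> 'd rel" where
  "Rel c = {(Comp C w src, Comp C w tgt) |w. w \<in> Hom C (obj_map F 2) c}"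

lemma in_Rel_iff:
  "(a, b) \<in> Rel c \<longleftrightarrow> (\<exists>w \<in> Hom C (obj_map F 2) c. Comp C w src = a \<and> Comp C w tgt = b)"
  unfolding Rel_def by blast

lemma Rel_Hom:
  "(a, b) \<in> Rel c \<Longrightarrow> a \<in> Hom C (obj_map F 1) c \<and> b \<in> Hom C (obj_map F 1) c"
  using Comp_Hom[OF C _ src_Hom] Comp_Hom[OF C _ tgt_Hom] by (auto simp: Rel_def)

lemma Rel_Comp:
  assumes "(a, b) \<in> Rel c" and u: "u \<in> Hom C c d"
  shows "(Comp C u a, Comp C u b) \<in> Rel d"
proof -
  obtain w where w: "w \<in> Hom C (obj_map F 2) c" "a = Comp C w src" "b = Comp C w tgt"
    using assms(1) by (auto simp: Rel_def)
  then show ?thesis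
    using Comp_assoc[OF C u w(1) src_Hom] Comp_assoc[OF C u w(1) tgt_Hom] Comp_Hom[OF C u w(1)]
    by (auto simp: Rel_def)
qed

lemma cocone_iff:
  assumes H: "is_functor cat_L C H" "obj_map H 1 = obj_map F 1" "obj_map H 2 = obj_map F 2"
      "arr_map H (point 0 2) = src" "arr_map H (point 1 2) = tgt"
    and st: "\<And>e. e \<in> E \<Longrightarrow> s e \<in> V \<and> t e \<in> V"
  shows "is_cocone (graph_index V E s t) C (H \<circ>\<^sub>F graph_diagram) c \<kappa> \<longleftrightarrow> c \<in> Ob C \<and>
    (\<forall>v \<in> V. \<kappa> (Inl v) \<in> Hom C (obj_map F 1) c) \<and>
    (\<forall>e \<in> E. \<kappa> (Inr e) \<in> Hom C (obj_map F 2) c \<and>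
       Comp C (\<kappa> (Inr e)) src = \<kappa> (Inl (s e)) \<and> Comp C (\<kappa> (Inr e)) tgt = \<kappa> (Inl (t e)))"
  unfolding H(2-5)[symmetric] by (rule graph_cocone_iff[OF C H(1) st])

lemmas cocone_F_iff = cocone_iff[OF F refl refl src_def[symmetric] tgt_def[symmetric]]

lemma F_graph_colimit:
  assumes "finite V" "finite E"
    and "bij_betw p V {..<n}" "\<And>e. e \<in> E \<Longrightarrow> s e \<in> V \<and> t e \<in> V \<and> p (s e) < p (t e)"
    and "\<And>v w. v \<in> V \<Longrightarrow> w \<in> V \<Longrightarrow> p w = Suc (p v) \<Longrightarrow> \<exists>e \<in> E. s e = v \<and> t e = w"
  shows "is_colimit (graph_index V E s t) C (F \<circ>\<^sub>F graph_diagram) (obj_map F n)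
    (\<lambda>j. arr_map F (case_sum (\<lambda>v. point (p v) n) (\<lambda>e. edge (p (s e)) (p (t e)) n) j))"
  by (rule preserves_finite_colimits_colimit[OF F_colimits is_category_graph_index
        finite_graph_index[OF assms(1,2)] is_functor_graph_diagram graph_colimit_L[OF assms(3-5)]])

text \<open>In the colimit [2] of two parallel edges both edges have the same leg; hence the two
  edge components of any cocone agree.\<close>

lemma edge_unique:
  assumes w: "w \<in> Hom C (obj_map F 2) c" "w' \<in> Hom C (obj_map F 2) c"
    and eq: "Comp C w src = Comp C w' src" "Comp C w tgt = Comp C w' tgt"
  shows "w = w'"
proof -
  let ?J = "graph_index {..<2} {..<2} (\<lambda>_. 0) (\<lambda>_. 1) :: (nat + nat, _) category"
  have col: "is_colimit ?J C (F \<circ>\<^sub>F graph_diagram) (obj_map F 2)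
    (\<lambda>j. arr_map F (case_sum (\<lambda>v. point (id v) 2) (\<lambda>e. edge (id 0) (id 1) 2) j))"
    by (rule F_graph_colimit) (auto simp: bij_betw_def intro: exI[of _ "0 :: nat"])
  have "is_cocone ?J C (F \<circ>\<^sub>F graph_diagram) c
      (case_sum (\<lambda>v. Comp C w (if v = 0 then src else tgt)) (\<lambda>e. if e = 0 then w else w'))"
    using Hom_Ob[OF C w(1)] w eq Comp_Hom[OF C w(1) src_Hom] Comp_Hom[OF C w(1) tgt_Hom]
    by (subst cocone_F_iff) auto
  from is_colimit_ex1[OF col this] obtain u where u: "\<And>j. j \<in> Ob ?J \<Longrightarrow> Comp C u (arr_map F (case_sum (\<lambda>v. point (id v) 2)
      (\<lambda>e. edge (id 0) (id 1) 2) j)) =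
      case_sum (\<lambda>v. Comp C w (if v = 0 then src else tgt)) (\<lambda>e. if e = 0 then w else w') j"
    by blast
  show "w = w'"
    using u[of "Inr 0"] u[of "Inr 1"] by (simp add: InrI)
qed

lemma trans_Rel: "trans (Rel c)"
proof (rule transI)
  fix a b b' assume ab: "(a, b) \<in> Rel c" and bb: "(b, b') \<in> Rel c"
  obtain w where w: "w \<in> Hom C (obj_map F 2) c" "a = Comp C w src" "b = Comp C w tgt"
    using ab by (auto simp: Rel_def)
  obtain w' where w': "w' \<in> Hom C (obj_map F 2) c" "b = Comp C w' src" "b' = Comp C w' tgt"
    using bb by (auto simp: Rel_def)
  let ?J = "graph_index {..<3} {..<2} (\<lambda>e. e) Suc :: (nat + nat, _) category"
  let ?\<mu> = "case_sum (\<lambda>v. if v = 0 then a else if v = 1 then b else b') (\<lambda>e. if e = 0 then w else w')"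
  have col: "is_colimit ?J C (F \<circ>\<^sub>F graph_diagram) (obj_map F 3)
    (\<lambda>j. arr_map F (case_sum (\<lambda>v. point (id v) 3) (\<lambda>e. edge (id e) (id (Suc e)) 3) j))"
    by (rule F_graph_colimit) (auto simp: bij_betw_def)
  have "is_cocone ?J C (F \<circ>\<^sub>F graph_diagram) c ?\<mu>"
    using Hom_Ob[OF C w(1)] w w' Rel_Hom[OF ab] Rel_Hom[OF bb]
    by (subst cocone_F_iff) auto
  from is_colimit_ex1[OF col this] obtain u where uH: "u \<in> Hom C (obj_map F 3) c"
    and u: "\<And>j. j \<in> Ob ?J \<Longrightarrow>
      Comp C u (arr_map F (case_sum (\<lambda>v. point (id v) 3) (\<lambda>e. edge (id e) (id (Suc e)) 3) j)) = ?\<mu> j"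
    by blast
  \<comment> \<open>The arrow from [2] to [3] that skips the middle point. Followed by the mediating
    arrow \<open>u\<close>, it witnesses the pair \<open>(a, b')\<close>.\<close>
  have e: "edge 0 2 3 \<in> Hom cat_L 2 3" by (rule edge_Hom) auto
  note Fe = is_functor_Hom[OF F e]
  have "Comp C (arr_map F (edge 0 2 3)) src = arr_map F (point 0 3)"
    "Comp C (arr_map F (edge 0 2 3)) tgt = arr_map F (point 2 3)"
    unfolding src_def tgt_def
    using is_functor_Comp[OF F e point_Hom, of 0] is_functor_Comp[OF F e point_Hom, of 1]
      Comp_point[OF e, of 0] Comp_point[OF e, of 1] by simp_all
  then have "Comp C (Comp C u (arr_map F (edge 0 2 3))) src = a"
    "Comp C (Comp C u (arr_map F (edge 0 2 3))) tgt = b'"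
    using Comp_assoc[OF C uH Fe src_Hom] Comp_assoc[OF C uH Fe tgt_Hom] u[of "Inl 0"] u[of "Inl 2"]
    by (simp_all add: InlI)
  then show "(a, b') \<in> Rel c"
    using Comp_Hom[OF C uH Fe] unfolding Rel_def by blast
qed

section \<open>Objects representing homomorphisms into \<open>Rel\<close>\<close>

definition rel_map :: "'a set \<times> 'a rel \<Rightarrow> 'c \<Rightarrow> ('a \<Rightarrow> 'd) \<Rightarrow> bool" where
  "rel_map X c \<phi> \<longleftrightarrow> c \<in> Ob C \<and> (\<forall>a \<in> fst X. \<phi> a \<in> Hom C (obj_map F 1) c) \<and>
     (\<forall>e \<in> snd X. (\<phi> (fst e), \<phi> (snd e)) \<in> Rel c)"

text \<open>\<open>\<phi>\<close> is the universal element of the functor that sends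
  \<open>d\<close> to the homomorphisms from \<open>X\<close> to \<open>Rel d\<close>. Functions
  count only through their values on \<open>fst X\<close>.\<close>

definition represents :: "'a set \<times> 'a rel \<Rightarrow> 'c \<Rightarrow> ('a \<Rightarrow> 'd) \<Rightarrow> bool" where
  "represents X c \<phi> \<longleftrightarrow> rel_map X c \<phi> \<and>
     (\<forall>d \<psi>. rel_map X d \<psi> \<longrightarrow> (\<exists>!u. u \<in> Hom C c d \<and> (\<forall>a \<in> fst X. Comp C u (\<phi> a) = \<psi> a)))"

lemma rel_mapD:
  assumes "rel_map X c \<phi>"
  shows "c \<in> Ob C" "a \<in> fst X \<Longrightarrow> \<phi> a \<in> Hom C (obj_map F 1) c"
    "(a, b) \<in> snd X \<Longrightarrow> (\<phi> a, \<phi> b) \<in> Rel c"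
  using assms by (auto simp: rel_map_def)

lemma rel_map_Comp:
  assumes "rel_map X c \<phi>" and u: "u \<in> Hom C c d"
  shows "rel_map X d (\<lambda>a. Comp C u (\<phi> a))"
  using assms(1) Hom_Ob[OF C u] Rel_Comp[OF _ u] Comp_Hom[OF C u] by (simp add: rel_map_def)

lemma rel_map_act:
  assumes "rel_map Y c \<phi>" and h: "h \<in> Hom cat_TransRel X Y"
  shows "rel_map X c (\<lambda>a. \<phi> (act h a))"
  unfolding rel_map_def
  using rel_mapD[OF assms(1)] TransRel_HomD[OF h] by simp

lemma representsD:
  assumes "represents X c \<phi>"
  shows "rel_map X c \<phi>"
    and "rel_map X d \<psi> \<Longrightarrow> \<exists>!u. u \<in> Hom C c d \<and> (\<forall>a \<in> fst X. Comp C u (\<phi> a) = \<psi> a)"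
  using assms unfolding represents_def by blast+

text \<open>The points \<open>\<phi> a\<close> are jointly epic. This reduces equations between
  arrows out of a representing object to equations at points.\<close>

lemma represents_unique:
  assumes r: "represents X c \<phi>" and u: "u \<in> Hom C c d" "v \<in> Hom C c d"
    and eq: "\<And>a. a \<in> fst X \<Longrightarrow> Comp C u (\<phi> a) = Comp C v (\<phi> a)"
  shows "u = v"
  using representsD(2)[OF r rel_map_Comp[OF representsD(1)[OF r] u(1)]] u eq by metis

lemma represents_iso:
  assumes r: "represents X c \<phi>" "represents X c' \<phi>'"
    and u: "u \<in> Hom C c c'" "\<And>a. a \<in> fst X \<Longrightarrow> Comp C u (\<phi> a) = \<phi>' a"
  shows "is_iso C u"
proof -
  obtain v where v: "v \<in> Hom C c' c" "\<And>a. a \<in> fst X \<Longrightarrow> Comp C v (\<phi>' a) = \<phi> a"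
    using representsD(2)[OF r(2) representsD(1)[OF r(1)]] by blast
  note p = rel_mapD[OF representsD(1)[OF r(1)]] and p' = rel_mapD[OF representsD(1)[OF r(2)]]
  show ?thesis
  proof (rule is_isoI[OF u(1) v(1)])
    show "Comp C v u = Id C c"
      by (rule represents_unique[OF r(1) Comp_Hom[OF C v(1) u(1)] Id_Hom[OF C p(1)]])
        (simp add: Comp_assoc[OF C v(1) u(1) p(2), symmetric] u(2) v(2) Comp_Id_left[OF C p(2)])
    show "Comp C u v = Id C c'"
      by (rule represents_unique[OF r(2) Comp_Hom[OF C u(1) v(1)] Id_Hom[OF C p'(1)]])
        (simp add: Comp_assoc[OF C u(1) v(1) p'(2), symmetric] u(2) v(2) Comp_Id_left[OF C p'(2)])
  qed
qed

text \<open>By \<open>edge_unique\<close> the components at edges are determined by those at points,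
  so cocones over the diagram are homomorphisms into \<open>Rel\<close>. The functor
  \<open>H\<close> need only agree with \<open>F\<close> on points and edges, since an extension
  restricted to the chains equals \<open>F\<close> merely on carriers.\<close>

lemma represents_graph_colimit:
  assumes X: "X \<in> Ob cat_TransRel"
    and H: "is_functor cat_L C H" "obj_map H 1 = obj_map F 1" "obj_map H 2 = obj_map F 2"
      "arr_map H (point 0 2) = src" "arr_map H (point 1 2) = tgt"
    and k: "is_colimit (graph_index (fst X) (snd X) fst snd) C (H \<circ>\<^sub>F graph_diagram) c \<kappa>"
  shows "represents X c (\<lambda>a. \<kappa> (Inl a))"
proof -
  let ?J = "graph_index (fst X) (snd X) fst snd"
  have sub: "e \<in> snd X \<Longrightarrow> fst e \<in> fst X \<and> snd e \<in> fst X" for e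
    using TransRel_Ob_subset[OF X] by (cases e) auto
  have iff: "is_cocone ?J C (H \<circ>\<^sub>F graph_diagram) d \<mu> \<longleftrightarrow> d \<in> Ob C \<and>
      (\<forall>a \<in> fst X. \<mu> (Inl a) \<in> Hom C (obj_map F 1) d) \<and>
      (\<forall>e \<in> snd X. \<mu> (Inr e) \<in> Hom C (obj_map F 2) d \<and>
         Comp C (\<mu> (Inr e)) src = \<mu> (Inl (fst e)) \<and> Comp C (\<mu> (Inr e)) tgt = \<mu> (Inl (snd e)))"
    for d \<mu>
    by (rule cocone_iff[OF H sub])
  have k0: "c \<in> Ob C" "\<And>a. a \<in> fst X \<Longrightarrow> \<kappa> (Inl a) \<in> Hom C (obj_map F 1) c"
    "\<And>e. e \<in> snd X \<Longrightarrow> \<kappa> (Inr e) \<in> Hom C (obj_map F 2) c"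
    "\<And>e. e \<in> snd X \<Longrightarrow> Comp C (\<kappa> (Inr e)) src = \<kappa> (Inl (fst e))"
    "\<And>e. e \<in> snd X \<Longrightarrow> Comp C (\<kappa> (Inr e)) tgt = \<kappa> (Inl (snd e))"
    using is_colimit_cocone[OF k] unfolding iff by blast+
  have "rel_map X c (\<lambda>a. \<kappa> (Inl a))"
    unfolding rel_map_def
  proof (intro conjI ballI)
    fix e assume e: "e \<in> snd X"
    show "(\<kappa> (Inl (fst e)), \<kappa> (Inl (snd e))) \<in> Rel c"
      unfolding Rel_def k0(4)[OF e, symmetric] k0(5)[OF e, symmetric] using k0(3)[OF e] by blast
  qed (rule k0(1), erule k0(2))
  moreover have "\<exists>!u. u \<in> Hom C c d \<and> (\<forall>a \<in> fst X. Comp C u (\<kappa> (Inl a)) = \<psi> a)"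
    if m: "rel_map X d \<psi>" for d \<psi>
  proof -
    have "\<exists>w. e \<in> snd X \<longrightarrow> w \<in> Hom C (obj_map F 2) d \<and> Comp C w src = \<psi> (fst e) \<and>
        Comp C w tgt = \<psi> (snd e)" for e
      using rel_mapD(3)[OF m, of "fst e" "snd e"] unfolding in_Rel_iff prod.collapse by metis
    then obtain w where w: "\<And>e. e \<in> snd X \<Longrightarrow> w e \<in> Hom C (obj_map F 2) d"
      "\<And>e. e \<in> snd X \<Longrightarrow> Comp C (w e) src = \<psi> (fst e)"
      "\<And>e. e \<in> snd X \<Longrightarrow> Comp C (w e) tgt = \<psi> (snd e)"
      by metis
    have "is_cocone ?J C (H \<circ>\<^sub>F graph_diagram) d (case_sum \<psi> w)"
      unfolding iff using rel_mapD[OF m] w by simp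
    from is_colimit_ex1[OF k this]
    have ex1: "\<exists>!u. u \<in> Hom C c d \<and> (\<forall>j \<in> Ob ?J. Comp C u (\<kappa> j) = case_sum \<psi> w j)" .
    have "(\<forall>j \<in> Ob ?J. Comp C u (\<kappa> j) = case_sum \<psi> w j) \<longleftrightarrow>
        (\<forall>a \<in> fst X. Comp C u (\<kappa> (Inl a)) = \<psi> a)" if u: "u \<in> Hom C c d" for u
    proof
      assume *: "\<forall>j \<in> Ob ?J. Comp C u (\<kappa> j) = case_sum \<psi> w j"
      then show "\<forall>a \<in> fst X. Comp C u (\<kappa> (Inl a)) = \<psi> a"
        using bspec[OF *, of "Inl _"] by (simp add: InlI)
    next
      assume *: "\<forall>a \<in> fst X. Comp C u (\<kappa> (Inl a)) = \<psi> a"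
      \<comment> \<open>An equation between edges: by \<open>edge_unique\<close> it can be checked
        at the two ends, where it is the hypothesis on points.\<close>
      have "Comp C u (\<kappa> (Inr e)) = w e" if e: "e \<in> snd X" for e
        using Comp_assoc[OF C u k0(3)[OF e] src_Hom] Comp_assoc[OF C u k0(3)[OF e] tgt_Hom]
          k0(4,5)[OF e] w[OF e] * sub[OF e]
        by (intro edge_unique[OF Comp_Hom[OF C u k0(3)[OF e]]]) simp_all
      then show "\<forall>j \<in> Ob ?J. Comp C u (\<kappa> j) = case_sum \<psi> w j"
        using * by auto
    qed
    then show ?thesis using ex1 by (simp cong: conj_cong)
  qed
  ultimately show ?thesis unfolding represents_def by blast
qed

lemma represents_ex:
  assumes X: "X \<in> Ob cat_TransRel"
  shows "\<exists>c \<phi>. represents X c \<phi>"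
proof -
  have "finite (fst X)" "finite (snd X)"
    using TransRel_Ob_finite[OF X] by auto
  note fin = finite_graph_index[OF this]
  obtain c \<kappa> where "is_colimit (graph_index (fst X) (snd X) fst snd) C (F \<circ>\<^sub>F graph_diagram) c \<kappa>"
    using finitely_cocomplete_colimit[OF finitely_cocomplete is_category_graph_index fin
        is_functor_comp[OF is_functor_graph_diagram F]] by blast
  from represents_graph_colimit[OF X F refl refl src_def[symmetric] tgt_def[symmetric] this]
  show ?thesis by blast
qed

text \<open>\<open>F\<close> preserves the gluing of [n] from its points and ordered pairs, so the
  given value of \<open>F\<close> already represents the chain. This is what lets the extension
  agree with \<open>F\<close> strictly.\<close>

lemma represents_chain:
  "represents (chain n :: 'a::infinite set \<times> 'a rel) (obj_map F n)
    (\<lambda>a. arr_map F (point (inv nat_emb a) n))"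
proof -
  let ?X = "chain n :: 'a set \<times> 'a rel" and ?p = "inv nat_emb :: 'a \<Rightarrow> nat"
  have "finite (fst ?X)" "finite (snd ?X)"
    using TransRel_Ob_finite[OF chain_Ob] by auto
  moreover have "bij_betw ?p (fst ?X) {..<n}"
    by (rule bij_betwI[where g = nat_emb]) (auto simp: in_fst_chain)
  moreover have "fst e \<in> fst ?X \<and> snd e \<in> fst ?X \<and> ?p (fst e) < ?p (snd e)" if "e \<in> snd ?X" for e
    using that by (cases e) (auto simp: in_snd_chain)
  moreover have "\<exists>e \<in> snd ?X. fst e = v \<and> snd e = w"
    if "v \<in> fst ?X" "w \<in> fst ?X" "?p w = Suc (?p v)" for v w
    using that by (intro bexI[of _ "(v, w)"]) (auto simp: in_fst_chain)
  ultimately have "is_colimit (graph_index (fst ?X) (snd ?X) fst snd) C (F \<circ>\<^sub>F graph_diagram) (obj_map F n)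
    (\<lambda>j. arr_map F (case_sum (\<lambda>v. point (?p v) n) (\<lambda>e. edge (?p (fst e)) (?p (snd e)) n) j))"
    by (rule F_graph_colimit)
  from represents_graph_colimit[OF chain_Ob F refl refl src_def[symmetric] tgt_def[symmetric] this]
  show ?thesis by simp
qed

text \<open>An extension preserves the presentation of \<open>X\<close> by points and edges, and on
  those it agrees with \<open>F\<close>; so its value at \<open>X\<close> is forced up to
  isomorphism.\<close>

lemma represents_extension:
  fixes E :: "('a::infinite set \<times> 'a rel, _, 'c, 'd) functor_data"
  assumes E: "is_cocontinuous_extension cat_L cat_TransRel chain_functor C F E"
    and X: "X \<in> Ob cat_TransRel"
  shows "represents X (obj_map E X) (\<lambda>a. arr_map E (rel_point X a))"
proof -
  have E': "is_functor cat_TransRel C E" "preserves_finite_colimits cat_TransRel C E"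
    "functor_eq cat_L (E \<circ>\<^sub>F chain_functor) F"
    using E unfolding is_cocontinuous_extension_def by blast+
  have "finite (fst X)" "finite (snd X)"
    using TransRel_Ob_finite[OF X] by auto
  note fin = finite_graph_index[OF this]
  let ?H = "E \<circ>\<^sub>F chain_functor"
  have H: "is_functor cat_L C ?H" by (rule is_functor_comp[OF is_functor_chain E'(1)])
  have Ho: "obj_map ?H n = obj_map F n" for n
    using functor_eqD(1)[OF E'(3)] by simp
  have Ha: "arr_map ?H (point i 2) = arr_map F (point i 2)" if "i < 2" for i
    using functor_eqD(2)[OF E'(3) point_Hom[OF that]] .
  have Ha': "arr_map ?H (point 0 2) = src" "arr_map ?H (point 1 2) = tgt"
    unfolding src_def tgt_def by (rule Ha; simp)+
  have "is_colimit (graph_index (fst X) (snd X) fst snd) C (?H \<circ>\<^sub>F graph_diagram) (obj_map E X)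
      (\<lambda>j. arr_map E (case_sum (rel_point X) (rel_edge X) j))"
    unfolding functor_comp_assoc
    by (rule preserves_finite_colimits_colimit[OF E'(2) is_category_graph_index fin
          is_functor_comp[OF is_functor_graph_diagram is_functor_chain] graph_colimit_TransRel[OF X]])
  from represents_graph_colimit[OF X H Ho Ho Ha' this]
  show ?thesis by simp
qed

lemma extension_ex:
  "\<exists>E :: ('a::infinite set \<times> 'a rel, _, 'c, 'd) functor_data.
     is_cocontinuous_extension cat_L cat_TransRel chain_functor C F E"
proof -
  let ?Q = "cat_TransRel :: ('a set \<times> 'a rel, _) category"
  have chain_inj: "m = n" if "(chain m :: 'a set \<times> 'a rel) = chain n" for m n
    using is_embedding_chain[where ?'a = 'a] that unfolding is_embedding_def
    by (auto dest: inj_onD)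
  \<comment> \<open>Representing objects are arbitrary except at chains, where they are pinned to
    the values of \<open>F\<close>: an extension has to equal \<open>F\<close> along the chains, not
    only up to isomorphism. As \<open>chain\<close> is injective, the requirements do not
    clash.\<close>
  have "\<exists>c \<phi>. X \<in> Ob ?Q \<longrightarrow> represents X c \<phi> \<and>
      (\<forall>n. X = chain n \<longrightarrow> c = obj_map F n \<and> \<phi> = (\<lambda>a. arr_map F (point (inv nat_emb a) n)))" for X
  proof (cases "\<exists>n. X = chain n")
    case True
    then obtain n where n: "X = chain n" by blast
    then show ?thesis using represents_chain[of n, where ?'a = 'a] chain_inj by blast
  next
    case False
    then show ?thesis using represents_ex[of X] by blast
  qed
  then obtain eo \<phi> where rep: "\<And>X. X \<in> Ob ?Q \<Longrightarrow> represents X (eo X) (\<phi> X)"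
    and chain: "\<And>n. eo (chain n) = obj_map F n"
      "\<And>n. \<phi> (chain n) = (\<lambda>a. arr_map F (point (inv nat_emb a) n))"
    using chain_Ob by metis
  note rm = representsD(1)[OF rep]
  note phi = rel_mapD(2)[OF rm]
  \<comment> \<open>The universal element turns the action of \<open>h\<close> on points into an
    arrow of \<open>C\<close>. Since this arrow is unique, functoriality is inherited from the
    composition of functions.\<close>
  have "\<exists>u. \<forall>X Y. h \<in> Hom ?Q X Y \<longrightarrow>
      u \<in> Hom C (eo X) (eo Y) \<and> (\<forall>a \<in> fst X. Comp C u (\<phi> X a) = \<phi> Y (act h a))" for h
  proof (cases "h \<in> Ar ?Q")
    case True
    then have h: "h \<in> Hom ?Q (Dom ?Q h) (Cod ?Q h)" by (rule Ar_Hom)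
    note Ob = TransRel_HomD(3,4)[OF h]
    obtain u where "u \<in> Hom C (eo (Dom ?Q h)) (eo (Cod ?Q h))"
      "\<forall>a \<in> fst (Dom ?Q h). Comp C u (\<phi> (Dom ?Q h) a) = \<phi> (Cod ?Q h) (act h a)"
      using representsD(2)[OF rep[OF Ob(1)] rel_map_act[OF rm[OF Ob(2)] h]] by blast
    then have "\<forall>X Y. h \<in> Hom ?Q X Y \<longrightarrow>
        u \<in> Hom C (eo X) (eo Y) \<and> (\<forall>a \<in> fst X. Comp C u (\<phi> X a) = \<phi> Y (act h a))"
      using Hom_Dom Hom_Cod by metis
    then show ?thesis by blast
  qed (metis Hom_Ar)
  then obtain ea where ea: "\<And>h X Y. h \<in> Hom ?Q X Y \<Longrightarrow> ea h \<in> Hom C (eo X) (eo Y)"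
    "\<And>h X Y a. h \<in> Hom ?Q X Y \<Longrightarrow> a \<in> fst X \<Longrightarrow> Comp C (ea h) (\<phi> X a) = \<phi> Y (act h a)"
    by metis
  define E where "E = \<lparr>obj_map = eo, arr_map = ea\<rparr>"
  have E_simps: "obj_map E = eo" "arr_map E = ea" by (simp_all add: E_def)
  have E: "is_functor ?Q C E"
    unfolding is_functor_def E_simps
  proof (intro conjI ballI allI)
    fix X assume X: "X \<in> Ob ?Q"
    then show eX: "eo X \<in> Ob C" using rel_mapD(1)[OF rm] by blast
    note Id = Id_Hom[OF is_category_TransRel X]
    show "ea (Id ?Q X) = Id C (eo X)"
      by (rule represents_unique[OF rep[OF X] ea(1)[OF Id] Id_Hom[OF C eX]])
        (simp add: ea(2)[OF Id] act_TransRel_Id Comp_Id_left[OF C phi[OF X]])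
  next
    fix X Y Z f g assume f: "f \<in> Hom ?Q X Y" and g: "g \<in> Hom ?Q Y Z"
    note gf = Comp_Hom[OF is_category_TransRel g f]
    have X: "X \<in> Ob ?Q" using TransRel_HomD(3)[OF f] .
    show "ea (Comp ?Q g f) = Comp C (ea g) (ea f)"
      by (rule represents_unique[OF rep[OF X] ea(1)[OF gf] Comp_Hom[OF C ea(1)[OF g] ea(1)[OF f]]])
        (simp add: ea(2)[OF gf] act_TransRel_Comp[OF g f] ea(2)[OF f] ea(2)[OF g] TransRel_HomD(1)[OF f]
          Comp_assoc[OF C ea(1)[OF g] ea(1)[OF f] phi[OF X], symmetric])
  next
    show "ea h \<in> Hom C (eo X) (eo Y)" if "h \<in> Hom ?Q X Y" for X Y h
      using ea(1)[OF that] .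
  qed
  have "functor_eq cat_L (E \<circ>\<^sub>F chain_functor) F"
    unfolding functor_eq_def functor_comp_simps E_simps
  proof (intro conjI ballI)
    show "eo (obj_map chain_functor n) = obj_map F n" for n by (simp add: chain)
  next
    fix h assume "h \<in> Ar cat_L"
    from Ar_Hom[OF this] obtain m n where h: "h \<in> Hom cat_L m n" by (rule that)
    note yh = chain_functor_Hom[where ?'a = 'a, OF h]
    have Fh: "arr_map F h \<in> Hom C (eo (chain m)) (eo (chain n))"
      using is_functor_Hom[OF F h] by (simp add: chain)
    show "ea (arr_map chain_functor h) = arr_map F h"
    proof (rule represents_unique[OF rep[OF chain_Ob] ea(1)[OF yh] Fh])
      fix a :: 'a assume a: "a \<in> fst (chain m)"
      then obtain i where i: "i < m" "a = nat_emb i" by (auto simp: in_fst_chain)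
      show "Comp C (ea (arr_map chain_functor h)) (\<phi> (chain m) a) =
          Comp C (arr_map F h) (\<phi> (chain m) a)"
        unfolding ea(2)[OF yh a]
        using is_functor_Comp[OF F h point_Hom[OF i(1)]] Comp_point[OF h i(1)]
        by (simp add: i(2) chain act_chain_functor[OF h i(1)])
    qed
  qed
  moreover have "preserves_finite_colimits ?Q C E"
    unfolding preserves_finite_colimits_def
  proof (intro allI impI)
    fix J D K \<kappa> assume *: "finite_index J \<and> is_functor J ?Q D \<and> is_colimit J ?Q D K \<kappa>"
    then have J: "is_category J" "finite (Ob J)" and D: "is_functor J ?Q D"
      and k: "is_colimit J ?Q D K \<kappa>"
      by (auto simp: finite_index_def)
    note k0 = is_colimit_cocone[OF k]
    note K = is_cocone_Ob[OF k0] and kH = is_cocone_Hom[OF k0]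
    note DO = is_functor_Ob[OF D]
    show "is_colimit J C (E \<circ>\<^sub>F D) (obj_map E K) (\<lambda>j. arr_map E (\<kappa> j))"
      unfolding is_colimit_def
    proof (intro conjI allI impI functor_cocone[OF J(1) D E k0])
      fix d \<mu> assume mu: "is_cocone J C (E \<circ>\<^sub>F D) d \<mu>"
      have muH: "\<mu> j \<in> Hom C (eo (obj_map D j)) d" if "j \<in> Ob J" for j
        using is_cocone_Hom[OF mu that] by (simp add: E_simps)
      define \<psi> where "\<psi> j a = Comp C (\<mu> j) (\<phi> (obj_map D j) a)" for j a
      \<comment> \<open>Read at points, a cocone under the image of \<open>D\<close> is a cocone of
        relations into \<open>Rel d\<close>, so the colimit property of \<open>K\<close> among
        relations applies.\<close>
      have "rel_cocone J D (Rel d) \<psi>"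
        unfolding rel_cocone_def
      proof (intro conjI ballI allI trans_Rel)
        fix j e assume "j \<in> Ob J" "e \<in> snd (obj_map D j)"
        then show "case e of (a, b) \<Rightarrow> (\<psi> j a, \<psi> j b) \<in> Rel d"
          using rel_mapD(3)[OF rel_map_Comp[OF rm[OF DO] muH]] by (auto simp: \<psi>_def)
      next
        fix i j t a assume t: "t \<in> Hom J i j" and a: "a \<in> fst (obj_map D i)"
        then have i: "i \<in> Ob J" and j: "j \<in> Ob J" using Hom_Ob[OF J(1) t] by auto
        note Dt = is_functor_Hom[OF D t]
        have "\<psi> j (act (arr_map D t) a) = Comp C (\<mu> j) (Comp C (ea (arr_map D t)) (\<phi> (obj_map D i) a))"
          by (simp add: \<psi>_def ea(2)[OF Dt a])
        also have "\<dots> = \<psi> i a"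
          using Comp_assoc[OF C muH[OF j] ea(1)[OF Dt] phi[OF DO[OF i] a]] is_cocone_Comp[OF mu t]
          by (simp add: \<psi>_def E_simps)
        finally show "\<psi> j (act (arr_map D t) a) = \<psi> i a" .
      qed
      then obtain v where v: "\<And>x y. (x, y) \<in> snd K \<Longrightarrow> (v x, v y) \<in> Rel d"
        "\<And>j a. j \<in> Ob J \<Longrightarrow> a \<in> fst (obj_map D j) \<Longrightarrow> v (act (\<kappa> j) a) = \<psi> j a"
        using TransRel_colimit_factor[OF J D k] by blast
      \<comment> \<open>The factorization \<open>v\<close> is known only on related pairs and on the
        images of the legs. An isolated element of \<open>K\<close> also has its value in the
        hom-set because the legs are jointly surjective.\<close>
      have "v x \<in> Hom C (obj_map F 1) d" if "x \<in> fst K" for x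
      proof -
        obtain j a where ja: "j \<in> Ob J" "a \<in> fst (obj_map D j)" "act (\<kappa> j) a = x"
          using TransRel_colimit_surj[OF J(1) D k \<open>x \<in> fst K\<close>] by blast
        show ?thesis
          using v(2)[OF ja(1,2)] Comp_Hom[OF C muH[OF ja(1)] phi[OF DO[OF ja(1)] ja(2)]] ja(3)
          by (simp add: \<psi>_def)
      qed
      then have "rel_map K d v"
        using v(1) is_cocone_Ob[OF mu] by (simp add: rel_map_def)
      then obtain u where u: "u \<in> Hom C (eo K) d" "\<And>x. x \<in> fst K \<Longrightarrow> Comp C u (\<phi> K x) = v x"
        using representsD(2)[OF rep[OF K]] by blast
      have eak: "Comp C (Comp C w (ea (\<kappa> j))) (\<phi> (obj_map D j) a) = Comp C w (\<phi> K (act (\<kappa> j) a))"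
        if w: "w \<in> Hom C (eo K) d" and j: "j \<in> Ob J" and a: "a \<in> fst (obj_map D j)" for w j a
        using Comp_assoc[OF C w ea(1)[OF kH[OF j]] phi[OF DO[OF j] a]] ea(2)[OF kH[OF j] a] by simp
      show "\<exists>!u. u \<in> Hom C (obj_map E K) d \<and> (\<forall>j\<in>Ob J. Comp C u (arr_map E (\<kappa> j)) = \<mu> j)"
        unfolding E_simps
      proof (intro ex1I[of _ u] conjI ballI u(1))
        fix j assume j: "j \<in> Ob J"
        show "Comp C u (ea (\<kappa> j)) = \<mu> j"
        proof (rule represents_unique[OF rep[OF DO[OF j]] Comp_Hom[OF C u(1) ea(1)[OF kH[OF j]]] muH[OF j]])
          fix a assume a: "a \<in> fst (obj_map D j)"
          show "Comp C (Comp C u (ea (\<kappa> j))) (\<phi> (obj_map D j) a) = Comp C (\<mu> j) (\<phi> (obj_map D j) a)"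
            using eak[OF u(1) j a] u(2)[OF TransRel_HomD(1)[OF kH[OF j] a]] v(2)[OF j a]
            by (simp add: \<psi>_def)
        qed
      next
        fix w assume w: "w \<in> Hom C (eo K) d \<and> (\<forall>j\<in>Ob J. Comp C w (ea (\<kappa> j)) = \<mu> j)"
        then have wH: "w \<in> Hom C (eo K) d" by simp
        show "w = u"
        proof (rule represents_unique[OF rep[OF K] wH u(1)])
          fix x assume x: "x \<in> fst K"
          obtain j a where ja: "j \<in> Ob J" "a \<in> fst (obj_map D j)" "act (\<kappa> j) a = x"
            using TransRel_colimit_surj[OF J(1) D k x] by blast
          show "Comp C w (\<phi> K x) = Comp C u (\<phi> K x)"
            using eak[OF wH ja(1,2)] ja(3) w ja(1) v(2)[OF ja(1,2)] u(2)[OF x] by (simp add: \<psi>_def)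
        qed
      qed
    qed
  qed
  ultimately show ?thesis
    using E unfolding is_cocontinuous_extension_def by blast
qed

text \<open>Both extensions represent the same homomorphisms, which gives the comparison. The
  prescribed identity at \<open>chain 1\<close> and naturality along the points of \<open>X\<close>
  fix a comparison on all points, hence completely.\<close>

lemma extension_unique:
  fixes E E' :: "('a::infinite set \<times> 'a rel, _, 'c, 'd) functor_data"
  assumes E: "is_cocontinuous_extension cat_L cat_TransRel chain_functor C F E"
    and E': "is_cocontinuous_extension cat_L cat_TransRel chain_functor C F E'"
  shows "\<exists>!\<theta>. \<theta> \<in> extensional (Ob cat_TransRel) \<and> is_natural_iso cat_TransRel C E E' \<theta> \<and>
    (\<forall>n \<in> Ob cat_L. \<theta> (obj_map chain_functor n) = Id C (obj_map F n))"
proof -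
  let ?Q = "cat_TransRel :: ('a set \<times> 'a rel, _) category"
  have EF: "is_functor ?Q C E" "is_functor ?Q C E'"
    "functor_eq cat_L (E \<circ>\<^sub>F chain_functor) F" "functor_eq cat_L (E' \<circ>\<^sub>F chain_functor) F"
    using E E' unfolding is_cocontinuous_extension_def by blast+
  note r = represents_extension[OF E] and r' = represents_extension[OF E']
  have Ech: "obj_map E (chain n) = obj_map F n" "obj_map E' (chain n) = obj_map F n" for n
    using functor_eqD(1)[OF EF(3), of n] functor_eqD(1)[OF EF(4), of n] by simp_all
  have EP: "Comp C (arr_map G f) (arr_map G (rel_point X a)) = arr_map G (rel_point Y (act f a))"
    if "is_functor ?Q C G" "f \<in> Hom ?Q X Y" "a \<in> fst X" for G f X Y a
    using is_functor_Comp[OF that(1,2) rel_point_Hom[OF TransRel_HomD(3)[OF that(2)] that(3)]]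
      Comp_rel_point[OF that(2,3)] by simp
  have "\<exists>u. X \<in> Ob ?Q \<longrightarrow> u \<in> Hom C (obj_map E X) (obj_map E' X) \<and>
      (\<forall>a \<in> fst X. Comp C u (arr_map E (rel_point X a)) = arr_map E' (rel_point X a))" for X
    using representsD(2)[OF r representsD(1)[OF r']] by blast
  then obtain u where u: "\<And>X. X \<in> Ob ?Q \<Longrightarrow> u X \<in> Hom C (obj_map E X) (obj_map E' X)"
    "\<And>X a. X \<in> Ob ?Q \<Longrightarrow> a \<in> fst X \<Longrightarrow>
      Comp C (u X) (arr_map E (rel_point X a)) = arr_map E' (rel_point X a)"
    by metis
  define \<theta> where "\<theta> = restrict u (Ob ?Q)"
  note phi = rel_mapD(2)[OF representsD(1)[OF r]]
  have nat: "is_natural_iso ?Q C E E' \<theta>"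
    unfolding is_natural_iso_def is_natural_def
  proof (intro conjI ballI allI)
    fix X assume X: "X \<in> Ob ?Q"
    then show "\<theta> X \<in> Hom C (obj_map E X) (obj_map E' X)" using u by (simp add: \<theta>_def)
    show "is_iso C (\<theta> X)"
      using represents_iso[OF r[OF X] r'[OF X] u(1)[OF X] u(2)[OF X]] X by (simp add: \<theta>_def)
  next
    fix X Y f assume f: "f \<in> Hom ?Q X Y"
    note XY = TransRel_HomD(3,4)[OF f]
    note Ef = is_functor_Hom[OF EF(1) f] and Ef' = is_functor_Hom[OF EF(2) f]
    have "Comp C (arr_map E' f) (u X) = Comp C (u Y) (arr_map E f)"
    proof (rule represents_unique[OF r[OF XY(1)] Comp_Hom[OF C Ef' u(1)[OF XY(1)]]
          Comp_Hom[OF C u(1)[OF XY(2)] Ef]])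
      fix a assume a: "a \<in> fst X"
      show "Comp C (Comp C (arr_map E' f) (u X)) (arr_map E (rel_point X a)) =
          Comp C (Comp C (u Y) (arr_map E f)) (arr_map E (rel_point X a))"
        using Comp_assoc[OF C Ef' u(1)[OF XY(1)] phi[OF XY(1) a]] u(2)[OF XY(1) a]
          Comp_assoc[OF C u(1)[OF XY(2)] Ef phi[OF XY(1) a]] u(2)[OF XY(2) TransRel_HomD(1)[OF f a]]
          EP[OF EF(1) f a] EP[OF EF(2) f a]
        by simp
    qed
    then show "Comp C (arr_map E' f) (\<theta> X) = Comp C (\<theta> Y) (arr_map E f)"
      using XY by (simp add: \<theta>_def)
  qed
  have uniq: "\<tau> X = u X"
    if t: "is_natural_iso ?Q C E E' \<tau>" "\<forall>n \<in> Ob cat_L. \<tau> (obj_map chain_functor n) = Id C (obj_map F n)"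
      and X: "X \<in> Ob ?Q" for \<tau> X
  proof (rule represents_unique[OF r[OF X] _ u(1)[OF X]])
    show "\<tau> X \<in> Hom C (obj_map E X) (obj_map E' X)" using natural_isoD(1)[OF t(1) X] .
    fix a assume a: "a \<in> fst X"
    note p = rel_point_Hom[OF X a]
    have "\<tau> (chain 1) = Id C (obj_map E' (chain 1))"
      using t(2) Ech(2)[of 1] by (simp del: One_nat_def)
    then have "Comp C (arr_map E' (rel_point X a)) (\<tau> (chain 1)) = arr_map E' (rel_point X a)"
      using Comp_Id_right[OF C is_functor_Hom[OF EF(2) p]] by simp
    then show "Comp C (\<tau> X) (arr_map E (rel_point X a)) = Comp C (u X) (arr_map E (rel_point X a))"
      using natural_isoD(3)[OF t(1) p] u(2)[OF X a] by simp
  qed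
  \<comment> \<open>The construction of \<open>u\<close> imposes nothing at chains in particular.
    The identity appears there because both extensions send a point of a chain to the same arrow of
    \<open>C\<close>.\<close>
  have chain: "\<theta> (chain n) = Id C (obj_map F n)" for n
  proof -
    have Id: "Id C (obj_map F n) \<in> Hom C (obj_map E (chain n)) (obj_map E' (chain n))"
      using Id_Hom[OF C is_functor_Ob[OF F]] by (simp add: Ech)
    have "u (chain n) = Id C (obj_map F n)"
    proof (rule represents_unique[OF r[OF chain_Ob] u(1)[OF chain_Ob] Id])
      fix a :: 'a assume a: "a \<in> fst (chain n)"
      then obtain i where i: "i < n" "a = nat_emb i" by (auto simp: in_fst_chain)
      have p: "arr_map E (rel_point (chain n) a) = arr_map F (point i n)"
        "arr_map E' (rel_point (chain n) a) = arr_map F (point i n)"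
        using functor_eqD(2)[OF EF(3) point_Hom[OF i(1)]] functor_eqD(2)[OF EF(4) point_Hom[OF i(1)]]
        by (simp_all add: i(2) chain_functor_point[OF i(1)])
      show "Comp C (u (chain n)) (arr_map E (rel_point (chain n) a)) =
          Comp C (Id C (obj_map F n)) (arr_map E (rel_point (chain n) a))"
        using u(2)[OF chain_Ob a] p Comp_Id_left[OF C is_functor_Hom[OF F point_Hom[OF i(1)]]] by simp
    qed
    then show ?thesis by (simp add: \<theta>_def chain_Ob)
  qed
  show ?thesis
  proof (intro ex1I[of _ \<theta>] conjI nat)
    show "\<theta> \<in> extensional (Ob ?Q)" by (simp add: \<theta>_def)
    show "\<forall>n \<in> Ob cat_L. \<theta> (obj_map chain_functor n) = Id C (obj_map F n)" by (simp add: chain)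
    fix \<tau> assume t: "\<tau> \<in> extensional (Ob ?Q) \<and> is_natural_iso ?Q C E E' \<tau> \<and>
      (\<forall>n \<in> Ob cat_L. \<tau> (obj_map chain_functor n) = Id C (obj_map F n))"
    show "\<tau> = \<theta>"
      by (rule extensionalityI[of _ "Ob ?Q"]) (use t uniq in \<open>auto simp: \<theta>_def\<close>)
  qed
qed

end

theorem TransRel_free_cocompletion:
  "is_free_conservative_finite_cocompletion TYPE(('c, 'd) category) cat_L
    (cat_TransRel :: ('a::infinite set \<times> 'a rel, _) category) chain_functor"
  unfolding is_free_conservative_finite_cocompletion_def
proof (intro conjI allI impI)
  fix C :: "('c, 'd) category" and F
  assume "finitely_cocomplete C \<and> is_functor cat_L C F \<and> preserves_finite_colimits cat_L C F"
  then interpret conservative_functor C F by unfold_locales auto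
  show "\<exists>E. is_cocontinuous_extension cat_L
      (cat_TransRel :: ('a::infinite set \<times> 'a rel, _) category) chain_functor C F E"
    by (rule extension_ex)
  fix E E' :: "('a set \<times> 'a rel, _, 'c, 'd) functor_data"
  assume "is_cocontinuous_extension cat_L cat_TransRel chain_functor C F E \<and>
    is_cocontinuous_extension cat_L cat_TransRel chain_functor C F E'"
  then show "\<exists>!\<theta>. \<theta> \<in> extensional (Ob cat_TransRel) \<and> is_natural_iso cat_TransRel C E E' \<theta> \<and>
      (\<forall>n \<in> Ob cat_L. \<theta> (obj_map chain_functor n) = Id C (obj_map F n))"
    using extension_unique by blast
qed (rule finitely_cocomplete_TransRel is_embedding_chain preserves_finite_colimits_chain)+

section \<open>Uniqueness of the cocompletion\<close>

text \<open>There are uncountably many functions on \<open>nat\<close>, but an arrow is determined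
  by its end points together with its graph, a finite set of pairs; \<open>g\<close> is this
  code.\<close>

lemma countable_TransRel:
  "countable (Ob (cat_TransRel :: (nat set \<times> nat rel, _) category))"
  "countable (Ar (cat_TransRel :: (nat set \<times> nat rel, _) category))"
proof -
  let ?Q = "cat_TransRel :: (nat set \<times> nat rel, _) category"
  have "Ob ?Q \<subseteq> {A. finite A} \<times> {r. finite r}"
    using TransRel_Ob_finite by fastforce
  then show Ob: "countable (Ob ?Q)"
    by (rule countable_subset) (intro countable_SIGMA countable_Collect_finite)
  define g :: "nat rel_arrow \<Rightarrow> _"
    where "g h = (fst h, (\<lambda>a. (a, act h a)) ` fst (fst h), snd (snd h))" for h
  have Ar: "h \<in> Hom ?Q (fst h) (snd (snd h))" if "h \<in> Ar ?Q" for h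
    using Ar_Hom[OF that] by (auto simp: cat_TransRel_def category_of_homs_def split_beta)
  have "g ` Ar ?Q \<subseteq> Ob ?Q \<times> {r. finite r} \<times> Ob ?Q"
    using TransRel_HomD(3,4)[OF Ar] TransRel_Ob_finite by (fastforce simp: g_def)
  then have "countable (g ` Ar ?Q)"
    by (rule countable_subset) (intro countable_SIGMA countable_Collect_finite Ob)
  moreover have "inj_on g (Ar ?Q)"
  proof (rule inj_onI)
    fix h h' assume h: "h \<in> Ar ?Q" "h' \<in> Ar ?Q" and eq: "g h = g h'"
    have *: "fst h = fst h'" "snd (snd h) = snd (snd h')"
      "(\<lambda>a. (a, act h a)) ` fst (fst h) = (\<lambda>a. (a, act h' a)) ` fst (fst h')"
      using eq unfolding g_def prod.inject by blast+
    have "act h a = act h' a" if "a \<in> fst (fst h)" for a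
    proof -
      have "(a, act h a) \<in> (\<lambda>a. (a, act h' a)) ` fst (fst h')"
        using that *(3) by blast
      then show ?thesis by auto
    qed
    then show "h = h'"
      using Ar[OF h(1)] Ar[OF h(2)] * by (intro TransRel_ext[of h "fst h" "snd (snd h)"]) auto
  qed
  ultimately show "countable (Ar ?Q)"
    by (rule countable_image_inj_on)
qed

section \<open>Comparison of free cocompletions\<close>

lemma free_cocompletionD:
  assumes "is_free_conservative_finite_cocompletion TYPE(('c, 'd) category) L P y"
  shows "finitely_cocomplete P" "is_embedding L P y" "is_functor L P y" "preserves_finite_colimits L P y"
    and "\<And>(C :: ('c, 'd) category) F. finitely_cocomplete C \<Longrightarrow> is_functor L C F \<Longrightarrow>
      preserves_finite_colimits L C F \<Longrightarrow> \<exists>E. is_cocontinuous_extension L P y C F E"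
    and "\<And>(C :: ('c, 'd) category) F E E'. finitely_cocomplete C \<Longrightarrow> is_functor L C F \<Longrightarrow>
      preserves_finite_colimits L C F \<Longrightarrow> is_cocontinuous_extension L P y C F E \<Longrightarrow>
      is_cocontinuous_extension L P y C F E' \<Longrightarrow> \<exists>\<theta>. is_natural_iso P C E E' \<theta>"
proof -
  note a = assms[unfolded is_free_conservative_finite_cocompletion_def]
  show "finitely_cocomplete P" "is_embedding L P y" "preserves_finite_colimits L P y"
    using a by simp_all
  then show "is_functor L P y" by (simp add: is_embedding_def)
  fix C :: "('c, 'd) category" and F
  assume *: "finitely_cocomplete C" "is_functor L C F" "preserves_finite_colimits L C F"
  with a show "\<exists>E. is_cocontinuous_extension L P y C F E" by simp
  fix E E'
  assume "is_cocontinuous_extension L P y C F E" "is_cocontinuous_extension L P y C F E'"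
  with a * have "\<exists>!\<theta>. \<theta> \<in> extensional (Ob P) \<and> is_natural_iso P C E E' \<theta> \<and>
      (\<forall>n\<in>Ob L. \<theta> (obj_map y n) = Id C (obj_map F n))"
    by simp
  then show "\<exists>\<theta>. is_natural_iso P C E E' \<theta>" by (elim ex1E conjE) (rule exI)
qed

lemma cocontinuous_extension_comp:
  assumes G: "is_cocontinuous_extension L P y Q y' G" and E: "is_cocontinuous_extension L Q y' R F E"
  shows "is_cocontinuous_extension L P y R F (E \<circ>\<^sub>F G)"
  using assms is_functor_comp[of P Q G R E] preserves_finite_colimits_comp[of P Q G R E]
  by (simp add: is_cocontinuous_extension_def functor_eq_def)

lemma cocontinuous_extension_id: "is_cocontinuous_extension L P y P y id_functor"
  by (simp add: is_cocontinuous_extension_def is_functor_id preserves_finite_colimits_id functor_eq_def)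

text \<open>Both composites and the identities extend the same functor, hence are isomorphic. The
  comparison functors \<open>G\<close> and \<open>E\<close> are hypotheses because their existence
  relates two types, whereas each universal property is assumed at its own type only.\<close>

lemma free_cocompletions_equivalent:
  fixes P :: "('o, 'm) category" and Q :: "('p, 'n) category"
  assumes P: "is_free_conservative_finite_cocompletion TYPE(('o, 'm) category) L P y"
    and Q: "is_free_conservative_finite_cocompletion TYPE(('p, 'n) category) L Q y'"
    and G: "is_cocontinuous_extension L P y Q y' G" and E: "is_cocontinuous_extension L Q y' P y E"
  shows "equivalent_categories P Q"
proof -
  note PD = free_cocompletionD[OF P] and QD = free_cocompletionD[OF Q]
  obtain \<eta> where "is_natural_iso P P id_functor (E \<circ>\<^sub>F G) \<eta>"
    using PD(6)[OF PD(1,3,4) cocontinuous_extension_id cocontinuous_extension_comp[OF G E]] by blast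
  moreover obtain \<epsilon> where "is_natural_iso Q Q (G \<circ>\<^sub>F E) id_functor \<epsilon>"
    using QD(6)[OF QD(1,3,4) cocontinuous_extension_comp[OF E G] cocontinuous_extension_id] by blast
  moreover have "is_functor P Q G" "is_functor Q P E"
    using G E by (auto simp: is_cocontinuous_extension_def)
  ultimately show ?thesis
    using PD(1) QD(1) unfolding equivalent_categories_def finitely_cocomplete_def by blast
qed

text \<open>The universal property of \<open>P\<close> is only available for categories of the same type as \<open>P\<close>, so
  the relations on natural numbers, of which there are countably many, are copied into that type.\<close>

lemma free_cocompletion_equivalent_TransRel_nat:
  fixes P :: "('o, 'm) category"
  assumes P: "is_free_conservative_finite_cocompletion TYPE(('o, 'm) category) cat_L P y"
  shows "equivalent_categories P (cat_TransRel :: (nat set \<times> nat rel, _) category)"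
proof -
  let ?Q = "cat_TransRel :: (nat set \<times> nat rel, _) category"
  let ?y = "chain_functor :: (_, _, nat set \<times> nat rel, _) functor_data"
  note PD = free_cocompletionD[OF P]
  have Pcat: "is_category P" using PD(1) by (simp add: finitely_cocomplete_def)
  have injo: "inj (obj_map y)" using PD(2) by (simp add: is_embedding_def)
  have Id: "Id P (obj_map y n) \<in> Hom P (obj_map y n) (obj_map y n)" for n
    using Id_Hom[OF Pcat is_functor_Ob[OF PD(3)]] by simp
  have injm: "inj (\<lambda>n. Id P (obj_map y n))"
  proof (rule injI)
    fix m n assume "Id P (obj_map y m) = Id P (obj_map y n)"
    then have "obj_map y m = obj_map y n" using Hom_Dom[OF Id] by metis
    then show "m = n" using injo by (simp add: inj_eq)
  qed
  \<comment> \<open>\<open>y\<close> is injective on the numbers, so \<open>P\<close> has infinitely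
    many objects and, through their identities, infinitely many arrows. This is room for a copy of
    any countable category.\<close>
  define f where "f = obj_map y \<circ> to_nat_on (Ob ?Q)"
  define g where "g = (\<lambda>n. Id P (obj_map y n)) \<circ> to_nat_on (Ar ?Q)"
  have f: "inj_on f (Ob ?Q)" and g: "inj_on g (Ar ?Q)"
    unfolding f_def g_def
    by (intro comp_inj_on inj_on_to_nat_on countable_TransRel inj_on_subset[OF injo] subset_UNIV
        inj_on_subset[OF injm])+
  define T where "T = transport_category f g ?Q"
  have T: "is_category T" unfolding T_def by (rule transport_category(1)[OF is_category_TransRel f g])
  obtain U V where UV: "inverse_functors ?Q T U V"
    using transport_category(2)[OF is_category_TransRel f g] unfolding T_def by blast
  note UVD = inverse_functorsD[OF UV]
  have Ty: "preserves_finite_colimits cat_L T (U \<circ>\<^sub>F ?y)"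
    by (rule preserves_finite_colimits_comp[OF is_functor_chain preserves_finite_colimits_chain
          inverse_functors_preserves_finite_colimits[OF is_category_TransRel T UV]])
  \<comment> \<open>The copy \<open>T\<close> has the type of \<open>P\<close>, so the universal
    property of \<open>P\<close> applies to it; \<open>V\<close> then leads back from the copy to
    the relations.\<close>
  obtain E' where E': "is_cocontinuous_extension cat_L P y T (U \<circ>\<^sub>F ?y) E'"
    using PD(5)[OF inverse_functors_finitely_cocomplete[OF finitely_cocomplete_TransRel T UV]
        is_functor_comp[OF is_functor_chain UVD(1)] Ty] by blast
  have "functor_eq cat_L (V \<circ>\<^sub>F (U \<circ>\<^sub>F ?y)) ?y"
    using UVD(3)[OF chain_Ob] UVD(4)[OF chain_functor_Hom[OF Ar_Hom]] by (simp add: functor_eq_def)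
  then have "is_cocontinuous_extension cat_L T (U \<circ>\<^sub>F ?y) ?Q ?y V"
    using UVD(2) inverse_functors_preserves_finite_colimits[OF T is_category_TransRel
        inverse_functors_sym[OF UV]]
    by (simp add: is_cocontinuous_extension_def)
  note G = cocontinuous_extension_comp[OF E' this]
  \<comment> \<open>In this direction no copy is required: the universal property of the relations
    is established for targets of every type.\<close>
  obtain E where "is_cocontinuous_extension cat_L ?Q ?y P y E"
    using free_cocompletionD(5)[OF TransRel_free_cocompletion PD(1,3,4)] by blast
  then show ?thesis
    by (rule free_cocompletions_equivalent[OF P TransRel_free_cocompletion G])
qed

text \<open>Both categories are free cocompletions with respect to targets of every type, so each
  extends along the other; this replaces an explicit renaming of elements.\<close>

lemma TransRel_nat_equivalent_TransRel:
  "equivalent_categories (cat_TransRel :: (nat set \<times> nat rel, _) category)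
    (cat_TransRel :: ('a::infinite set \<times> 'a rel, _) category)"
proof -
  note free = TransRel_free_cocompletion
  note D = finitely_cocomplete_TransRel is_functor_chain preserves_finite_colimits_chain
  show ?thesis
    using free_cocompletionD(5)[OF free D] free_cocompletionD(5)[OF free D]
    by (elim exE) (rule free_cocompletions_equivalent[OF free free])
qed

section \<open>Graphs with unique edges along paths\<close>

lemma Ob_Graph: "G \<in> Ob cat_Graph \<longleftrightarrow>
  wf_digraph G \<and> tail G \<in> extensional (arcs G) \<and> head G \<in> extensional (arcs G)"
  by (simp add: cat_Graph_def)

lemma Hom_Graph: "h \<in> Hom cat_Graph G H \<longleftrightarrow> G \<in> Ob cat_Graph \<and> H \<in> Ob cat_Graph \<and>
  (\<exists>p q. h = (G, (p, q), H) \<and> p \<in> verts G \<rightarrow>\<^sub>E verts H \<and> q \<in> arcs G \<rightarrow>\<^sub>E arcs H \<and>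
     (\<forall>e \<in> arcs G. tail H (q e) = p (tail G e) \<and> head H (q e) = p (head G e)))"
  unfolding cat_Graph_def Hom_category_of_homs graph_homs_def by auto

lemma Graph_HomI:
  assumes "G \<in> Ob cat_Graph" "H \<in> Ob cat_Graph"
    and "\<And>v. v \<in> verts G \<Longrightarrow> p v \<in> verts H" "\<And>e. e \<in> arcs G \<Longrightarrow> q e \<in> arcs H"
    and "\<And>e. e \<in> arcs G \<Longrightarrow> tail H (q e) = p (tail G e)" "\<And>e. e \<in> arcs G \<Longrightarrow> head H (q e) = p (head G e)"
  shows "(G, (restrict p (verts G), restrict q (arcs G)), H) \<in> Hom cat_Graph G H"
proof -
  have "tail G e \<in> verts G" "head G e \<in> verts G" if "e \<in> arcs G" for e
    using assms(1) that by (auto simp: Ob_Graph wf_digraph_def)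
  then show ?thesis
    unfolding Hom_Graph using assms by auto
qed

lemma Graph_HomD:
  assumes "h \<in> Hom cat_Graph G H"
  shows "G \<in> Ob cat_Graph" "H \<in> Ob cat_Graph" "v \<in> verts G \<Longrightarrow> fst (act h) v \<in> verts H"
    "e \<in> arcs G \<Longrightarrow> snd (act h) e \<in> arcs H"
    "e \<in> arcs G \<Longrightarrow> tail H (snd (act h) e) = fst (act h) (tail G e)"
    "e \<in> arcs G \<Longrightarrow> head H (snd (act h) e) = fst (act h) (head G e)"
  using assms unfolding Hom_Graph by auto

lemma Graph_ext:
  assumes "h \<in> Hom cat_Graph G H" "h' \<in> Hom cat_Graph G H"
    and v: "\<And>v. v \<in> verts G \<Longrightarrow> fst (act h) v = fst (act h') v"
    and e: "\<And>e. e \<in> arcs G \<Longrightarrow> snd (act h) e = snd (act h') e"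
  shows "h = h'"
proof -
  obtain p q p' q' where *: "h = (G, (p, q), H)" "h' = (G, (p', q'), H)"
    "p \<in> verts G \<rightarrow>\<^sub>E verts H" "p' \<in> verts G \<rightarrow>\<^sub>E verts H" "q \<in> arcs G \<rightarrow>\<^sub>E arcs H" "q' \<in> arcs G \<rightarrow>\<^sub>E arcs H"
    using assms(1,2) unfolding Hom_Graph by auto
  have "p = p'" by (rule PiE_ext[OF *(3,4)]) (use v * in simp)
  moreover have "q = q'" by (rule PiE_ext[OF *(5,6)]) (use e * in simp)
  ultimately show ?thesis using * by simp
qed

lemma act_Graph_Comp:
  assumes "k \<in> Hom cat_Graph H K" "h \<in> Hom cat_Graph G H"
  shows "v \<in> verts G \<Longrightarrow> fst (act (Comp cat_Graph k h)) v = fst (act k) (fst (act h) v)"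
    and "e \<in> arcs G \<Longrightarrow> snd (act (Comp cat_Graph k h)) e = snd (act k) (snd (act h) e)"
  using assms unfolding Hom_Graph by (auto simp: cat_Graph_def compose_def)

lemma act_Graph_Id:
  "v \<in> verts G \<Longrightarrow> fst (act (Id cat_Graph G)) v = v"
  "e \<in> arcs G \<Longrightarrow> snd (act (Id cat_Graph G)) e = e"
  by (simp_all add: cat_Graph_def)

lemma is_category_Graph: "is_category cat_Graph"
  unfolding cat_Graph_def
proof (rule is_category_of_homs, goal_cases)
  case (1 G)
  then show ?case by (auto simp: graph_homs_def wf_digraph_def)
next
  case (2 G H K f g)
  obtain p q p' q' where fg: "f = (p, q)" "g = (p', q')" by (cases f, cases g)
  then have f: "p \<in> verts G \<rightarrow>\<^sub>E verts H" "q \<in> arcs G \<rightarrow>\<^sub>E arcs H"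
      "\<And>e. e \<in> arcs G \<Longrightarrow> tail H (q e) = p (tail G e) \<and> head H (q e) = p (head G e)"
    and g: "p' \<in> verts H \<rightarrow>\<^sub>E verts K" "q' \<in> arcs H \<rightarrow>\<^sub>E arcs K"
      "\<And>e. e \<in> arcs H \<Longrightarrow> tail K (q' e) = p' (tail H e) \<and> head K (q' e) = p' (head H e)"
    and G: "\<And>e. e \<in> arcs G \<Longrightarrow> tail G e \<in> verts G \<and> head G e \<in> verts G"
    using 2 by (auto simp: graph_homs_def wf_digraph_def)
  have "compose (verts G) p' p \<in> verts G \<rightarrow>\<^sub>E verts K" "compose (arcs G) q' q \<in> arcs G \<rightarrow>\<^sub>E arcs K"
    using f(1,2) g(1,2) by (auto simp: compose_def)
  moreover have "tail K (q' (q e)) = p' (p (tail G e)) \<and> head K (q' (q e)) = p' (p (head G e))"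
    if "e \<in> arcs G" for e
    using f(3)[OF that] g(3)[OF PiE_mem[OF f(2) that]] by simp
  ultimately show ?case
    using G unfolding fg graph_homs_def by (simp add: compose_def)
next
  case (3 G H f)
  obtain p q where f: "f = (p, q)" by (cases f)
  then have p: "p \<in> verts G \<rightarrow> verts H" "p \<in> extensional (verts G)"
    and q: "q \<in> arcs G \<rightarrow> arcs H" "q \<in> extensional (arcs G)"
    using 3 by (auto simp: graph_homs_def PiE_def)
  show ?case
    by (simp add: f compose_Id[OF p] compose_Id[OF q] Id_compose[OF p] Id_compose[OF q])
next
  case (4 G H K M f g h)
  obtain p q p' q' p'' q'' where fgh: "f = (p, q)" "g = (p', q')" "h = (p'', q'')"
    by (cases f, cases g, cases h)
  then have p: "p \<in> verts G \<rightarrow> verts H" and q: "q \<in> arcs G \<rightarrow> arcs H"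
    using 4 by (auto simp: graph_homs_def PiE_def)
  show ?case by (simp add: fgh compose_assoc[OF p] compose_assoc[OF q])
qed

section \<open>Full subcategories\<close>

lemma Hom_full_subcategory:
  "h \<in> Hom (full_subcategory C Q) x y \<longleftrightarrow> h \<in> Hom C x y \<and> Q x \<and> Q y"
  by (auto simp: Hom_def full_subcategory_def)

lemma full_subcategory_simps [simp]:
  "Ob (full_subcategory C Q) = {x \<in> Ob C. Q x}"
  "Id (full_subcategory C Q) = Id C" "Comp (full_subcategory C Q) = Comp C"
  by (simp_all add: full_subcategory_def)

lemma is_category_full_subcategory:
  assumes C: "is_category C"
  shows "is_category (full_subcategory C Q)"
  unfolding is_category_def
proof (intro conjI ballI allI)
  fix f assume "f \<in> Ar (full_subcategory C Q)"
  then show "Dom (full_subcategory C Q) f \<in> Ob (full_subcategory C Q)"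
    "Cod (full_subcategory C Q) f \<in> Ob (full_subcategory C Q)"
    using C by (auto simp: full_subcategory_def is_category_def)
qed (auto simp: Hom_full_subcategory Id_Hom[OF C] Comp_Id_left[OF C] Comp_Id_right[OF C]
    intro: Comp_Hom[OF C] Comp_assoc[OF C])

lemma is_category_PathGraph: "is_category cat_PathGraph"
  unfolding cat_PathGraph_def by (rule is_category_full_subcategory[OF is_category_Graph])

lemma Ob_PathGraph:
  "G \<in> Ob cat_PathGraph \<longleftrightarrow> G \<in> Ob cat_Graph \<and> fin_digraph G \<and> unique_edge_along_paths G"
  by (auto simp: cat_PathGraph_def)

lemma Hom_PathGraph:
  "h \<in> Hom cat_PathGraph G H \<longleftrightarrow> h \<in> Hom cat_Graph G H \<and> G \<in> Ob cat_PathGraph \<and> H \<in> Ob cat_PathGraph"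
  using Graph_HomD(1,2)[of h G H] unfolding Ob_PathGraph
  by (auto simp: cat_PathGraph_def Hom_full_subcategory)

lemma PathGraph_Comp [simp]: "Comp cat_PathGraph = Comp cat_Graph" "Id cat_PathGraph = Id cat_Graph"
  by (simp_all add: cat_PathGraph_def)

text \<open>Tail and head commute with bijections in one direction exactly if they commute with the
  inverses, so the inverse pair is again a morphism. The arrows are restrictions because morphisms
  of \<open>cat_Graph\<close> are extensional.\<close>

lemma Graph_isoI:
  fixes G H :: "('v, 'e) pre_digraph"
  assumes h: "(G, (restrict p (verts G), restrict q (arcs G)), H) \<in> Hom cat_PathGraph G H"
    and p: "bij_betw p (verts G) (verts H)" and q: "bij_betw q (arcs G) (arcs H)"
  shows "is_iso cat_PathGraph (G, (restrict p (verts G), restrict q (arcs G)), H)"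
proof -
  let ?h = "(G, (restrict p (verts G), restrict q (arcs G)), H)"
  have hG: "?h \<in> Hom cat_Graph G H" and GH: "G \<in> Ob cat_PathGraph" "H \<in> Ob cat_PathGraph"
    using h by (auto simp: Hom_PathGraph)
  note GH' = Graph_HomD(1,2)[OF hG]
  define p' q' where "p' = inv_into (verts G) p" and "q' = inv_into (arcs G) q"
  have p'p: "p' (p v) = v" "p v \<in> verts H" if "v \<in> verts G" for v
    using p that by (auto simp: p'_def bij_betw_def)
  have pp': "p (p' v) = v" "p' v \<in> verts G" if "v \<in> verts H" for v
    using p that by (auto simp: p'_def bij_betw_def f_inv_into_f inv_into_into)
  have q'q: "q' (q e) = e" "q e \<in> arcs H" if "e \<in> arcs G" for e
    using q that by (auto simp: q'_def bij_betw_def)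
  have qq': "q (q' e) = e" "q' e \<in> arcs G" if "e \<in> arcs H" for e
    using q that by (auto simp: q'_def bij_betw_def f_inv_into_f inv_into_into)
  have GV: "tail G e \<in> verts G" "head G e \<in> verts G" if "e \<in> arcs G" for e
    using GH'(1) that by (auto simp: Ob_Graph wf_digraph_def)
  have th: "tail H (q e) = p (tail G e)" "head H (q e) = p (head G e)" if "e \<in> arcs G" for e
    using Graph_HomD(5,6)[OF hG that] that GV[OF that] by simp_all
  have "tail G (q' e) = p' (tail H e)" "head G (q' e) = p' (head H e)" if e: "e \<in> arcs H" for e
    using th[OF qq'(2)[OF e]] qq'[OF e] p'p(1) GV by simp_all
  then have k: "(H, (restrict p' (verts H), restrict q' (arcs H)), G) \<in> Hom cat_Graph H G" (is "?k \<in> _")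
    using pp'(2) qq'(2) by (intro Graph_HomI[OF GH'(2,1)])
  note cat = is_category_Graph
  have "Comp cat_Graph ?k ?h = Id cat_Graph G"
    by (rule Graph_ext[OF Comp_Hom[OF cat k hG] Id_Hom[OF cat GH'(1)]])
      (simp_all add: act_Graph_Comp[OF k hG] act_Graph_Id p'p q'q)
  moreover have "Comp cat_Graph ?h ?k = Id cat_Graph H"
    by (rule Graph_ext[OF Comp_Hom[OF cat hG k] Id_Hom[OF cat GH'(2)]])
      (simp_all add: act_Graph_Comp[OF hG k] act_Graph_Id pp' qq')
  ultimately show ?thesis
    using k GH by (intro is_isoI[OF h, of ?k]) (simp_all add: Hom_PathGraph)
qed

text \<open>A single arc is a path, so the path condition also excludes parallel arcs.\<close>

lemma PathGraph_edge_unique: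
  assumes G: "G \<in> Ob cat_PathGraph" and e: "e \<in> arcs G" "e' \<in> arcs G"
    and eq: "tail G e = tail G e'" "head G e = head G e'"
  shows "e = e'"
proof -
  have "wf_digraph G" using G by (simp add: Ob_PathGraph Ob_Graph)
  then have "pre_digraph.awalk G (tail G e) [e] (head G e)"
    using e by (simp add: pre_digraph.awalk_def pre_digraph.cas.simps wf_digraph_def)
  moreover have "unique_edge_along_paths G" using G by (simp add: Ob_PathGraph)
  ultimately have "\<exists>!d. d \<in> arcs G \<and> tail G d = tail G e \<and> head G d = head G e"
    unfolding unique_edge_along_paths_def by (metis list.discI)
  then show ?thesis using e eq by metis
qed

text \<open>Paths of two arcs make the relation of being joined by an arc transitive.\<close>

lemma PathGraph_edge_trans:
  assumes G: "G \<in> Ob cat_PathGraph" and e: "e \<in> arcs G" "e' \<in> arcs G" and eq: "head G e = tail G e'"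
  shows "\<exists>d \<in> arcs G. tail G d = tail G e \<and> head G d = head G e'"
proof -
  have "wf_digraph G" using G by (simp add: Ob_PathGraph Ob_Graph)
  then have "pre_digraph.awalk G (tail G e) [e, e'] (head G e')"
    using e eq by (simp add: pre_digraph.awalk_def pre_digraph.cas.simps wf_digraph_def)
  moreover have "unique_edge_along_paths G" using G by (simp add: Ob_PathGraph)
  ultimately have "\<exists>!d. d \<in> arcs G \<and> tail G d = tail G e \<and> head G d = head G e'"
    unfolding unique_edge_along_paths_def by (metis list.discI)
  then show ?thesis by blast
qed

section \<open>The graph of a transitive relation\<close>

definition arc_emb :: "nat \<times> nat \<Rightarrow> 'e::infinite" where
  "arc_emb e = nat_emb (prod_encode e)"

lemma inj_arc_emb: "inj arc_emb"
  by (auto simp: arc_emb_def inj_on_def)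

lemma arc_emb_eq [simp]: "arc_emb e = arc_emb e' \<longleftrightarrow> e = e'"
  using inj_arc_emb by (auto dest: injD)

lemma inv_arc_emb [simp]: "inv arc_emb (arc_emb e) = e"
  by (rule inv_f_f[OF inj_arc_emb])

text \<open>Vertices and arcs have unrelated infinite types, so numbers are coded into the one and
  pairs of numbers into the other. Tail and head are restricted because the objects of
  \<open>cat_Graph\<close> have extensional incidence functions.\<close>

definition rel_graph :: "nat set \<times> nat rel \<Rightarrow> ('v::infinite, 'e::infinite) pre_digraph" where
  "rel_graph X = \<lparr>verts = nat_emb ` fst X, arcs = arc_emb ` snd X,
     tail = restrict (\<lambda>e. nat_emb (fst (inv arc_emb e))) (arc_emb ` snd X),
     head = restrict (\<lambda>e. nat_emb (snd (inv arc_emb e))) (arc_emb ` snd X)\<rparr>"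

lemma verts_rel_graph: "verts (rel_graph X) = nat_emb ` fst X"
  and arcs_rel_graph: "arcs (rel_graph X) = arc_emb ` snd X"
  and tail_rel_graph: "e \<in> snd X \<Longrightarrow> tail (rel_graph X) (arc_emb e) = nat_emb (fst e)"
  and head_rel_graph: "e \<in> snd X \<Longrightarrow> head (rel_graph X) (arc_emb e) = nat_emb (snd e)"
  by (auto simp: rel_graph_def)

lemmas rel_graph_simps = verts_rel_graph arcs_rel_graph tail_rel_graph head_rel_graph

text \<open>Transitivity contracts a path to a single pair, by induction along the path. That the
  arcs belong to the graph is a separate hypothesis since \<open>cas\<close> checks only that
  consecutive ends match.\<close>

lemma cas_rel_graph:
  assumes "trans (snd X)" and "w \<noteq> []" "set w \<subseteq> arc_emb ` snd X" "pre_digraph.cas (rel_graph X) x w y"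
  shows "\<exists>e \<in> snd X. x = nat_emb (fst e) \<and> y = nat_emb (snd e)"
  using assms(2-4)
proof (induction w arbitrary: x)
  case (Cons c w)
  then obtain e where e: "e \<in> snd X" "c = arc_emb e" by auto
  have x: "x = nat_emb (fst e)"
    using Cons.prems e by (simp add: pre_digraph.cas.simps tail_rel_graph)
  have w: "pre_digraph.cas (rel_graph X) (nat_emb (snd e)) w y"
    using Cons.prems e by (simp add: pre_digraph.cas.simps head_rel_graph)
  show ?case
  proof (cases "w = []")
    case True
    then show ?thesis using w x e(1) by (auto simp: pre_digraph.cas.simps)
  next
    case False
    then obtain d where d: "d \<in> snd X" "(nat_emb (snd e) :: 'a) = nat_emb (fst d)" "y = nat_emb (snd d)"
      using Cons.IH[OF False _ w] Cons.prems by auto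
    then have "snd e = fst d" by simp
    then have "(fst e, snd e) \<in> snd X" "(snd e, snd d) \<in> snd X"
      using e(1) d(1) by (metis prod.collapse)+
    then have "(fst e, snd d) \<in> snd X"
      by (rule transD[OF assms(1)])
    then show ?thesis using x d(3) by (intro bexI[of _ "(fst e, snd d)"]) simp_all
  qed
qed simp

lemma rel_graph_Ob:
  assumes X: "X \<in> Ob cat_TransRel"
  shows "rel_graph X \<in> Ob (cat_PathGraph :: (('v::infinite, 'e::infinite) pre_digraph, _) category)"
proof -
  let ?G = "rel_graph X :: ('v, 'e) pre_digraph"
  have wf: "wf_digraph ?G"
    by unfold_locales (auto simp: rel_graph_simps dest: TransRel_Ob_subset[OF X] intro!: imageI)
  moreover have "fin_digraph ?G"
    using TransRel_Ob_finite[OF X] wf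
    by (simp add: fin_digraph_def fin_digraph_axioms_def rel_graph_simps)
  moreover have "tail ?G \<in> extensional (arcs ?G)" "head ?G \<in> extensional (arcs ?G)"
    by (auto simp: rel_graph_def)
  moreover have "unique_edge_along_paths ?G"
    unfolding unique_edge_along_paths_def
  proof (intro allI impI)
    fix x y w assume w: "pre_digraph.awalk ?G x w y \<and> w \<noteq> []"
    then obtain e where e: "e \<in> snd X" "x = nat_emb (fst e)" "y = nat_emb (snd e)"
      using cas_rel_graph[of X w x y] X
      by (auto simp: pre_digraph.awalk_def arcs_rel_graph Ob_TransRel)
    show "\<exists>!e. e \<in> arcs ?G \<and> tail ?G e = x \<and> head ?G e = y"
    proof (rule ex1I[of _ "arc_emb e"])
      show "arc_emb e \<in> arcs ?G \<and> tail ?G (arc_emb e) = x \<and> head ?G (arc_emb e) = y"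
        using e by (simp add: rel_graph_simps)
      fix d assume "d \<in> arcs ?G \<and> tail ?G d = x \<and> head ?G d = y"
      then show "d = arc_emb e"
        using e by (auto simp: rel_graph_simps)
    qed
  qed
  ultimately show ?thesis by (simp add: Ob_PathGraph Ob_Graph)
qed

definition rel_graph_functor ::
  "(nat set \<times> nat rel, nat rel_arrow,
    ('v::infinite, 'e::infinite) pre_digraph, ('v, 'e) graph_arrow) functor_data" where
  "rel_graph_functor = \<lparr>obj_map = rel_graph, arr_map = (\<lambda>(X, f, Y).
     (rel_graph X, (restrict (\<lambda>v. nat_emb (f (inv nat_emb v))) (verts (rel_graph X :: ('v, 'e) pre_digraph)),
       restrict (\<lambda>e. arc_emb (map_prod f f (inv arc_emb e))) (arcs (rel_graph X :: ('v, 'e) pre_digraph))),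
      rel_graph Y))\<rparr>"

lemma obj_rel_graph_functor [simp]: "obj_map rel_graph_functor = rel_graph"
  by (simp add: rel_graph_functor_def)

lemma rel_graph_functor_Hom:
  assumes h: "h \<in> Hom cat_TransRel X Y"
  shows "arr_map rel_graph_functor h \<in>
    Hom (cat_PathGraph :: (('v::infinite, 'e::infinite) pre_digraph, _) category) (rel_graph X) (rel_graph Y)"
proof -
  obtain f where f: "h = (X, f, Y)" using h by (auto simp: Hom_TransRel)
  note hD = TransRel_HomD[OF h, unfolded f act_simp]
  note XY = rel_graph_Ob[where ?'v = 'v and ?'e = 'e, OF hD(3)] rel_graph_Ob[where ?'v = 'v and ?'e = 'e, OF hD(4)]
  have e: "map_prod f f e \<in> snd Y" if "e \<in> snd X" for e
    using hD(2)[of "fst e" "snd e"] that by (simp add: map_prod_def split_beta)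
  have "arr_map (rel_graph_functor :: (_, _, ('v, 'e) pre_digraph, _) functor_data) h
      \<in> Hom cat_Graph (rel_graph X) (rel_graph Y)"
    unfolding f rel_graph_functor_def functor_data.simps prod.case
    using XY hD e
    by (intro Graph_HomI) (auto simp: Ob_PathGraph rel_graph_simps dest: e)
  then show ?thesis using XY by (simp add: Hom_PathGraph)
qed

lemma act_rel_graph_functor:
  assumes "h \<in> Hom cat_TransRel X Y"
  shows "a \<in> fst X \<Longrightarrow> fst (act (arr_map (rel_graph_functor :: (_, _, ('v::infinite, 'e::infinite) pre_digraph, _) functor_data) h)) (nat_emb a) = nat_emb (act h a)"
    and "e \<in> snd X \<Longrightarrow> snd (act (arr_map (rel_graph_functor :: (_, _, ('v::infinite, 'e::infinite) pre_digraph, _) functor_data) h)) (arc_emb e) = arc_emb (act h (fst e), act h (snd e))"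
  using assms
  by (auto simp: Hom_TransRel rel_graph_functor_def rel_graph_simps map_prod_def split_beta)

lemma is_functor_rel_graph:
  "is_functor cat_TransRel cat_PathGraph
    (rel_graph_functor :: (_, _, ('v::infinite, 'e::infinite) pre_digraph, _) functor_data)"
  (is "is_functor ?Q ?R ?F")
  unfolding is_functor_def obj_rel_graph_functor
proof (intro conjI ballI allI)
  note Q = is_category_TransRel
  have R: "is_category ?R" by (rule is_category_PathGraph)
  {
    fix X assume X: "X \<in> Ob ?Q"
    then show RX: "rel_graph X \<in> Ob ?R" by (rule rel_graph_Ob)
    note Id = Id_Hom[OF Q X]
    have H: "arr_map ?F (Id ?Q X) \<in> Hom cat_Graph (rel_graph X) (rel_graph X)"
      "Id ?R (rel_graph X) \<in> Hom cat_Graph (rel_graph X) (rel_graph X)"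
      using rel_graph_functor_Hom[OF Id] Id_Hom[OF R RX] unfolding Hom_PathGraph by blast+
    show "arr_map ?F (Id ?Q X) = Id ?R (rel_graph X)"
      using TransRel_Ob_subset[OF X]
      by (intro Graph_ext[OF H])
        (auto simp: rel_graph_simps act_rel_graph_functor[OF Id] act_TransRel_Id act_Graph_Id)
  next
    fix X Y h assume "h \<in> Hom ?Q X Y"
    then show "arr_map ?F h \<in> Hom ?R (rel_graph X) (rel_graph Y)" by (rule rel_graph_functor_Hom)
  next
    fix X Y Z h k assume h: "h \<in> Hom ?Q X Y" and k: "k \<in> Hom ?Q Y Z"
    let ?X = "rel_graph X :: ('v, 'e) pre_digraph"
    note kh = Comp_Hom[OF Q k h]
    have H: "arr_map ?F h \<in> Hom cat_Graph (rel_graph X) (rel_graph Y)"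
      "arr_map ?F k \<in> Hom cat_Graph (rel_graph Y) (rel_graph Z)"
      "arr_map ?F (Comp ?Q k h) \<in> Hom cat_Graph (rel_graph X) (rel_graph Z)"
      using rel_graph_functor_Hom[OF h] rel_graph_functor_Hom[OF k] rel_graph_functor_Hom[OF kh]
      unfolding Hom_PathGraph by blast+
    have "arr_map ?F (Comp ?Q k h) = Comp cat_Graph (arr_map ?F k) (arr_map ?F h)"
    proof (rule Graph_ext[OF H(3) Comp_Hom[OF is_category_Graph H(2,1)]])
      fix v :: 'v assume v: "v \<in> verts ?X"
      then obtain a where a: "a \<in> fst X" "v = nat_emb a" by (auto simp: rel_graph_simps)
      show "fst (act (arr_map ?F (Comp ?Q k h))) v =
          fst (act (Comp cat_Graph (arr_map ?F k) (arr_map ?F h))) v"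
        unfolding act_Graph_Comp(1)[OF H(2,1) v]
        using a TransRel_HomD(1)[OF h a(1)]
        by (simp add: act_rel_graph_functor(1)[OF kh] act_rel_graph_functor(1)[OF h]
            act_rel_graph_functor(1)[OF k] act_TransRel_Comp[OF k h])
    next
      fix e :: 'e assume e: "e \<in> arcs ?X"
      then obtain a b where a: "(a, b) \<in> snd X" "e = arc_emb (a, b)" by (auto simp: rel_graph_simps)
      show "snd (act (arr_map ?F (Comp ?Q k h))) e =
          snd (act (Comp cat_Graph (arr_map ?F k) (arr_map ?F h))) e"
        unfolding act_Graph_Comp(2)[OF H(2,1) e]
        using a TransRel_HomD(2)[OF h a(1)] TransRel_Ob_subset[OF TransRel_HomD(3)[OF h] a(1)]
        by (simp add: act_rel_graph_functor(2)[OF kh] act_rel_graph_functor(2)[OF h]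
            act_rel_graph_functor(2)[OF k] act_TransRel_Comp[OF k h])
    qed
    then show "arr_map ?F (Comp ?Q k h) = Comp ?R (arr_map ?F k) (arr_map ?F h)" by simp
  }
qed

text \<open>An arc of \<open>rel_graph Y\<close> is the code of its ends, so the arc component of a
  graph morphism is forced by its vertex component, and the existence of the arc says that the
  vertex component respects the relation.\<close>

lemma fully_faithful_rel_graph:
  "fully_faithful cat_TransRel cat_PathGraph
    (rel_graph_functor :: (_, _, ('v::infinite, 'e::infinite) pre_digraph, _) functor_data)"
  (is "fully_faithful ?Q ?R ?F")
  unfolding fully_faithful_def obj_rel_graph_functor
proof (intro conjI ballI is_functor_rel_graph bij_betw_imageI)
  fix X Y assume X: "X \<in> Ob ?Q" and Y: "Y \<in> Ob ?Q"
  let ?X = "rel_graph X :: ('v, 'e) pre_digraph"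
  show "inj_on (arr_map ?F) (Hom ?Q X Y)"
  proof (rule inj_onI)
    fix h h' assume h: "h \<in> Hom ?Q X Y" "h' \<in> Hom ?Q X Y" and eq: "arr_map ?F h = arr_map ?F h'"
    have "act h a = act h' a" if a: "a \<in> fst X" for a
    proof -
      have "(nat_emb (act h a) :: 'v) = nat_emb (act h' a)"
        using act_rel_graph_functor(1)[where ?'v = 'v and ?'e = 'e, OF h(1) a]
          act_rel_graph_functor(1)[where ?'v = 'v and ?'e = 'e, OF h(2) a] eq by simp
      then show ?thesis by simp
    qed
    then show "h = h'" by (rule TransRel_ext[OF h])
  qed
  show "arr_map ?F ` Hom ?Q X Y = Hom ?R (rel_graph X) (rel_graph Y)"
  proof (intro subset_antisym subsetI)
    fix g assume "g \<in> arr_map ?F ` Hom ?Q X Y"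
    then show "g \<in> Hom ?R (rel_graph X) (rel_graph Y)" using rel_graph_functor_Hom by blast
  next
    fix g assume "g \<in> Hom ?R (rel_graph X) (rel_graph Y)"
    then have g: "g \<in> Hom cat_Graph (rel_graph X) (rel_graph Y)" by (simp add: Hom_PathGraph)
    define f where "f a = inv nat_emb (fst (act g) (nat_emb a))" for a
    have gf: "fst (act g) (nat_emb a) = nat_emb (f a)" "f a \<in> fst Y" if "a \<in> fst X" for a
      using Graph_HomD(3)[OF g, of "nat_emb a"] that by (auto simp: rel_graph_simps f_def)
    have edge: "(f a, f b) \<in> snd Y" "snd (act g) (arc_emb (a, b)) = arc_emb (f a, f b)"
      if ab: "(a, b) \<in> snd X" for a b
    proof -
      have "arc_emb (a, b) \<in> arcs ?X"
        using ab by (simp add: rel_graph_simps)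
      note e = Graph_HomD(4-6)[OF g this]
      obtain c d where cd: "(c, d) \<in> snd Y" "snd (act g) (arc_emb (a, b)) = arc_emb (c, d)"
        using e(1) by (auto simp: rel_graph_simps)
      have "f a = c" "f b = d"
        using e(2,3) cd ab TransRel_Ob_subset[OF X ab] by (simp_all add: rel_graph_simps gf)
      then show "(f a, f b) \<in> snd Y" "snd (act g) (arc_emb (a, b)) = arc_emb (f a, f b)"
        using cd by simp_all
    qed
    have h: "(X, restrict f (fst X), Y) \<in> Hom ?Q X Y"
      by (rule TransRel_HomI[OF X Y gf(2) edge(1)])
    have "arr_map ?F (X, restrict f (fst X), Y) \<in> Hom cat_Graph (rel_graph X) (rel_graph Y)"
      using rel_graph_functor_Hom[where ?'v = 'v and ?'e = 'e, OF h] by (simp add: Hom_PathGraph)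
    then have "arr_map ?F (X, restrict f (fst X), Y) = g"
    proof (rule Graph_ext[OF _ g])
      fix v :: 'v assume "v \<in> verts ?X"
      then show "fst (act (arr_map ?F (X, restrict f (fst X), Y))) v = fst (act g) v"
        by (auto simp: rel_graph_simps act_rel_graph_functor(1)[OF h] gf)
    next
      fix e :: 'e assume "e \<in> arcs ?X"
      then show "snd (act (arr_map ?F (X, restrict f (fst X), Y))) e = snd (act g) e"
        using TransRel_Ob_subset[OF X] by (auto simp: rel_graph_simps act_rel_graph_functor(2)[OF h] edge)
    qed
    then show "g \<in> arr_map ?F ` Hom ?Q X Y" using h by blast
  qed
qed

text \<open>Numbering the vertices turns arcs into pairs of numbers. Nothing is lost because
  parallel arcs coincide, and paths of two arcs make the resulting relation transitive.\<close>

lemma essentially_surjective_rel_graph: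
  "essentially_surjective cat_TransRel cat_PathGraph
    (rel_graph_functor :: (_, _, ('v::infinite, 'e::infinite) pre_digraph, _) functor_data)"
  (is "essentially_surjective ?Q ?R ?F")
  unfolding essentially_surjective_def obj_rel_graph_functor
proof
  fix G assume G: "G \<in> Ob ?R"
  have wf: "wf_digraph G" and finv: "finite (verts G)"
    using G by (auto simp: Ob_PathGraph fin_digraph_def fin_digraph_axioms_def)
  have GV: "tail G e \<in> verts G" "head G e \<in> verts G" if "e \<in> arcs G" for e
    using wf that by (auto simp: wf_digraph_def)
  obtain n :: "'v \<Rightarrow> nat" where n: "inj_on n (verts G)"
    using finite_imp_inj_to_nat_seg[OF finv] by blast
  define m where "m e = (n (tail G e), n (head G e))" for e
  define X where "X = (n ` verts G, m ` arcs G)"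
  have m_inj: "inj_on m (arcs G)"
  proof (rule inj_onI)
    fix e e' assume e: "e \<in> arcs G" "e' \<in> arcs G" "m e = m e'"
    then have "tail G e = tail G e'" "head G e = head G e'"
      using inj_onD[OF n] GV by (auto simp: m_def)
    then show "e = e'" by (rule PathGraph_edge_unique[OF G e(1,2)])
  qed
  have "trans (snd X)"
  proof (rule transI)
    fix x y z assume "(x, y) \<in> snd X" "(y, z) \<in> snd X"
    then obtain e e' where e: "e \<in> arcs G" "e' \<in> arcs G" "x = n (tail G e)" "y = n (head G e)"
      "n (head G e) = n (tail G e')" "z = n (head G e')"
      by (auto simp: X_def m_def)
    then have "head G e = tail G e'" using inj_onD[OF n] GV by blast
    then obtain d where d: "d \<in> arcs G" "tail G d = tail G e" "head G d = head G e'"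
      using PathGraph_edge_trans[OF G e(1,2)] by blast
    then have "(x, z) = m d" using e by (simp add: m_def)
    then show "(x, z) \<in> snd X" using d(1) by (simp add: X_def)
  qed
  then have X: "X \<in> Ob ?Q"
    using finv GV by (auto simp: Ob_TransRel X_def m_def)
  let ?X = "rel_graph X :: ('v, 'e) pre_digraph"
  let ?p = "\<lambda>v :: 'v. inv_into (verts G) n (inv nat_emb v)"
  let ?q = "\<lambda>e :: 'e. inv_into (arcs G) m (inv arc_emb e)"
  have inv: "inv_into (verts G) n (n v) = v" if "v \<in> verts G" for v using n that by simp
  have inv': "inv_into (arcs G) m (m e) = e" if "e \<in> arcs G" for e using m_inj that by simp
  note RX = rel_graph_Ob[where ?'v = 'v and ?'e = 'e, OF X]
  have vs: "verts ?X = (\<lambda>v. nat_emb (n v)) ` verts G"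
    and es: "arcs ?X = (\<lambda>e. arc_emb (m e)) ` arcs G"
    by (auto simp: rel_graph_simps X_def)
  have th: "tail ?X (arc_emb (m e)) = nat_emb (n (tail G e))"
    "head ?X (arc_emb (m e)) = nat_emb (n (head G e))"
    if "e \<in> arcs G" for e
    using tail_rel_graph[of "m e" X] head_rel_graph[of "m e" X] that by (auto simp: X_def m_def)
  have bp: "bij_betw ?p (verts ?X) (verts G)"
    by (rule bij_betwI[where g = "\<lambda>v. nat_emb (n v)"]) (auto simp: vs inv)
  have bq: "bij_betw ?q (arcs ?X) (arcs G)"
    by (rule bij_betwI[where g = "\<lambda>e. arc_emb (m e)"]) (auto simp: es inv')
  have "(?X, (restrict ?p (verts ?X), restrict ?q (arcs ?X)), G) \<in> Hom cat_Graph ?X G"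
    using G RX by (intro Graph_HomI) (auto simp: vs es inv inv' th GV Ob_PathGraph)
  then have h: "(?X, (restrict ?p (verts ?X), restrict ?q (arcs ?X)), G) \<in> Hom ?R ?X G"
    using G RX by (simp add: Hom_PathGraph)
  show "\<exists>X \<in> Ob ?Q. \<exists>i \<in> Hom ?R (rel_graph X) G. is_iso ?R i"
    using X h Graph_isoI[OF h bp bq] by blast
qed

theorem theorem15:
  shows "(\<exists>y. is_free_conservative_finite_cocompletion TYPE(('c, 'd) category) cat_L
              (cat_TransRel :: ('a::infinite set \<times> 'a rel, _) category) y) \<and>
         (\<forall>(P :: ('o, 'm) category) y.
            is_free_conservative_finite_cocompletion TYPE(('o, 'm) category) cat_L P y \<longrightarrow>
            equivalent_categories P
              (cat_PathGraph :: (('v::infinite, 'e::infinite) pre_digraph, _) category) \<and>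
            equivalent_categories P
              (cat_TransRel :: ('a::infinite set \<times> 'a rel, _) category))"
proof (intro conjI allI impI)
  show "\<exists>y. is_free_conservative_finite_cocompletion TYPE(('c, 'd) category) cat_L
      (cat_TransRel :: ('a set \<times> 'a rel, _) category) y"
    using TransRel_free_cocompletion by blast
  fix P :: "('o, 'm) category" and y
  assume P: "is_free_conservative_finite_cocompletion TYPE(('o, 'm) category) cat_L P y"
  \<comment> \<open>Relations on \<open>nat\<close> are the common intermediate: \<open>P\<close> is
    equivalent to them, and they are equivalent to both required categories.\<close>
  note Pnat = free_cocompletion_equivalent_TransRel_nat[OF P]
  show "equivalent_categories P (cat_PathGraph :: (('v, 'e) pre_digraph, _) category)"
    by (rule equivalent_categories_trans[OF Pnat equivalent_categoriesI[OF is_category_TransRel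
            is_category_PathGraph fully_faithful_rel_graph essentially_surjective_rel_graph]])
  show "equivalent_categories P (cat_TransRel :: ('a set \<times> 'a rel, _) category)"
    by (rule equivalent_categories_trans[OF Pnat TransRel_nat_equivalent_TransRel])
qed

end
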